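(* There is an absolute constant $C>0$ such that for every prime $q$, the number $m_4(-q)$ of quartic number fields (up to isomorphism) of discriminant $-q$ satisfies $$m_4(-q)\le C\,q^{7/8}\log^4 q.$$ *)

theory Defs
  imports
    Complex_Main
    "HOL-Computational_Algebra.Computational_Algebra"
    "HOL-Algebra.Algebraic_Closure_Type"
    "Jordan_Normal_Form.Determinant"
begin

global_interpretation rat_vs: Vector_Spaces.vector_space "\<lambda>(a::rat) (z::complex). of_rat a * z"
  by unfold_locales (auto simp: algebra_simps of_rat_add of_rat_mult)

global_interpretation int_mod: Modules.module "\<lambda>(k::int) (z::complex). of_int k * z"
  by unfold_locales (auto simp: algebra_simps)

text \<open>
  Every number field embeds into the complex numbers, so number fields up to isomorphism are
  represented by the subfields of the complex numbers that have finite degree over the rationals.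
\<close>

abbreviation complex_field :: "complex ring" where
  "complex_field \<equiv> ring_of_type_algebra"

definition number_field :: "complex set \<Rightarrow> bool" where
  "number_field K \<longleftrightarrow> subfield K complex_field \<and> (\<exists>B. finite B \<and> rat_vs.span B = K)"

definition nf_degree :: "complex set \<Rightarrow> nat" where
  "nf_degree K = rat_vs.dim K"

definition nf_basis :: "complex set \<Rightarrow> complex set" where
  "nf_basis K = (SOME B. rat_vs.independent B \<and> rat_vs.span B = K)"

text \<open>
  The trace of the rational linear map \<open>y \<mapsto> x * y\<close> on \<open>K\<close>: the sum of the diagonal entries of its
  matrix, which does not depend on the basis.
\<close>

definition nf_trace :: "complex set \<Rightarrow> complex \<Rightarrow> rat" where
  "nf_trace K x = (\<Sum>b\<in>nf_basis K. rat_vs.representation (nf_basis K) (x * b) b)"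

definition ring_of_integers :: "complex set \<Rightarrow> complex set" where
  "ring_of_integers K = {x \<in> K. algebraic_int x}"

definition integral_basis :: "complex set \<Rightarrow> complex list \<Rightarrow> bool" where
  "integral_basis K bs \<longleftrightarrow>
     distinct bs \<and> int_mod.independent (set bs) \<and> int_mod.span (set bs) = ring_of_integers K"

definition trace_discriminant :: "complex set \<Rightarrow> complex list \<Rightarrow> rat" where
  "trace_discriminant K bs =
     det (mat (length bs) (length bs) (\<lambda>(i, j). nf_trace K (bs ! i * bs ! j)))"

text \<open>The value does not depend on the choice of the integral basis.\<close>

definition nf_discriminant :: "complex set \<Rightarrow> rat" where
  "nf_discriminant K = trace_discriminant K (SOME bs. integral_basis K bs)"

definition nf_iso :: "(complex set \<times> complex set) set" where
  "nf_iso = {(K, L). number_field K \<and> number_field L \<and>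
     complex_field\<lparr>carrier := K\<rparr> \<simeq> complex_field\<lparr>carrier := L\<rparr>}"

definition nf_classes :: "nat \<Rightarrow> int \<Rightarrow> complex set set set" where
  "nf_classes n d =
     {K. number_field K \<and> nf_degree K = n \<and> nf_discriminant K = of_int d} // nf_iso"

definition nf_count :: "nat \<Rightarrow> int \<Rightarrow> nat" where
  "nf_count n d = card (nf_classes n d)"

end

theory Submission
  imports "HOL-Analysis.Analysis" "Jordan_Normal_Form.Char_Poly" Defs
begin

text \<open>
  Since its discriminant is negative, a quartic field \<open>K\<close> of discriminant \<open>-q\<close> has two real
  embeddings and one pair of complex ones. Minkowski's theorem on linear forms gives an irrational
  integer of \<open>K\<close> all of whose conjugates, after removing the trace, are \<open>O(q\<^sup>1\<^sup>/\<^sup>6)\<close>. It generates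
  \<open>K\<close>: a cubic subfield is impossible, and a quadratic subfield generated by a square root of a
  squarefree \<open>D\<close> would force \<open>D\<^sup>2\<close> to divide the prime \<open>q\<close>. Its characteristic polynomial is
  \<open>x\<^sup>4 + a x\<^sup>2 + b x + c\<close> with \<open>a\<close>, \<open>b\<close>, \<open>c\<close> of size \<open>O(q\<^sup>1\<^sup>/\<^sup>3)\<close>, \<open>O(q\<^sup>1\<^sup>/\<^sup>2)\<close>, \<open>O(q\<^sup>2\<^sup>/\<^sup>3)\<close>, and \<open>q\<close>
  divides its discriminant, which is a cubic polynomial in \<open>c\<close> with leading coefficient 256. So
  \<open>a\<close> and \<open>b\<close> leave at most three residues of \<open>c\<close> modulo \<open>q\<close>, hence boundedly many \<open>c\<close>, and the
  number of fields is even \<open>O(q\<^sup>5\<^sup>/\<^sup>6)\<close>.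
\<close>

text \<open>The exponent 1/6 is a matter of covolume. In the trace and three real forms that vanish
  on the rationals, the integers of the field form a lattice of determinant
  \<open>4 * sqrt q\<close>. With the trace bounded by a constant, \<open>sqrt q\<close> is shared
  equally by the other three forms. Without a bound on the trace the short vector could be a
  rational integer, which generates nothing. The polynomial discriminant is
  \<open>- q * n^2\<close>, with \<open>n\<close> the index of the order generated by the small
  integer, hence the divisibility by \<open>q\<close>. The interval for \<open>c\<close> has length
  \<open>20000 * q^(2/3)\<close>, which is below \<open>q\<close> once \<open>q\<close> exceeds
  \<open>8 * 10^12\<close>; then a residue of \<open>c\<close> determines \<open>c\<close>. Smaller
  primes, among them 2, where 256 is not invertible, only affect the constant. The quartic
  determines the field up to isomorphism because its roots are conjugate, so counting triples
  \<open>(a, b, c)\<close> counts fields. The definitions speak of traces in a chosen basis and of a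
  chosen integral basis. Much of the proof ties them to embeddings: the trace is the sum of the
  conjugates, the discriminant is the square of a determinant of conjugates, and an integral basis
  exists.\<close>

hide_const (open) Finite_Cartesian_Product.mat Finite_Cartesian_Product.vec
  Finite_Cartesian_Product.row Determinants.det Polynomials.lead_coeff Polynomials.degree
  up_ring.coeff up_ring.monom Module.smult Divisibility.prime Fraction_Field.Fract

section \<open>Algebraic integers\<close>

lemma algebraic_int_of_eigenvalue:
  fixes A :: "int mat" and z :: complex
  assumes A: "A \<in> carrier_mat n n" and ev: "eigenvalue (map_mat of_int A) z"
  shows "algebraic_int z"
proof -
  have A': "map_mat of_int A \<in> carrier_mat n n" using A by simp
  have "poly (char_poly (map_mat of_int A)) z = 0"
    using ev unfolding eigenvalue_root_char_poly[OF A'] .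
  moreover have "char_poly (map_mat of_int A) = map_poly (of_int :: int \<Rightarrow> complex) (char_poly A)"
    by (rule of_int_hom.char_poly_hom[OF A])
  moreover have "lead_coeff (char_poly A) = 1"
    using degree_monic_char_poly[OF A] by simp
  ultimately show ?thesis
    by (auto simp: algebraic_int_altdef_ipoly)
qed

text \<open>Multiplication by \<open>z\<close> acts on the listed elements of \<open>W\<close>
  through an integer matrix, and the list itself is an eigenvector for \<open>z\<close>; the element
  \<open>w\<close> keeps that vector nonzero.\<close>

lemma algebraic_int_of_stable_span:
  fixes z :: complex
  assumes fin: "finite W" and w: "w \<in> W" "w \<noteq> 0"
    and st: "\<And>v. v \<in> W \<Longrightarrow> z * v \<in> int_mod.span W"
  shows "algebraic_int z"
proof -
  obtain ws where ws: "set ws = W" "distinct ws"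
    using finite_distinct_list[OF fin] by blast
  define n where "n = length ws"
  have "\<exists>u. z * v = (\<Sum>x\<in>W. of_int (u x) * x)" if "v \<in> W" for v
    using st[OF that] fin by (auto simp: int_mod.span_finite)
  then obtain u where u: "\<And>v. v \<in> W \<Longrightarrow> z * v = (\<Sum>x\<in>W. of_int (u v x) * x)"
    by metis
  define A where "A = mat n n (\<lambda>(i, j). u (ws ! i) (ws ! j))"
  have A: "A \<in> carrier_mat n n" by (simp add: A_def)
  define v where "v = vec n (\<lambda>i. ws ! i)"
  have bij: "bij_betw (\<lambda>j. ws ! j) {0..<n} W"
    using ws by (auto simp: n_def bij_betw_def inj_on_def nth_eq_iff_index_eq set_conv_nth)
  have "map_mat of_int A *\<^sub>v v = z \<cdot>\<^sub>v v"
  proof (rule eq_vecI)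
    fix i assume "i < dim_vec (z \<cdot>\<^sub>v v)"
    hence i: "i < n" by (simp add: v_def)
    hence iW: "ws ! i \<in> W" using ws by (auto simp: n_def)
    have "(map_mat of_int A *\<^sub>v v) $ i = (\<Sum>j = 0..<n. of_int (u (ws ! i) (ws ! j)) * ws ! j)"
      using i by (simp add: A_def v_def scalar_prod_def)
    also have "\<dots> = (\<Sum>x\<in>W. of_int (u (ws ! i) x) * x)"
      by (rule sum.reindex_bij_betw[OF bij])
    finally show "(map_mat of_int A *\<^sub>v v) $ i = (z \<cdot>\<^sub>v v) $ i"
      using i u[OF iW] by (simp add: v_def)
  qed (simp add: A_def v_def)
  moreover have "v \<noteq> 0\<^sub>v n"
  proof
    assume v0: "v = 0\<^sub>v n"
    obtain j where "j < n" "ws ! j = w" using w ws by (metis in_set_conv_nth n_def)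
    hence "v $ j = w" by (simp add: v_def)
    thus False using v0 \<open>j < n\<close> w by simp
  qed
  ultimately have "eigenvalue (map_mat of_int A) z"
    unfolding eigenvalue_def eigenvector_def using A by (intro exI[of _ v]) (simp add: v_def)
  thus ?thesis by (rule algebraic_int_of_eigenvalue[OF A])
qed

lemma algebraic_int_top_power_in_span:
  fixes x :: complex
  assumes "algebraic_int x"
  obtains m where "m > 0" "x ^ m \<in> int_mod.span ((\<lambda>i. x ^ i) ` {..<m})"
proof -
  obtain p where p: "poly (map_poly of_int p) x = 0" "lead_coeff p = (1::int)"
    using assms by (auto simp: algebraic_int_altdef_ipoly)
  define m where "m = degree p"
  have sum0: "(\<Sum>i\<le>m. of_int (coeff p i) * x ^ i) = 0"
    using p by (simp add: poly_altdef m_def)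
  have "m > 0"
  proof (rule ccontr)
    assume "\<not> m > 0"
    with sum0 p show False by (simp add: m_def)
  qed
  have "{..m} = insert m {..<m}" by auto
  hence "x ^ m = - (\<Sum>i<m. of_int (coeff p i) * x ^ i)"
    using sum0 p by (simp add: m_def eq_neg_iff_add_eq_0)
  also have "\<dots> \<in> int_mod.span ((\<lambda>i. x ^ i) ` {..<m})"
    by (intro int_mod.span_neg int_mod.span_sum int_mod.span_scale int_mod.span_base) auto
  finally show ?thesis using that \<open>m > 0\<close> by blast
qed

lemma span_mult_stable:
  fixes x :: complex
  assumes "\<And>w. w \<in> W \<Longrightarrow> x * w \<in> int_mod.span W" "v \<in> int_mod.span W"
  shows "x * v \<in> int_mod.span W"
  using assms(2)
proof (induction rule: int_mod.span_induct_alt)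
  case (step c w v)
  have "x * (of_int c * w + v) = of_int c * (x * w) + x * v" by (simp add: algebra_simps)
  thus ?case using step assms(1) by (simp add: int_mod.span_add int_mod.span_scale)
qed (auto simp: int_mod.span_zero)

text \<open>The products \<open>x ^ i * y ^ j\<close> below the degrees of the monic equations of
  \<open>x\<close> and \<open>y\<close> span a module that is stable under both \<open>x\<close> and
  \<open>y\<close>, hence under their sum and product.\<close>

lemma
  fixes x y :: complex
  assumes x: "algebraic_int x" and y: "algebraic_int y"
  shows algebraic_int_add: "algebraic_int (x + y)"
    and algebraic_int_mult: "algebraic_int (x * y)"
proof -
  obtain m where m: "m > 0" "x ^ m \<in> int_mod.span ((\<lambda>i. x ^ i) ` {..<m})"
    using algebraic_int_top_power_in_span[OF x] by blast
  obtain n where n: "n > 0" "y ^ n \<in> int_mod.span ((\<lambda>i. y ^ i) ` {..<n})"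
    using algebraic_int_top_power_in_span[OF y] by blast
  define W where "W = (\<lambda>(i, j). x ^ i * y ^ j) ` ({..<m} \<times> {..<n})"
  have fin: "finite W" by (simp add: W_def)
  have W1: "1 \<in> W" using m n by (force simp: W_def)
  have WI: "x ^ i * y ^ j \<in> W" if "i < m" "j < n" for i j
    using that by (force simp: W_def)
  have xm: "x ^ m * y ^ j \<in> int_mod.span W" if "j < n" for j
  proof -
    have "y ^ j * v \<in> int_mod.span W" if "v \<in> int_mod.span ((\<lambda>i. x ^ i) ` {..<m})" for v
      using that
    proof (induction rule: int_mod.span_induct_alt)
      case (step c w v)
      have "y ^ j * (of_int c * w + v) = of_int c * (w * y ^ j) + y ^ j * v"
        by (simp add: algebra_simps)
      moreover have "w * y ^ j \<in> int_mod.span W"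
        using step(1) WI \<open>j < n\<close> by (auto intro: int_mod.span_base)
      ultimately show ?case using step by (simp add: int_mod.span_add int_mod.span_scale)
    qed (auto simp: int_mod.span_zero)
    from this[OF m(2)] show ?thesis by (simp add: mult.commute)
  qed
  have yn: "x ^ i * y ^ n \<in> int_mod.span W" if "i < m" for i
  proof -
    have "x ^ i * v \<in> int_mod.span W" if "v \<in> int_mod.span ((\<lambda>i. y ^ i) ` {..<n})" for v
      using that
    proof (induction rule: int_mod.span_induct_alt)
      case (step c w v)
      have "x ^ i * (of_int c * w + v) = of_int c * (x ^ i * w) + x ^ i * v"
        by (simp add: algebra_simps)
      moreover have "x ^ i * w \<in> int_mod.span W"
        using step(1) WI \<open>i < m\<close> by (auto intro: int_mod.span_base)
      ultimately show ?case using step by (simp add: int_mod.span_add int_mod.span_scale)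
    qed (auto simp: int_mod.span_zero)
    from this[OF n(2)] show ?thesis .
  qed
  have xW: "x * w \<in> int_mod.span W" if "w \<in> W" for w
  proof -
    obtain i j where ij: "i < m" "j < n" "w = x ^ i * y ^ j" using \<open>w \<in> W\<close> by (auto simp: W_def)
    have eq: "x * w = x ^ Suc i * y ^ j" using ij by (simp add: algebra_simps)
    show ?thesis
    proof (cases "Suc i = m")
      case True thus ?thesis using xm[OF ij(2)] unfolding eq by simp
    next
      case False thus ?thesis using WI[of "Suc i" j] ij unfolding eq by (simp add: int_mod.span_base)
    qed
  qed
  have yW: "y * w \<in> int_mod.span W" if "w \<in> W" for w
  proof -
    obtain i j where ij: "i < m" "j < n" "w = x ^ i * y ^ j" using \<open>w \<in> W\<close> by (auto simp: W_def)
    have eq: "y * w = x ^ i * y ^ Suc j" using ij by (simp add: algebra_simps)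
    show ?thesis
    proof (cases "Suc j = n")
      case True thus ?thesis using yn[OF ij(1)] unfolding eq by simp
    next
      case False thus ?thesis using WI[of i "Suc j"] ij unfolding eq by (simp add: int_mod.span_base)
    qed
  qed
  show "algebraic_int (x + y)"
    by (rule algebraic_int_of_stable_span[OF fin W1])
       (auto simp: distrib_right intro: int_mod.span_add xW yW)
  show "algebraic_int (x * y)"
    by (rule algebraic_int_of_stable_span[OF fin W1])
       (auto simp: mult.assoc intro: span_mult_stable[OF xW] yW)
qed

lemma algebraic_int_diff: "algebraic_int x \<Longrightarrow> algebraic_int y \<Longrightarrow> algebraic_int (x - y)"
  for x y :: complex
  using algebraic_int_add[of x "- y"] by simp

lemma algebraic_int_sum:
  fixes f :: "'a \<Rightarrow> complex"
  shows "(\<And>i. i \<in> I \<Longrightarrow> algebraic_int (f i)) \<Longrightarrow> algebraic_int (sum f I)"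
  by (induction I rule: infinite_finite_induct) (auto intro: algebraic_int_add)

lemma algebraic_int_power: "algebraic_int x \<Longrightarrow> algebraic_int (x ^ n)" for x :: complex
  by (induction n) (auto intro: algebraic_int_mult)

section \<open>Quartic fields and their generators\<close>

definition qeval :: "rat poly \<Rightarrow> complex \<Rightarrow> complex" where
  "qeval p x = poly (map_poly of_rat p) x"

lemma qeval_0 [simp]: "qeval 0 x = 0"
  by (simp add: qeval_def)

lemma qeval_pCons [simp]: "qeval (pCons a p) x = of_rat a + x * qeval p x"
  unfolding qeval_def by (subst Polynomial.map_poly_pCons) simp_all

lemma qeval_1 [simp]: "qeval 1 x = 1"
  by (simp add: one_pCons)

lemma qeval_add [simp]: "qeval (p + q) x = qeval p x + qeval q x"
  by (induction p q rule: poly_induct2) (auto simp: algebra_simps of_rat_add)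

lemma qeval_minus [simp]: "qeval (- p) x = - qeval p x"
  using qeval_add[of p "- p" x] by (simp add: add_eq_0_iff)

lemma qeval_diff [simp]: "qeval (p - q) x = qeval p x - qeval q x"
  using qeval_add[of p "- q" x] by simp

lemma qeval_smult [simp]: "qeval (Polynomial.smult a p) x = of_rat a * qeval p x"
  by (induction p) (auto simp: algebra_simps of_rat_mult)

lemma qeval_mult [simp]: "qeval (p * q) x = qeval p x * qeval q x"
  by (induction p) (auto simp: algebra_simps)

lemma qeval_sum: "qeval (sum f I) x = (\<Sum>i\<in>I. qeval (f i) x)"
  by (induction I rule: infinite_finite_induct) auto

lemma qeval_monom [simp]: "qeval (Polynomial.monom a n) x = of_rat a * x ^ n"
  by (induction n) (auto simp: monom_0 monom_Suc)

lemma qeval_pcompose: "qeval (pcompose p q) x = qeval p (qeval q x)"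
  by (induction p) (auto simp: pcompose_pCons)

lemma cnj_of_rat [simp]: "cnj (of_rat a) = of_rat a"
  by (cases a) (simp add: of_rat_rat)

lemma qeval_cnj: "cnj (qeval p x) = qeval p (cnj x)"
  by (induction p) auto

lemma qeval_altdef: "degree p < n \<Longrightarrow> qeval p x = (\<Sum>i<n. of_rat (coeff p i) * x ^ i)"
proof -
  assume "degree p < n"
  hence "p = (\<Sum>i<n. Polynomial.monom (coeff p i) i)"
    by (intro poly_eqI) (auto simp: coeff_sum coeff_eq_0)
  hence "qeval p x = qeval (\<Sum>i<n. Polynomial.monom (coeff p i) i) x" by simp
  thus ?thesis by (simp add: qeval_sum)
qed

lemma span_powers:
  assumes "n > 0"
  shows "rat_vs.span ((\<lambda>i. x ^ i) ` {..<n}) = {qeval p x |p. degree p < n}"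
proof (intro equalityI subsetI)
  fix v assume "v \<in> rat_vs.span ((\<lambda>i. x ^ i) ` {..<n})"
  thus "v \<in> {qeval p x |p. degree p < n}"
  proof (induction rule: rat_vs.span_induct_alt)
    case base
    show ?case using assms by (intro CollectI exI[of _ 0]) auto
  next
    case (step c w v)
    then obtain i p where i: "i < n" "w = x ^ i" and p: "v = qeval p x" "degree p < n" by auto
    have "degree (Polynomial.monom c i + p) < n"
      using i p by (meson degree_add_less degree_monom_le le_less_trans)
    moreover have "of_rat c * w + v = qeval (Polynomial.monom c i + p) x" using i p by simp
    ultimately show ?case by blast
  qed
next
  fix v assume "v \<in> {qeval p x |p. degree p < n}"
  then obtain p where p: "v = qeval p x" "degree p < n" by blast
  have "(\<Sum>i<n. of_rat (coeff p i) * x ^ i) \<in> rat_vs.span ((\<lambda>i. x ^ i) ` {..<n})"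
    by (intro rat_vs.span_sum rat_vs.span_scale rat_vs.span_base) auto
  thus "v \<in> rat_vs.span ((\<lambda>i. x ^ i) ` {..<n})"
    using p by (simp add: qeval_altdef)
qed

text \<open>The hypothesis says that \<open>x\<close> has degree at least \<open>n\<close> over the
  rationals. Degrees of elements are expressed in this way throughout, without minimal
  polynomials.\<close>

lemma powers_independent:
  assumes no: "\<And>p. degree p < n \<Longrightarrow> qeval p x = 0 \<Longrightarrow> p = 0"
  shows "inj_on (\<lambda>i. x ^ i) {..<n}" "rat_vs.independent ((\<lambda>i. x ^ i) ` {..<n})"
proof -
  show inj: "inj_on (\<lambda>i. x ^ i) {..<n}"
  proof (rule inj_onI)
    fix i j assume ij: "i \<in> {..<n}" "j \<in> {..<n}" "x ^ i = x ^ j"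
    have "degree (Polynomial.monom (1::rat) i - Polynomial.monom 1 j) < n"
      using ij by (intro degree_diff_less) (auto simp: degree_monom_eq)
    moreover have "qeval (Polynomial.monom 1 i - Polynomial.monom 1 j) x = 0" using ij by simp
    ultimately have "Polynomial.monom (1::rat) i = Polynomial.monom 1 j" using no by force
    thus "i = j" by (simp add: monom_eq_iff')
  qed
  show "rat_vs.independent ((\<lambda>i. x ^ i) ` {..<n})"
  proof
    assume "rat_vs.dependent ((\<lambda>i. x ^ i) ` {..<n})"
    then obtain u where u: "\<exists>v\<in>(\<lambda>i. x ^ i) ` {..<n}. u v \<noteq> 0"
        "(\<Sum>v\<in>(\<lambda>i. x ^ i) ` {..<n}. of_rat (u v) * v) = 0"
      by (subst (asm) rat_vs.dependent_finite) auto
    define p where "p = (\<Sum>i<n. Polynomial.monom (u (x ^ i)) i)"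
    obtain k where k: "k < n" "u (x ^ k) \<noteq> 0" using u(1) by auto
    have coeff_p: "coeff p i = (if i < n then u (x ^ i) else 0)" for i
      by (auto simp: p_def coeff_sum)
    have "p \<noteq> 0" using coeff_p[of k] k by auto
    moreover have "degree p < n"
      using k coeff_p by (metis \<open>p \<noteq> 0\<close> leading_coeff_neq_0)
    moreover have "qeval p x = 0"
      using u(2) by (simp add: p_def qeval_sum sum.reindex[OF inj])
    ultimately show False using no by blast
  qed
qed

lemma number_field_closed:
  assumes "number_field K"
  shows "0 \<in> K" "1 \<in> K"
    and "x \<in> K \<Longrightarrow> y \<in> K \<Longrightarrow> x + y \<in> K"
    and "x \<in> K \<Longrightarrow> y \<in> K \<Longrightarrow> x * y \<in> K"
    and "x \<in> K \<Longrightarrow> y \<in> K \<Longrightarrow> x - y \<in> K"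
    and "x \<in> K \<Longrightarrow> - x \<in> K"
    and "x \<in> K \<Longrightarrow> inverse x \<in> K"
    and "of_rat a \<in> K"
    and "x \<in> K \<Longrightarrow> qeval p x \<in> K"
    and "rat_vs.span K = K"
proof -
  have sf: "subfield K complex_field" using assms by (simp add: number_field_def)
  interpret ring complex_field by (rule ring_from_type_algebra)
  obtain B where B: "rat_vs.span B = K" using assms by (auto simp: number_field_def)
  have sub: "rat_vs.subspace K" using rat_vs.subspace_span[of B] B by simp
  note sr = subfieldE(1)[OF sf]
  show zero: "0 \<in> K" by (rule rat_vs.subspace_0[OF sub])
  show one: "1 \<in> K" using subringE(3)[OF sr] by (simp add: ring_of_type_algebra_def)
  show add: "x + y \<in> K" if "x \<in> K" "y \<in> K" for x y
    by (rule rat_vs.subspace_add[OF sub that])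
  show "x - y \<in> K" if "x \<in> K" "y \<in> K" for x y
    by (rule rat_vs.subspace_diff[OF sub that])
  show "- x \<in> K" if "x \<in> K" for x
    by (rule rat_vs.subspace_neg[OF sub that])
  show mult: "x * y \<in> K" if "x \<in> K" "y \<in> K" for x y
    using subringE(6)[OF sr that] by (simp add: ring_of_type_algebra_def)
  show "inverse x \<in> K" if "x \<in> K" for x
  proof (cases "x = 0")
    case False
    thus ?thesis
      using subfield_m_inv_simprule[OF sf, of x "inverse x"] that one
      by (simp add: ring_of_type_algebra_def)
  qed (use zero in auto)
  show rat: "of_rat a \<in> K" for a
    using rat_vs.subspace_scale[OF sub one, of a] by simp
  show "qeval p x \<in> K" if "x \<in> K" for p x
    by (induction p) (auto intro: zero add mult rat that)
  show "rat_vs.span K = K" using B rat_vs.span_span by blast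
qed

section \<open>Degrees of elements and primitive elements of a quartic field\<close>

locale quartic_field =
  fixes K :: "complex set"
  assumes nf: "number_field K" and deg4: "nf_degree K = 4"
begin

lemmas closed = number_field_closed[OF nf]

lemma obtain_basis:
  obtains B where "B \<subseteq> K" "rat_vs.independent B" "rat_vs.span B = K" "finite B" "card B = 4"
proof -
  obtain B where B: "B \<subseteq> K" "rat_vs.independent B" "K \<subseteq> rat_vs.span B" "card B = rat_vs.dim K"
    using rat_vs.basis_exists by blast
  have "rat_vs.span B \<subseteq> K" using rat_vs.span_mono[OF B(1)] closed(10) by simp
  moreover have "card B = 4" using B(4) deg4 by (simp add: nf_degree_def)
  moreover from this have "finite B" by (metis card.infinite zero_neq_numeral)
  ultimately show ?thesis using B that by blast
qed

lemma independent_card_le: "S \<subseteq> K \<Longrightarrow> rat_vs.independent S \<Longrightarrow> finite S \<and> card S \<le> 4"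
  using obtain_basis rat_vs.independent_span_bound by metis

lemma independent_card_span:
  assumes S: "S \<subseteq> K" "rat_vs.independent S" "card S = 4"
  shows "rat_vs.span S = K"
proof
  show "rat_vs.span S \<subseteq> K" using rat_vs.span_mono[OF S(1)] closed(10) by simp
  show "K \<subseteq> rat_vs.span S"
  proof (rule ccontr)
    assume "\<not> K \<subseteq> rat_vs.span S"
    then obtain x where x: "x \<in> K" "x \<notin> rat_vs.span S" by blast
    hence "rat_vs.independent (insert x S)" using S rat_vs.independent_insertI by blast
    moreover have "x \<notin> S" using x rat_vs.span_base by blast
    moreover have "finite S" using S by (metis card.infinite zero_neq_numeral)
    ultimately show False using independent_card_le[of "insert x S"] S x by simp
  qed
qed

lemma obtain_outside_span:
  assumes "finite T" "card T < 4"
  obtains y where "y \<in> K" "y \<notin> rat_vs.span T"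
proof -
  obtain B where B: "rat_vs.independent B" "rat_vs.span B = K" "card B = 4" "B \<subseteq> K"
    using obtain_basis by metis
  have "\<not> B \<subseteq> rat_vs.span T"
    using rat_vs.independent_span_bound[of T B] assms B by auto
  thus ?thesis using that B by blast
qed

lemma primitive_range:
  assumes y: "y \<in> K" and prim: "\<And>p. degree p < 4 \<Longrightarrow> qeval p y = 0 \<Longrightarrow> p = 0"
  shows "K = {qeval p y |p. degree p < 4}"
proof -
  have "y ^ i \<in> K" for i by (induction i) (auto intro: closed y)
  hence "rat_vs.span ((\<lambda>i. y ^ i) ` {..<4::nat}) = K"
    using powers_independent[OF prim] by (intro independent_card_span) (auto simp: card_image)
  thus ?thesis by (simp add: span_powers)
qed

text \<open>There is no element of degree three: if \<open>y\<close> is outside the cubic field of \<open>x\<close>, then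
  \<open>x * y = l + s * y\<close> with \<open>l\<close> in the cubic field and \<open>s\<close> rational, which forces \<open>y = l / (x - s)\<close>
  into the cubic field.\<close>

lemma no_cubic:
  assumes x: "x \<in> K" and p: "p \<noteq> 0" "degree p < 4" "qeval p x = 0"
  shows "\<exists>p. p \<noteq> 0 \<and> degree p < 3 \<and> qeval p x = 0"
proof (rule ccontr)
  assume "\<not> ?thesis"
  hence no: "p = 0" if "degree p < 3" "qeval p x = 0" for p using that by blast
  define S where "S = (\<lambda>i. x ^ i) ` {..<3::nat}"
  have ind: "rat_vs.independent S" and "card S = 3"
    using powers_independent[OF no] by (auto simp: S_def card_image)
  have fin: "finite S" by (simp add: S_def)
  have span: "rat_vs.span S = {qeval p x |p. degree p < 3}" by (simp add: S_def span_powers)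
  have SK: "S \<subseteq> K"
  proof -
    have "x ^ i \<in> K" for i by (induction i) (auto intro: closed x)
    thus ?thesis by (auto simp: S_def)
  qed
  obtain y where y: "y \<in> K" "y \<notin> rat_vs.span S"
    using obtain_outside_span[OF fin] \<open>card S = 3\<close> by auto
  have "rat_vs.independent (insert y S)" using y ind rat_vs.independent_insertI by blast
  moreover have "card (insert y S) = 4"
    using y \<open>card S = 3\<close> fin rat_vs.span_base[of y S] by (subst card_insert_disjoint) auto
  ultimately have "rat_vs.span (insert y S) = K" using independent_card_span SK y by simp
  hence "x * y \<in> rat_vs.span (insert y S)" using closed(4) x y by simp
  then obtain s where "x * y - of_rat s * y \<in> rat_vs.span S"
    using rat_vs.span_breakdown_eq by blast
  then obtain l where l: "(x - of_rat s) * y = qeval l x"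
    unfolding span by (auto simp: algebra_simps)
  have deg: "degree p = 3" using p no[of p] by force
  \<comment> \<open>Dividing \<open>p\<close> by \<open>X - s\<close> inverts \<open>x - s\<close>:
    since \<open>p\<close> vanishes at \<open>x\<close>, the product \<open>(x - s) * h(x)\<close>
    is the rational number \<open>- p(s)\<close>.\<close>
  define h where "h = synthetic_div p s"
  have ph: "p = [:-s, 1:] * h + [:poly p s:]"
    using synthetic_div_correct'[of s p] by (simp add: h_def)
  have dh: "degree h < 3" using deg by (simp add: h_def degree_synthetic_div)
  have "h \<noteq> 0" using deg by (auto simp: h_def synthetic_div_eq_0_iff)
  have "qeval p x = (x - of_rat s) * qeval h x + of_rat (poly p s)"
    by (subst ph) (simp add: of_rat_minus algebra_simps)
  hence eq: "(x - of_rat s) * qeval h x = - of_rat (poly p s)"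
    using p(3) by (simp add: add_eq_0_iff)
  have "poly p s \<noteq> 0"
  proof
    assume "poly p s = 0"
    hence "x = of_rat s \<or> qeval h x = 0" using eq by auto
    thus False
    proof
      assume "x = of_rat s"
      hence "qeval [:-s, 1:] x = 0" by (simp add: of_rat_minus)
      from no[OF _ this] show False by simp
    qed (use no[OF dh] \<open>h \<noteq> 0\<close> in auto)
  qed
  \<comment> \<open>The polynomial \<open>g\<close> represents \<open>l / (x - s)\<close>; reduction
    modulo the cubic \<open>p\<close> brings it into the span of \<open>1\<close>, \<open>x\<close>,
    \<open>x^2\<close>.\<close>
  define g where "g = Polynomial.smult (- (1 / poly p s)) ((l * h) mod p)"
  have "qeval ((l * h) mod p) x = qeval (l * h) x"
  proof -
    have "l * h = p * ((l * h) div p) + (l * h) mod p" by simp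
    hence "qeval (l * h) x = qeval (p * ((l * h) div p) + (l * h) mod p) x" by simp
    also have "\<dots> = qeval ((l * h) mod p) x" using p(3) by (simp only: qeval_add qeval_mult) simp
    finally show ?thesis by simp
  qed
  also have "\<dots> = ((x - of_rat s) * qeval h x) * y" using l by (simp add: algebra_simps flip: l)
  also have "\<dots> = - of_rat (poly p s) * y" by (simp add: eq)
  finally have "qeval g x = y"
    using \<open>poly p s \<noteq> 0\<close> by (simp add: g_def of_rat_minus of_rat_divide)
  moreover have "degree g < 3"
  proof -
    have "degree ((l * h) mod p) < 3"
      using degree_mod_less'[of p "l * h"] deg p(1) by (cases "(l * h) mod p = 0") auto
    thus ?thesis by (simp add: g_def)
  qed
  ultimately have "y \<in> rat_vs.span S" unfolding span by blast
  thus False using y by blast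
qed

lemma quadratic_relation:
  assumes "x \<in> K" and p: "p \<noteq> 0" "degree p < 4" "qeval p x = 0"
  shows "\<exists>s t. x ^ 2 = of_rat s * x + of_rat t"
proof -
  obtain p where p: "p \<noteq> 0" "degree p < 3" "qeval p x = 0" using no_cubic[OF assms] by blast
  have eq: "of_rat (coeff p 0) + of_rat (coeff p 1) * x + of_rat (coeff p 2) * x ^ 2 = 0"
    using qeval_altdef[OF p(2), of x] p(3) by (simp add: numeral_3_eq_3 numeral_2_eq_2)
  show ?thesis
  proof (cases "coeff p 2 = 0")
    case False
    have "x ^ 2 = of_rat (- (coeff p 1 / coeff p 2)) * x + of_rat (- (coeff p 0 / coeff p 2))"
      using False eq by (simp add: field_simps of_rat_divide of_rat_minus add_eq_0_iff)
    thus ?thesis by blast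
  next
    case c2: True
    have "coeff p 1 \<noteq> 0"
    proof
      assume c1: "coeff p 1 = 0"
      hence "coeff p 0 = 0" using eq c2 by simp
      have "coeff p i = 0" for i
      proof -
        consider "i = 0" | "i = 1" | "i = 2" | "i \<ge> 3" by linarith
        thus ?thesis using p(2) c1 c2 \<open>coeff p 0 = 0\<close> by cases (auto intro: coeff_eq_0)
      qed
      thus False using p(1) by (auto intro: poly_eqI)
    qed
    hence "x = of_rat (- (coeff p 0 / coeff p 1))"
      using eq c2 by (simp add: field_simps of_rat_divide of_rat_minus add_eq_0_iff)
    \<comment> \<open>A rational \<open>x\<close> also satisfies a relation of the required form,
      with \<open>t = 0\<close>.\<close>
    hence "x ^ 2 = of_rat (- (coeff p 0 / coeff p 1)) * x + of_rat 0"
      by (simp add: power2_eq_square)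
    thus ?thesis by blast
  qed
qed

text \<open>If every element were quadratic, take \<open>x\<close>, \<open>y\<close> with rational squares such that \<open>1\<close>, \<open>x\<close>,
  \<open>y\<close> are independent; the quadratic equation of \<open>x + y\<close> expresses \<open>x * y\<close>, and multiplying it by
  \<open>x\<close> expresses \<open>y\<close> through \<open>1\<close> and \<open>x\<close>.\<close>

lemma obtain_primitive:
  obtains \<theta> where "\<theta> \<in> K" "\<And>p. degree p < 4 \<Longrightarrow> qeval p \<theta> = 0 \<Longrightarrow> p = 0"
proof (rule ccontr)
  note that' = that
  assume not_thesis: "\<not> thesis"
  have "\<exists>p. p \<noteq> 0 \<and> degree p < 4 \<and> qeval p x = 0" if "x \<in> K" for x
    using not_thesis that'[of x] \<open>x \<in> K\<close> by blast
  hence quad: "\<exists>s t. x ^ 2 = of_rat s * x + of_rat t" if "x \<in> K" for x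
    using quadratic_relation that by metis
  have shift: "\<exists>s t. (x - of_rat s) ^ 2 = of_rat t" if "x \<in> K" for x
  proof -
    obtain s t where "x ^ 2 = of_rat s * x + of_rat t" using quad \<open>x \<in> K\<close> by blast
    hence "(x - of_rat (s / 2)) ^ 2 = of_rat (t + s ^ 2 / 4)"
      by (simp add: power2_eq_square algebra_simps of_rat_divide of_rat_add of_rat_mult)
    thus ?thesis by blast
  qed
  obtain x0 where x0: "x0 \<in> K" "x0 \<notin> rat_vs.span {1}"
    using obtain_outside_span[of "{1}"] by auto
  obtain sx A where A: "(x0 - of_rat sx) ^ 2 = of_rat A" using shift[OF x0(1)] by blast
  define x where "x = x0 - of_rat sx"
  have xK: "x \<in> K" unfolding x_def by (intro closed x0)
  have x_irrat: "x \<noteq> of_rat r" for r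
  proof
    assume "x = of_rat r"
    hence "x0 = of_rat (r + sx) * 1" by (simp add: x_def of_rat_add algebra_simps)
    thus False using x0(2) by (metis insertI1 rat_vs.span_base rat_vs.span_scale)
  qed
  have "card {1, x} < 4" by (cases "x = 1") auto
  then obtain y0 where y0: "y0 \<in> K" "y0 \<notin> rat_vs.span {1, x}"
    using obtain_outside_span[of "{1, x}"] by auto
  obtain sy B where B: "(y0 - of_rat sy) ^ 2 = of_rat B" using shift[OF y0(1)] by blast
  define y where "y = y0 - of_rat sy"
  have yK: "y \<in> K" unfolding y_def by (intro closed y0)
  have y_indep: "y \<noteq> of_rat a + of_rat b * x" for a b
  proof
    assume "y = of_rat a + of_rat b * x"
    hence "y0 = of_rat (a + sy) * 1 + of_rat b * x" by (simp add: y_def of_rat_add algebra_simps)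
    moreover have "of_rat (a + sy) * 1 + of_rat b * x \<in> rat_vs.span {1, x}"
      by (intro rat_vs.span_add rat_vs.span_scale rat_vs.span_base) auto
    ultimately show False using y0(2) by simp
  qed
  have xx: "x * x = of_rat A" and yy: "y * y = of_rat B"
    using A B by (simp_all add: x_def y_def power2_eq_square)
  obtain s t where st: "(x + y) ^ 2 = of_rat s * (x + y) + of_rat t"
    using quad closed(3)[OF xK yK] by blast
  \<comment> \<open>Expanding the equation of \<open>x + y\<close> gives
    \<open>2 * (x * y) = s * (x + y) + (t - A - B)\<close>.\<close>
  define c r where "c = (t - A - B) / 2" and "r = s / 2"
  have xy: "x * y = of_rat c + of_rat r * (x + y)"
    using st xx yy
    by (simp add: power2_eq_square c_def r_def of_rat_divide of_rat_diff of_rat_add field_simps)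
  have "of_rat A * y = x * (x * y)" by (simp add: xx flip: mult.assoc)
  also have "\<dots> = of_rat c * x + of_rat r * (x * x) + of_rat r * (x * y)"
    by (subst xy) (simp add: algebra_simps)
  also have "\<dots> = of_rat c * x + of_rat r * of_rat A + of_rat r * (of_rat c + of_rat r * (x + y))"
    by (simp only: xx xy)
  finally have key: "of_rat (A - r ^ 2) * y = of_rat (r * A + r * c) + of_rat (c + r ^ 2) * x"
    by (simp add: of_rat_diff of_rat_add of_rat_mult power2_eq_square algebra_simps)
  have "A - r ^ 2 \<noteq> 0"
  proof
    assume "A - r ^ 2 = 0"
    hence "x * x = of_rat r * of_rat r" using xx by (simp add: power2_eq_square of_rat_mult)
    hence "x = of_rat r \<or> x = of_rat (- r)" by (simp add: square_eq_iff of_rat_minus)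
    thus False using x_irrat by blast
  qed
  hence nz: "of_rat (A - r ^ 2) \<noteq> (0 :: complex)" by (metis of_rat_eq_0_iff)
  have "y = (of_rat (A - r ^ 2) * y) / of_rat (A - r ^ 2)" using nz by simp
  also have "\<dots> = of_rat ((r * A + r * c) / (A - r ^ 2)) + of_rat ((c + r ^ 2) / (A - r ^ 2)) * x"
    unfolding key of_rat_divide by (simp only: add_divide_distrib times_divide_eq_left)
  finally have "y = of_rat ((r * A + r * c) / (A - r ^ 2)) + of_rat ((c + r ^ 2) / (A - r ^ 2)) * x" .
  thus False using y_indep by blast
qed

end

text \<open>With \<open>n\<close> the leading coefficient and \<open>d\<close> the degree of an
  integer equation for \<open>x\<close>, multiplying the equation by \<open>n ^ (d - 1)\<close>
  makes it monic in \<open>n * x\<close>.\<close>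

lemma algebraic_int_multiple:
  fixes x :: complex
  assumes "algebraic x"
  obtains n :: int where "n \<noteq> 0" "algebraic_int (of_int n * x)"
proof -
  obtain p where p: "p \<noteq> (0 :: int poly)" "poly (map_poly of_int p) x = 0"
    using algebraicE'[OF assms] by metis
  define n where "n = lead_coeff p"
  define d where "d = degree p"
  define z where "z = of_int n * x"
  have sum0: "(\<Sum>i\<le>d. of_int (coeff p i) * x ^ i) = 0"
    using p by (simp add: poly_altdef d_def)
  have "d > 0"
  proof (rule Nat.gr0I)
    assume "d = 0"
    hence "coeff p (degree p) = 0" using sum0 by (simp add: d_def)
    thus False using p(1) by simp
  qed
  have split: "{..d} = insert d {..<d}" by auto
  have "z ^ d = of_int (n ^ (d - 1)) * (of_int n * x ^ d)"
    using \<open>d > 0\<close> by (cases d) (auto simp: z_def power_mult_distrib algebra_simps)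
  also have "of_int n * x ^ d = - (\<Sum>i<d. of_int (coeff p i) * x ^ i)"
    using sum0 unfolding split n_def d_def[symmetric] by (simp add: eq_neg_iff_add_eq_0)
  also have "of_int (n ^ (d - 1)) * \<dots> = - (\<Sum>i<d. of_int (n ^ (d - 1) * coeff p i) * x ^ i)"
    by (simp add: sum_distrib_left algebra_simps)
  also have "(\<Sum>i<d. of_int (n ^ (d - 1) * coeff p i) * x ^ i) =
      (\<Sum>i<d. of_int (n ^ (d - 1 - i) * coeff p i) * z ^ i)"
  proof (rule sum.cong)
    fix i assume "i \<in> {..<d}"
    hence "n ^ (d - 1) = n ^ (d - 1 - i) * n ^ i" by (simp flip: power_add)
    thus "of_int (n ^ (d - 1) * coeff p i) * x ^ i = of_int (n ^ (d - 1 - i) * coeff p i) * z ^ i"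
      by (simp add: z_def power_mult_distrib)
  qed simp
  also have "- \<dots> \<in> int_mod.span ((\<lambda>i. z ^ i) ` {..<d})"
    by (intro int_mod.span_neg int_mod.span_sum int_mod.span_scale int_mod.span_base) auto
  finally have zd: "z ^ d \<in> int_mod.span ((\<lambda>i. z ^ i) ` {..<d})" .
  have "algebraic_int z"
  proof (rule algebraic_int_of_stable_span)
    show "z ^ 0 \<in> (\<lambda>i. z ^ i) ` {..<d}" using \<open>d > 0\<close> by blast
    fix v assume "v \<in> (\<lambda>i. z ^ i) ` {..<d}"
    then obtain i where i: "i < d" "z * v = z ^ Suc i" by auto
    show "z * v \<in> int_mod.span ((\<lambda>i. z ^ i) ` {..<d})"
      using zd i by (cases "Suc i = d") (auto intro: int_mod.span_base simp del: power_Suc)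
  qed auto
  moreover have "n \<noteq> 0" using p by (simp add: n_def)
  ultimately show ?thesis using that by (simp add: z_def)
qed

lemma (in quartic_field) obtain_integral_primitive:
  obtains \<theta> where "\<theta> \<in> K" "algebraic_int \<theta>" "\<And>p. degree p < 4 \<Longrightarrow> qeval p \<theta> = 0 \<Longrightarrow> p = 0"
proof -
  obtain \<theta> where \<theta>: "\<theta> \<in> K" "\<And>p. degree p < 4 \<Longrightarrow> qeval p \<theta> = 0 \<Longrightarrow> p = 0"
    using obtain_primitive by metis
  \<comment> \<open>Five powers of \<open>\<theta>\<close> cannot be independent in dimension
    four.\<close>
  have "\<exists>p. p \<noteq> 0 \<and> qeval p \<theta> = 0"
  proof (rule ccontr)
    assume no: "\<not> ?thesis"
    have "p = 0" if "degree p < 5" "qeval p \<theta> = 0" for p using no that by blast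
    note ind = powers_independent[OF this]
    have "\<theta> ^ i \<in> K" for i by (induction i) (auto intro: closed \<theta>)
    hence "(\<lambda>i. \<theta> ^ i) ` {..<5::nat} \<subseteq> K" by blast
    from independent_card_le[OF this ind(2)] show False using ind(1) by (simp add: card_image)
  qed
  then obtain p where p: "p \<noteq> 0" "qeval p \<theta> = 0" by blast
  have "algebraic \<theta>"
    unfolding algebraic_altdef using p
    by (intro exI[of _ "map_poly of_rat p"]) (auto simp: coeff_map_poly qeval_def map_poly_eq_0_iff)
  then obtain n :: int where n: "n \<noteq> 0" "algebraic_int (of_int n * \<theta>)"
    using algebraic_int_multiple by blast
  have "p = 0" if "degree p < 4" "qeval p (of_int n * \<theta>) = 0" for p
  proof -
    \<comment> \<open>Substituting \<open>n * X\<close> preserves degrees, so the integral multiple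
      is as primitive as \<open>\<theta>\<close> itself.\<close>
    have "qeval (pcompose p [:0, of_int n:]) \<theta> = 0"
      using that by (simp add: qeval_pcompose mult.commute)
    moreover have "degree (pcompose p [:0, of_int n:]) < 4" using that n by simp
    ultimately have "pcompose p [:0, of_int n:] = 0" using \<theta>(2) by blast
    thus "p = 0" using n by (simp add: pcompose_eq_0_iff)
  qed
  moreover have "of_int n * \<theta> \<in> K" using closed(4)[OF closed(8)[of "of_int n"] \<theta>(1)] by simp
  ultimately show ?thesis using that n by blast
qed

section \<open>Embeddings and the trace form\<close>

interpretation of_rat_hom: field_char_0_hom "of_rat :: rat \<Rightarrow> complex"
  by unfold_locales (auto simp: of_rat_add of_rat_mult)

section \<open>Explicit determinants of size three and four\<close>

lemma det_mat_Suc: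
  fixes f :: "nat \<times> nat \<Rightarrow> 'a :: comm_ring_1"
  shows "det (mat (Suc n) (Suc n) f) =
    (\<Sum>i<Suc n. f (i, 0) * ((- 1) ^ i *
       det (mat n n (\<lambda>(a, b). f (if a < i then a else Suc a, Suc b)))))"
proof -
  have "det (mat (Suc n) (Suc n) f) =
    (\<Sum>i<Suc n. mat (Suc n) (Suc n) f $$ (i, 0) * cofactor (mat (Suc n) (Suc n) f) i 0)"
    by (rule laplace_expansion_column) auto
  also have "\<dots> = (\<Sum>i<Suc n. f (i, 0) * ((- 1) ^ i *
       det (mat n n (\<lambda>(a, b). f (if a < i then a else Suc a, Suc b)))))"
  proof (rule sum.cong)
    fix i assume i: "i \<in> {..<Suc n}"
    have "mat_delete (mat (Suc n) (Suc n) f) i 0 =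
        mat n n (\<lambda>(a, b). f (if a < i then a else Suc a, Suc b))"
      by (rule eq_matI) (auto simp: mat_delete_def)
    thus "mat (Suc n) (Suc n) f $$ (i, 0) * cofactor (mat (Suc n) (Suc n) f) i 0 =
      f (i, 0) * ((- 1) ^ i * det (mat n n (\<lambda>(a, b). f (if a < i then a else Suc a, Suc b))))"
      using i by (simp add: cofactor_def)
  qed simp
  finally show ?thesis .
qed

lemma det_mat_3:
  fixes f :: "nat \<times> nat \<Rightarrow> 'a :: comm_ring_1"
  shows "det (mat 3 3 f) =
    f (0, 0) * (f (1, 1) * f (2, 2) - f (1, 2) * f (2, 1)) -
    f (1, 0) * (f (0, 1) * f (2, 2) - f (0, 2) * f (2, 1)) +
    f (2, 0) * (f (0, 1) * f (1, 2) - f (0, 2) * f (1, 1))"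
proof -
  have "mat 3 3 f = mat (Suc (Suc (Suc 0))) (Suc (Suc (Suc 0))) f"
    by (simp add: numeral_3_eq_3)
  thus ?thesis by (simp add: det_mat_Suc numeral_2_eq_2 algebra_simps)
qed

lemma det_mat_4:
  fixes f :: "nat \<times> nat \<Rightarrow> 'a :: comm_ring_1"
  shows "det (mat 4 4 f) =
    f (0, 0) * det (mat 3 3 (\<lambda>(a, b). f (Suc a, Suc b))) -
    f (1, 0) * det (mat 3 3 (\<lambda>(a, b). f (if a < 1 then a else Suc a, Suc b))) +
    f (2, 0) * det (mat 3 3 (\<lambda>(a, b). f (if a < 2 then a else Suc a, Suc b))) -
    f (3, 0) * det (mat 3 3 (\<lambda>(a, b). f (if a < 3 then a else Suc a, Suc b)))"
proof -
  have "mat 4 4 f = mat (Suc 3) (Suc 3) f" by simp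
  also have "det \<dots> = (\<Sum>i<Suc 3. f (i, 0) * ((- 1) ^ i *
       det (mat 3 3 (\<lambda>(a, b). f (if a < i then a else Suc a, Suc b)))))"
    by (rule det_mat_Suc)
  finally show ?thesis by (simp add: numeral_3_eq_3 numeral_2_eq_2)
qed

lemma vandermonde_4:
  fixes x :: "nat \<Rightarrow> 'a :: comm_ring_1"
  shows "det (mat 4 4 (\<lambda>(i, j). x i ^ j)) =
    (x 1 - x 0) * (x 2 - x 0) * (x 3 - x 0) * (x 2 - x 1) * (x 3 - x 1) * (x 3 - x 2)"
  unfolding det_mat_4 det_mat_3 by (simp add: numeral_2_eq_2 numeral_3_eq_3) (simp add: algebra_simps)

lemma sum_4_nat: "(\<Sum>i<4. f i) = f 0 + f 1 + f 2 + f (3::nat)"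
  for f :: "nat \<Rightarrow> 'a :: comm_monoid_add"
  by (simp add: eval_nat_numeral)

lemma less_4_cases: "i < 4 \<longleftrightarrow> i = 0 \<or> i = 1 \<or> i = 2 \<or> i = (3::nat)"
  by auto

text \<open>For algebraic \<open>\<theta>\<close> these are the roots of its minimal polynomial,
  described without naming that polynomial.\<close>

definition conjugates :: "complex \<Rightarrow> complex set" where
  "conjugates \<theta> = {r. \<forall>p. qeval p \<theta> = 0 \<longrightarrow> qeval p r = 0}"

text \<open>The field embedding that sends \<open>\<theta>\<close> to \<open>r\<close>. When
  \<open>r\<close> is a conjugate of \<open>\<theta>\<close>, every polynomial representing
  \<open>x\<close> gives the same value.\<close>

definition emb :: "complex \<Rightarrow> complex \<Rightarrow> complex \<Rightarrow> complex" where
  "emb \<theta> r x = qeval (SOME p. qeval p \<theta> = x) r"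

lemma emb_qeval:
  assumes "r \<in> conjugates \<theta>"
  shows "emb \<theta> r (qeval p \<theta>) = qeval p r"
proof -
  define q where "q = (SOME q. qeval q \<theta> = qeval p \<theta>)"
  have "qeval q \<theta> = qeval p \<theta>" unfolding q_def by (rule someI[of _ p]) simp
  hence "qeval (q - p) \<theta> = 0" by simp
  hence "qeval (q - p) r = 0" using assms unfolding conjugates_def by blast
  thus ?thesis by (simp add: emb_def q_def)
qed

lemma cnj_conjugates: "r \<in> conjugates \<theta> \<Longrightarrow> cnj r \<in> conjugates \<theta>"
  unfolding conjugates_def by (auto simp flip: qeval_cnj)

text \<open>The monic quartic \<open>f\<close> of \<open>\<theta>\<close> is separable. A common
  divisor of \<open>f\<close> and its derivative has degree below four and so cannot vanish at
  \<open>\<theta>\<close>; its cofactor must, and therefore already has degree four.\<close>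

lemma (in quartic_field) card_conjugates:
  assumes \<theta>: "\<theta> \<in> K" and prim: "\<And>p. degree p < 4 \<Longrightarrow> qeval p \<theta> = 0 \<Longrightarrow> p = 0"
  shows "card (conjugates \<theta>) = 4"
proof -
  have "\<theta> ^ i \<in> K" for i by (induction i) (auto intro: closed \<theta>)
  hence "\<theta> ^ 4 \<in> {qeval p \<theta> |p. degree p < 4}" using primitive_range[OF \<theta> prim] by blast
  then obtain g where g: "\<theta> ^ 4 = qeval g \<theta>" "degree g < 4" by blast
  define f where "f = Polynomial.monom 1 4 - g"
  have f0: "qeval f \<theta> = 0" using g by (simp add: f_def)
  have df: "degree f = 4"
    using g by (simp add: f_def degree_add_eq_left degree_monom_eq diff_conv_add_uminus
        del: add_uminus_conv_diff)
  have dvd: "f dvd p" if "qeval p \<theta> = 0" for p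
  proof -
    have "qeval (p mod f) \<theta> = qeval (f * (p div f) + p mod f) \<theta>" using f0
      by (simp only: qeval_add qeval_mult) simp
    also have "\<dots> = 0" using that by simp
    finally have "qeval (p mod f) \<theta> = 0" .
    moreover have "degree (p mod f) < 4"
      using degree_mod_less'[of f p] df by (cases "p mod f = 0"; cases "f = 0") auto
    ultimately have "p mod f = 0" using prim by blast
    thus ?thesis by (simp add: mod_eq_0_iff_dvd)
  qed
  have conj: "conjugates \<theta> = {r. poly (map_poly of_rat f) r = 0}"
    unfolding qeval_def[symmetric]
  proof (intro equalityI subsetI CollectI)
    fix z assume "z \<in> {r. qeval f r = 0}"
    hence "qeval p z = 0" if "qeval p \<theta> = 0" for p using dvd[OF that] by (auto elim!: dvdE)
    thus "z \<in> conjugates \<theta>" by (simp add: conjugates_def)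
  qed (use f0 in \<open>simp add: conjugates_def\<close>)
  have "f \<noteq> 0" using df by auto
  have "pderiv f \<noteq> 0" using df by (simp add: pderiv_eq_0_iff)
  have "degree (gcd f (pderiv f)) = 0"
  proof -
    define d where "d = gcd f (pderiv f)"
    obtain h where h: "f = d * h" by (metis d_def dvd_def gcd_dvd1)
    have "degree d \<le> degree (pderiv f)"
      unfolding d_def using \<open>pderiv f \<noteq> 0\<close> by (intro dvd_imp_degree_le) auto
    hence "degree d < 4" using df by (simp add: degree_pderiv)
    moreover have "d \<noteq> 0" "h \<noteq> 0" using h \<open>f \<noteq> 0\<close> by auto
    ultimately have "qeval d \<theta> \<noteq> 0" using prim by blast
    hence "qeval h \<theta> = 0" using f0 h by simp
    hence "degree h \<ge> 4" using prim \<open>h \<noteq> 0\<close> by force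
    moreover have "degree f = degree d + degree h"
      using \<open>d \<noteq> 0\<close> \<open>h \<noteq> 0\<close> unfolding h by (rule degree_mult_eq)
    ultimately show ?thesis using df by (simp add: d_def)
  qed
  moreover have "gcd f (pderiv f) \<noteq> 0" using \<open>f \<noteq> 0\<close> by simp
  ultimately have "is_unit (gcd f (pderiv f))" by (simp add: is_unit_iff_degree)
  hence "coprime f (pderiv f)" by (rule is_unit_gcd[THEN iffD1])
  \<comment> \<open>A Bezout identity over the rationals survives evaluation at complex numbers and
    excludes a common root of \<open>f\<close> and its derivative there.\<close>
  then obtain u v where uv: "u * f + v * pderiv f = 1"
    using bezout_coefficients_fst_snd[of f "pderiv f"] by (metis coprime_iff_gcd_eq_1)
  have pd: "map_poly of_rat (pderiv f) = pderiv (map_poly (of_rat :: rat \<Rightarrow> complex) f)"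
    by (rule poly_eqI) (simp add: coeff_map_poly coeff_pderiv of_rat_mult of_rat_add)
  have "rsquarefree (map_poly (of_rat :: rat \<Rightarrow> complex) f)"
    unfolding rsquarefree_roots
  proof (intro allI notI, elim conjE)
    fix a :: complex
    assume "poly (map_poly of_rat f) a = 0" "poly (pderiv (map_poly of_rat f)) a = 0"
    hence "qeval f a = 0" "qeval (pderiv f) a = 0" by (simp_all add: qeval_def pd)
    hence "qeval (u * f + v * pderiv f) a = 0" by simp
    thus False unfolding uv by simp
  qed
  note dec = complex_poly_decompose_rsquarefree[OF this]
  have nz: "map_poly (of_rat :: rat \<Rightarrow> complex) f \<noteq> 0" using \<open>f \<noteq> 0\<close> by simp
  have "4 = degree (map_poly (of_rat :: rat \<Rightarrow> complex) f)" using df by simp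
  also have "\<dots> = degree (\<Prod>z | poly (map_poly of_rat f) z = (0::complex). [:- z, 1:])"
    using nz by (subst dec[symmetric]) simp
  also have "\<dots> = (\<Sum>z | poly (map_poly of_rat f) z = (0::complex). degree [:- z, 1:])"
    by (rule degree_prod_eq_sum_degree) auto
  also have "\<dots> = card (conjugates \<theta>)" by (simp add: conj)
  finally show ?thesis by simp
qed

text \<open>The numbering \<open>r\<close> of the conjugates is a parameter, so that the real ones
  can later be placed first.\<close>

locale quartic_embeddings = quartic_field +
  fixes \<theta> :: complex and r :: "nat \<Rightarrow> complex"
  assumes \<theta>: "\<theta> \<in> K" and \<theta>_int: "algebraic_int \<theta>"
    and prim: "\<And>p. degree p < 4 \<Longrightarrow> qeval p \<theta> = 0 \<Longrightarrow> p = 0"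
    and r: "\<And>i. i < 4 \<Longrightarrow> r i \<in> conjugates \<theta>"
    and r_inj: "inj_on r {..<4}"
begin

definition \<sigma> :: "nat \<Rightarrow> complex \<Rightarrow> complex" where
  "\<sigma> i x = emb \<theta> (r i) x"

lemma \<theta>_powers_in: "\<theta> ^ i \<in> K"
  by (induction i) (auto intro: closed \<theta>)

lemma obtain_qeval:
  assumes "x \<in> K"
  obtains p where "degree p < 4" "x = qeval p \<theta>"
  using primitive_range[OF \<theta> prim] that assms by blast

lemma \<sigma>_poly: "i < 4 \<Longrightarrow> \<sigma> i (qeval p \<theta>) = qeval p (r i)"
  by (simp add: \<sigma>_def emb_qeval r)

lemma
  assumes i: "i < 4"
  shows \<sigma>_add: "x \<in> K \<Longrightarrow> y \<in> K \<Longrightarrow> \<sigma> i (x + y) = \<sigma> i x + \<sigma> i y"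
    and \<sigma>_diff: "x \<in> K \<Longrightarrow> y \<in> K \<Longrightarrow> \<sigma> i (x - y) = \<sigma> i x - \<sigma> i y"
    and \<sigma>_mult: "x \<in> K \<Longrightarrow> y \<in> K \<Longrightarrow> \<sigma> i (x * y) = \<sigma> i x * \<sigma> i y"
    and \<sigma>_of_rat: "\<sigma> i (of_rat a) = of_rat a"
    and \<sigma>_qeval: "x \<in> K \<Longrightarrow> \<sigma> i (qeval p x) = qeval p (\<sigma> i x)"
proof -
  show "\<sigma> i (x + y) = \<sigma> i x + \<sigma> i y" if "x \<in> K" "y \<in> K" for x y
    using that \<sigma>_poly[OF i] by (elim obtain_qeval) (metis qeval_add)
  show "\<sigma> i (x - y) = \<sigma> i x - \<sigma> i y" if "x \<in> K" "y \<in> K" for x y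
    using that \<sigma>_poly[OF i] by (elim obtain_qeval) (metis qeval_diff)
  show "\<sigma> i (x * y) = \<sigma> i x * \<sigma> i y" if "x \<in> K" "y \<in> K" for x y
    using that \<sigma>_poly[OF i] by (elim obtain_qeval) (metis qeval_mult)
  show "\<sigma> i (of_rat a) = of_rat a"
    using \<sigma>_poly[OF i, of "[:a:]"] by simp
  show "\<sigma> i (qeval p x) = qeval p (\<sigma> i x)" if "x \<in> K"
    using that \<sigma>_poly[OF i] by (elim obtain_qeval) (metis qeval_pcompose)
qed

lemma \<sigma>_0: "i < 4 \<Longrightarrow> \<sigma> i 0 = 0"
  and \<sigma>_1: "i < 4 \<Longrightarrow> \<sigma> i 1 = 1"
  and \<sigma>_of_int: "i < 4 \<Longrightarrow> \<sigma> i (of_int n) = of_int n"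
  using \<sigma>_of_rat[of i 0] \<sigma>_of_rat[of i 1] \<sigma>_of_rat[of i "of_int n"] by simp_all

lemma power_in: "x \<in> K \<Longrightarrow> x ^ n \<in> K"
  by (induction n) (auto intro: closed)

lemma \<sigma>_power: "i < 4 \<Longrightarrow> x \<in> K \<Longrightarrow> \<sigma> i (x ^ n) = \<sigma> i x ^ n"
  by (induction n) (auto simp: \<sigma>_1 \<sigma>_mult power_in)

lemma \<sigma>_\<theta>: "i < 4 \<Longrightarrow> \<sigma> i \<theta> = r i"
  using \<sigma>_poly[of i "[:0, 1:]"] by simp

lemma sum_in: "(\<And>j. j \<in> J \<Longrightarrow> f j \<in> K) \<Longrightarrow> sum f J \<in> K"
  by (induction J rule: infinite_finite_induct) (auto intro: closed)

lemma \<sigma>_sum: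
  "i < 4 \<Longrightarrow> (\<And>j. j \<in> J \<Longrightarrow> f j \<in> K) \<Longrightarrow> \<sigma> i (sum f J) = (\<Sum>j\<in>J. \<sigma> i (f j))"
proof (induction J rule: infinite_finite_induct)
  case (insert j J)
  have "sum f J \<in> K" using insert by (intro sum_in) auto
  thus ?case using insert by (simp add: \<sigma>_add)
qed (auto simp: \<sigma>_0)

lemma \<sigma>_inverse: "i < 4 \<Longrightarrow> x \<in> K \<Longrightarrow> \<sigma> i (inverse x) = inverse (\<sigma> i x)"
proof (cases "x = 0")
  case False
  assume i: "i < 4" "x \<in> K"
  have "\<sigma> i x * \<sigma> i (inverse x) = 1"
    using \<sigma>_mult[OF i closed(7)[OF i(2)]] False i by (simp add: \<sigma>_1)
  thus ?thesis by (metis inverse_unique)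
qed (auto simp: \<sigma>_0)

lemma \<sigma>_eq_0: "i < 4 \<Longrightarrow> x \<in> K \<Longrightarrow> \<sigma> i x = 0 \<longleftrightarrow> x = 0"
proof
  assume "i < 4" "x \<in> K" "\<sigma> i x = 0"
  show "x = 0"
  proof (rule ccontr)
    assume "x \<noteq> 0"
    have "\<sigma> i (x * inverse x) = 0"
      using \<open>\<sigma> i x = 0\<close> \<open>i < 4\<close> \<open>x \<in> K\<close> by (simp only: \<sigma>_mult closed(7)) simp
    thus False using \<open>x \<noteq> 0\<close> \<open>i < 4\<close> by (simp add: \<sigma>_1)
  qed
qed (simp add: \<sigma>_0)

lemma \<sigma>_algebraic_int:
  assumes "i < 4" "x \<in> K" "algebraic_int x"
  shows "algebraic_int (\<sigma> i x)"
proof -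
  obtain p where p: "poly (map_poly of_int p) x = 0" "lead_coeff p = (1::int)"
    using assms by (auto simp: algebraic_int_altdef_ipoly)
  have q: "qeval (map_poly of_int p) z = poly (map_poly of_int p) z" for z
    by (simp add: qeval_def map_poly_map_poly o_def)
  have "qeval (map_poly of_int p) (\<sigma> i x) = \<sigma> i (qeval (map_poly of_int p) x)"
    using assms by (simp add: \<sigma>_qeval)
  also have "\<dots> = 0" using p assms by (simp add: q \<sigma>_0)
  finally show ?thesis using p(2) by (auto simp: q algebraic_int_altdef_ipoly)
qed

text \<open>Rows are embeddings and columns are field elements; the square of the determinant is the
  discriminant of the list.\<close>

definition emat :: "complex list \<Rightarrow> complex mat" where
  "emat bs = mat 4 4 (\<lambda>(i, j). \<sigma> i (bs ! j))"

lemma emat_carrier [simp]: "emat bs \<in> carrier_mat 4 4"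
  by (simp add: emat_def)

lemma det_emat_change:
  assumes bs: "\<And>j. j < 4 \<Longrightarrow> bs ! j \<in> K" and C: "C \<in> carrier_mat 4 4"
    and xs: "\<And>j. j < 4 \<Longrightarrow> xs ! j = (\<Sum>k<4. of_rat (C $$ (k, j)) * bs ! k)"
  shows "det (emat xs) = det (emat bs) * of_rat (det C)"
proof -
  have "emat xs = emat bs * map_mat of_rat C"
  proof (rule eq_matI)
    fix i j assume "i < dim_row (emat bs * map_mat of_rat C)" "j < dim_col (emat bs * map_mat of_rat C)"
    hence ij: "i < 4" "j < 4" using C by (auto simp: emat_def)
    have "\<sigma> i (xs ! j) = (\<Sum>k<4. \<sigma> i (of_rat (C $$ (k, j)) * bs ! k))"
      using ij bs by (subst xs) (auto intro!: \<sigma>_sum closed)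
    also have "\<dots> = (\<Sum>k<4. of_rat (C $$ (k, j)) * \<sigma> i (bs ! k))"
      using ij bs by (intro sum.cong) (auto simp: \<sigma>_mult \<sigma>_of_rat closed)
    finally show "emat xs $$ (i, j) = (emat bs * map_mat of_rat C) $$ (i, j)"
      using ij C by (simp add: emat_def scalar_prod_def lessThan_atLeast0 mult.commute)
  qed (use C in \<open>auto simp: emat_def\<close>)
  also have "det \<dots> = det (emat bs) * det (map_mat of_rat C)"
    by (rule det_mult[of _ 4]) (use C in auto)
  also have "det (map_mat of_rat C) = (of_rat (det C) :: complex)" by simp
  finally show ?thesis .
qed

abbreviation powers :: "complex \<Rightarrow> complex list" where
  "powers x \<equiv> map (\<lambda>i. x ^ i) [0..<4]"

lemma det_emat_powers:
  assumes "x \<in> K"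
  shows "det (emat (powers x)) = (\<sigma> 1 x - \<sigma> 0 x) * (\<sigma> 2 x - \<sigma> 0 x) * (\<sigma> 3 x - \<sigma> 0 x) *
    (\<sigma> 2 x - \<sigma> 1 x) * (\<sigma> 3 x - \<sigma> 1 x) * (\<sigma> 3 x - \<sigma> 2 x)"
proof -
  have "emat (powers x) = mat 4 4 (\<lambda>(i, j). \<sigma> i x ^ j)"
    by (rule eq_matI) (auto simp: emat_def \<sigma>_power assms simp del: upt_rec_numeral)
  thus ?thesis by (simp add: vandermonde_4)
qed

lemma det_emat_\<theta>: "det (emat (powers \<theta>)) \<noteq> 0"
proof -
  have "r i \<noteq> r j" if "i < 4" "j < 4" "i \<noteq> j" for i j
    using r_inj that by (auto simp: inj_on_def)
  thus ?thesis using \<theta> by (simp add: det_emat_powers \<sigma>_\<theta>)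
qed

lemma coordinates:
  assumes bs: "length bs = 4" "distinct bs" and span: "rat_vs.span (set bs) = K" and x: "x \<in> K"
  obtains c where "x = (\<Sum>k<4. of_rat (c k) * bs ! k)"
proof -
  have "x \<in> rat_vs.span (set bs)" using span x by simp
  then obtain u where u: "x = (\<Sum>v\<in>set bs. of_rat (u v) * v)" by (auto simp: rat_vs.span_finite)
  have bij: "bij_betw (\<lambda>j. bs ! j) {..<4} (set bs)"
    using bs by (auto simp: bij_betw_def inj_on_def nth_eq_iff_index_eq set_conv_nth)
  have "x = (\<Sum>k<4. of_rat (u (bs ! k)) * bs ! k)"
    unfolding u by (rule sum.reindex_bij_betw[OF bij, symmetric])
  thus ?thesis by (rule that)
qed

text \<open>The powers of \<open>\<theta>\<close> are rational combinations of the basis, so their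
  determinant is a multiple of this one; it is a Vandermonde determinant at four distinct
  conjugates.\<close>

lemma det_emat_basis:
  assumes bs: "length bs = 4" "distinct bs" and span: "rat_vs.span (set bs) = K"
  shows "det (emat bs) \<noteq> 0"
proof -
  have in_K: "bs ! j \<in> K" if "j < 4" for j using that bs span rat_vs.span_base by (metis nth_mem)
  have "\<exists>c. \<theta> ^ j = (\<Sum>k<4. of_rat (c k) * bs ! k)" for j
    using coordinates[OF bs span \<theta>_powers_in[of j]] by metis
  then obtain c where c: "\<And>j. \<theta> ^ j = (\<Sum>k<4. of_rat (c j k) * bs ! k)" by metis
  have "det (emat (powers \<theta>)) = det (emat bs) * of_rat (det (mat 4 4 (\<lambda>(k, j). c j k)))"
    by (rule det_emat_change[OF in_K]) (use c in \<open>auto simp del: upt_rec_numeral\<close>)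
  thus ?thesis using det_emat_\<theta> by auto
qed

lemma nf_basis_props:
  "rat_vs.independent (nf_basis K)" "rat_vs.span (nf_basis K) = K"
  "finite (nf_basis K)" "card (nf_basis K) = 4"
proof -
  have "\<exists>B. rat_vs.independent B \<and> rat_vs.span B = K" using obtain_basis by metis
  hence B: "rat_vs.independent (nf_basis K) \<and> rat_vs.span (nf_basis K) = K"
    unfolding nf_basis_def by (rule someI_ex)
  thus "rat_vs.independent (nf_basis K)" "rat_vs.span (nf_basis K) = K" by auto
  have "nf_basis K \<subseteq> K" using B rat_vs.span_superset by blast
  thus "finite (nf_basis K)" using independent_card_le B by blast
  have "card (nf_basis K) = rat_vs.dim K"
    using rat_vs.dim_eq_card[of "nf_basis K" K] B by (metis rat_vs.span_span)
  thus "card (nf_basis K) = 4" using deg4 by (simp add: nf_degree_def)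
qed

text \<open>The matrix of embeddings of a basis diagonalises multiplication by \<open>x\<close>,
  with the conjugates of \<open>x\<close> on the diagonal, and similar matrices have equal
  traces.\<close>

lemma nf_trace_eq:
  assumes x: "x \<in> K"
  shows "of_rat (nf_trace K x) = (\<Sum>i<4. \<sigma> i x)"
proof -
  let ?B = "nf_basis K"
  obtain bs where bs: "set bs = ?B" "distinct bs"
    using finite_distinct_list nf_basis_props(3) by blast
  have len: "length bs = 4" using bs nf_basis_props(4) by (metis distinct_card)
  have span: "rat_vs.span (set bs) = K" using bs nf_basis_props by simp
  have in_K: "bs ! j \<in> K" if "j < 4" for j
    using that len span rat_vs.span_base by (metis nth_mem)
  have bij: "bij_betw (\<lambda>j. bs ! j) {..<4} ?B"
    using bs len by (auto simp: bij_betw_def inj_on_def nth_eq_iff_index_eq set_conv_nth)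
  define M where "M = mat 4 4 (\<lambda>(k, j). rat_vs.representation ?B (x * bs ! j) (bs ! k))"
  have rep: "x * bs ! j = (\<Sum>k<4. of_rat (M $$ (k, j)) * bs ! k)" if "j < 4" for j
  proof -
    have "x * bs ! j = (\<Sum>b\<in>?B. of_rat (rat_vs.representation ?B (x * bs ! j) b) * b)"
      using rat_vs.sum_representation_eq[of ?B "x * bs ! j" ?B] nf_basis_props closed(4)[OF x in_K[OF that]]
      by simp
    also have "\<dots> = (\<Sum>k<4. of_rat (rat_vs.representation ?B (x * bs ! j) (bs ! k)) * bs ! k)"
      by (rule sum.reindex_bij_betw[OF bij, symmetric])
    finally show ?thesis using that by (simp add: M_def)
  qed
  define S where "S = emat bs"
  have S: "S \<in> carrier_mat 4 4" by (simp add: S_def)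
  have "det S \<noteq> 0" unfolding S_def by (rule det_emat_basis[OF len bs(2) span])
  define T where "T = inverse (det S) \<cdot>\<^sub>m adj_mat S"
  have T: "T \<in> carrier_mat 4 4" using adj_mat[OF S] by (simp add: T_def)
  have ST: "S * T = 1\<^sub>m 4" and TS: "T * S = 1\<^sub>m 4"
    using adj_mat[OF S] S \<open>det S \<noteq> 0\<close>
    by (auto simp: T_def mult_smult_distrib[OF S] mult_smult_assoc_mat[of _ 4 4 _ 4])
  define M' where "M' = map_mat (of_rat :: rat \<Rightarrow> complex) M"
  have M': "M' \<in> carrier_mat 4 4" by (simp add: M'_def M_def)
  \<comment> \<open>This is \<open>S\<close> multiplied from the left by the diagonal matrix of the
    conjugates of \<open>x\<close>.\<close>
  define D where "D = mat 4 4 (\<lambda>(i, j). \<sigma> i x * S $$ (i, j))"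
  have SM: "S * M' = D"
  proof (rule eq_matI)
    fix i j assume "i < dim_row D" "j < dim_col D"
    hence ij: "i < 4" "j < 4" by (auto simp: D_def)
    have "\<sigma> i x * \<sigma> i (bs ! j) = \<sigma> i (x * bs ! j)" using ij x in_K by (simp add: \<sigma>_mult)
    also have "\<dots> = (\<Sum>k<4. \<sigma> i (of_rat (M $$ (k, j)) * bs ! k))"
      using ij in_K by (subst rep) (auto intro!: \<sigma>_sum closed)
    also have "\<dots> = (\<Sum>k<4. of_rat (M $$ (k, j)) * \<sigma> i (bs ! k))"
      using ij in_K by (intro sum.cong) (auto simp: \<sigma>_mult \<sigma>_of_rat closed)
    finally show "(S * M') $$ (i, j) = D $$ (i, j)"
      using ij S M' by (simp add: D_def S_def emat_def M'_def M_def scalar_prod_def lessThan_atLeast0 mult.commute)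
  qed (use S M' in \<open>auto simp: D_def\<close>)
  have "M' = (T * S) * M'" using M' by (simp add: TS)
  also have "\<dots> = T * D" using S T M' by (simp add: assoc_mult_mat[of _ 4 4 _ 4 _ 4] SM)
  finally have MT: "M' = T * D" .
  have diag: "M' $$ (k, k) = (\<Sum>i<4. T $$ (k, i) * (\<sigma> i x * S $$ (i, k)))" if "k < 4" for k
    using that T unfolding MT by (simp add: D_def scalar_prod_def lessThan_atLeast0)
  have one: "(\<Sum>k<4. S $$ (i, k) * T $$ (k, i)) = 1" if "i < 4" for i
  proof -
    have "(S * T) $$ (i, i) = 1" using that by (simp add: ST)
    thus ?thesis using that S T by (simp add: scalar_prod_def lessThan_atLeast0)
  qed
  have "of_rat (nf_trace K x) = (\<Sum>b\<in>?B. of_rat (rat_vs.representation ?B (x * b) b))"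
    by (simp add: nf_trace_def of_rat_sum)
  also have "\<dots> = (\<Sum>k<4. of_rat (rat_vs.representation ?B (x * bs ! k) (bs ! k)))"
    by (rule sum.reindex_bij_betw[OF bij, symmetric])
  also have "\<dots> = (\<Sum>k<4. M' $$ (k, k))" by (simp add: M'_def M_def)
  also have "\<dots> = (\<Sum>k<4. \<Sum>i<4. T $$ (k, i) * (\<sigma> i x * S $$ (i, k)))"
    using diag by simp
  also have "\<dots> = (\<Sum>i<4. \<Sum>k<4. T $$ (k, i) * (\<sigma> i x * S $$ (i, k)))" by (rule sum.swap)
  also have "\<dots> = (\<Sum>i<4. \<sigma> i x * (\<Sum>k<4. S $$ (i, k) * T $$ (k, i)))"
    by (simp add: sum_distrib_left algebra_simps)
  also have "\<dots> = (\<Sum>i<4. \<sigma> i x)" using one by simp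
  finally show ?thesis .
qed

text \<open>The Gram matrix is the transpose of \<open>emat bs\<close>, times the diagonal matrix of
  the conjugates of \<open>d\<close>, times \<open>emat bs\<close>. The value \<open>d = 1\<close>
  gives the discriminant; the inverse of a square root is inserted later to exclude quadratic
  subfields.\<close>

lemma det_trace_form:
  assumes d: "d \<in> K" and in_K: "\<And>j. j < 4 \<Longrightarrow> bs ! j \<in> K"
  shows "of_rat (det (mat 4 4 (\<lambda>(i, j). nf_trace K (d * (bs ! i * bs ! j))))) =
    \<sigma> 0 d * \<sigma> 1 d * \<sigma> 2 d * \<sigma> 3 d * det (emat bs) ^ 2"
proof -
  let ?G = "mat 4 4 (\<lambda>(i, j). nf_trace K (d * (bs ! i * bs ! j)))"
  let ?S = "emat bs"
  define D where "D = mat 4 4 (\<lambda>(i, j). if i = j then \<sigma> i d else 0)"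
  have D: "D \<in> carrier_mat 4 4" by (simp add: D_def)
  have DS: "D * ?S = mat 4 4 (\<lambda>(i, j). \<sigma> i d * \<sigma> i (bs ! j))"
  proof (rule eq_matI)
    fix i j assume "i < dim_row (mat 4 4 (\<lambda>(i, j). \<sigma> i d * \<sigma> i (bs ! j)))"
      "j < dim_col (mat 4 4 (\<lambda>(i, j). \<sigma> i d * \<sigma> i (bs ! j)))"
    hence ij: "i < 4" "j < 4" by auto
    have "(D * ?S) $$ (i, j) = (\<Sum>k = 0..<4. (if i = k then \<sigma> i d else 0) * \<sigma> k (bs ! j))"
      using ij by (simp add: D_def emat_def scalar_prod_def)
    also have "\<dots> = (\<Sum>k = 0..<4. if i = k then \<sigma> i d * \<sigma> k (bs ! j) else 0)"
      by (intro sum.cong) auto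
    also have "\<dots> = \<sigma> i d * \<sigma> i (bs ! j)" using ij by simp
    finally show "(D * ?S) $$ (i, j) = mat 4 4 (\<lambda>(i, j). \<sigma> i d * \<sigma> i (bs ! j)) $$ (i, j)"
      using ij by simp
  qed (auto simp: D_def emat_def)
  have "map_mat of_rat ?G = transpose_mat ?S * (D * ?S)"
    unfolding DS
  proof (rule eq_matI)
    fix i j assume "i < dim_row (transpose_mat ?S * mat 4 4 (\<lambda>(i, j). \<sigma> i d * \<sigma> i (bs ! j)))"
      "j < dim_col (transpose_mat ?S * mat 4 4 (\<lambda>(i, j). \<sigma> i d * \<sigma> i (bs ! j)))"
    hence ij: "i < 4" "j < 4" by (auto simp: emat_def)
    have "of_rat (nf_trace K (d * (bs ! i * bs ! j))) = (\<Sum>k<4. \<sigma> k (d * (bs ! i * bs ! j)))"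
      using ij in_K d by (intro nf_trace_eq closed) auto
    also have "\<dots> = (\<Sum>k<4. \<sigma> k (bs ! i) * (\<sigma> k d * \<sigma> k (bs ! j)))"
      using ij in_K d by (intro sum.cong) (auto simp: \<sigma>_mult closed)
    finally show "map_mat of_rat ?G $$ (i, j) =
        (transpose_mat ?S * mat 4 4 (\<lambda>(i, j). \<sigma> i d * \<sigma> i (bs ! j))) $$ (i, j)"
      using ij by (simp add: emat_def scalar_prod_def lessThan_atLeast0)
  qed (auto simp: emat_def)
  moreover have "det (map_mat (of_rat :: rat \<Rightarrow> complex) ?G) = of_rat (det ?G)" by simp
  ultimately have "of_rat (det ?G) = det (transpose_mat ?S * (D * ?S))" by simp
  also have "\<dots> = det (transpose_mat ?S) * det (D * ?S)"
    by (rule det_mult[of _ 4]) (auto simp: D_def emat_def)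
  also have "det (D * ?S) = det D * det ?S"
    by (rule det_mult[of _ 4]) (auto simp: D_def emat_def)
  also have "det (transpose_mat ?S) = det ?S" by (rule det_transpose[of _ 4]) simp
  also have "det D = \<sigma> 0 d * \<sigma> 1 d * \<sigma> 2 d * \<sigma> 3 d"
    unfolding D_def det_mat_4 det_mat_3 by (simp add: numeral_2_eq_2 numeral_3_eq_3)
  finally show ?thesis by (simp add: power2_eq_square algebra_simps)
qed

lemma trace_discriminant_eq:
  assumes "length bs = 4" "\<And>j. j < 4 \<Longrightarrow> bs ! j \<in> K"
  shows "of_rat (trace_discriminant K bs) = det (emat bs) ^ 2"
  using det_trace_form[of 1 bs] assms by (simp add: trace_discriminant_def closed \<sigma>_1)

text \<open>As a sum of conjugates the trace is an algebraic integer, and it is rational.\<close>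

lemma nf_trace_int:
  assumes "x \<in> K" "algebraic_int x"
  shows "nf_trace K x \<in> \<int>"
proof -
  have "algebraic_int (of_rat (nf_trace K x) :: complex)"
    unfolding nf_trace_eq[OF assms(1)] using assms by (intro algebraic_int_sum \<sigma>_algebraic_int) auto
  hence "(of_rat (nf_trace K x) :: complex) \<in> \<int>"
    by (intro rational_algebraic_int_is_int) auto
  then obtain n where "(of_rat (nf_trace K x) :: complex) = of_int n" by (elim Ints_cases)
  hence "(of_rat (nf_trace K x) :: complex) = of_rat (of_int n)" by simp
  hence "nf_trace K x = of_int n" by (metis of_rat_eq_iff)
  thus ?thesis by simp
qed

end

section \<open>Integral bases\<close>

text \<open>Clears the denominators of a rational linear dependence, which turns independence over
  the integers into independence over the rationals.\<close>

lemma common_denominator: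
  fixes u :: "'a \<Rightarrow> rat"
  assumes "finite S"
  obtains N :: int and k where "N \<noteq> 0" "\<And>v. v \<in> S \<Longrightarrow> of_int N * u v = of_int (k v)"
proof -
  have "\<exists>N k. N \<noteq> 0 \<and> (\<forall>v\<in>S. of_int N * u v = of_int (k v))"
    using assms
  proof (induction S rule: finite_induct)
    case (insert x S)
    then obtain N k where Nk: "N \<noteq> 0" "\<And>v. v \<in> S \<Longrightarrow> of_int N * u v = of_int (k v)" by blast
    obtain a b where ab: "u x = Fract a b" "b > 0" using Rat_cases by metis
    have "of_int (N * b) * u x = of_int (N * a)"
      using ab by (simp add: Fract_of_int_quotient)
    moreover have "of_int (N * b) * u v = of_int (b * k v)" if "v \<in> S" for v
    proof -
      have "of_int (N * b) * u v = of_int b * (of_int N * u v)" by simp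
      also have "\<dots> = of_int (b * k v)" unfolding Nk(2)[OF that] by simp
      finally show ?thesis .
    qed
    ultimately have "\<forall>v\<in>insert x S. of_int (N * b) * u v = of_int (if v = x then N * a else b * k v)"
      using insert(2) by (metis insertE)
    moreover have "N * b \<noteq> 0" using Nk ab by simp
    ultimately show ?case by (intro exI[of _ "N * b"] exI[of _ "\<lambda>v. if v = x then N * a else b * k v"] conjI)
  next
    case empty
    show ?case by (intro exI[of _ 1]) simp
  qed
  thus ?thesis using that by blast
qed

lemma of_rat_complex_real: "(of_rat a :: complex) = of_real (of_rat a)"
  by (cases a) (simp add: of_rat_rat)

lemma of_rat_eq_of_int_complex: "(of_rat a :: complex) = of_int n \<longleftrightarrow> a = of_int n"
  by (metis of_rat_eq_iff of_rat_of_int_eq)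

lemma algebraic_int_of_rat:
  assumes "algebraic_int (of_rat a :: complex)"
  obtains n where "a = of_int n"
proof -
  have "(of_rat a :: complex) \<in> \<int>" using assms by (intro rational_algebraic_int_is_int) auto
  thus ?thesis using that by (elim Ints_cases) (simp add: of_rat_eq_of_int_complex)
qed

context quartic_embeddings
begin

abbreviation \<O> :: "complex set" where "\<O> \<equiv> ring_of_integers K"

lemma integers_closed:
  shows "of_int n \<in> \<O>" "\<theta> ^ i \<in> \<O>"
    and "x \<in> \<O> \<Longrightarrow> x \<in> K"
    and "x \<in> \<O> \<Longrightarrow> y \<in> \<O> \<Longrightarrow> x + y \<in> \<O>"
    and "x \<in> \<O> \<Longrightarrow> y \<in> \<O> \<Longrightarrow> x - y \<in> \<O>"
    and "x \<in> \<O> \<Longrightarrow> y \<in> \<O> \<Longrightarrow> x * y \<in> \<O>"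
    and "x \<in> \<O> \<Longrightarrow> x ^ k \<in> \<O>"
proof -
  have "of_int n \<in> K" using closed(8)[of "of_int n"] by simp
  thus "of_int n \<in> \<O>" by (simp add: ring_of_integers_def)
qed (auto simp: ring_of_integers_def intro: closed \<theta>_powers_in power_in \<theta>_int algebraic_int_add
      algebraic_int_diff algebraic_int_mult algebraic_int_power)

lemma int_span_in: "S \<subseteq> \<O> \<Longrightarrow> x \<in> int_mod.span S \<Longrightarrow> x \<in> \<O>"
  by (erule int_mod.span_induct_alt) (use integers_closed(1)[of 0] in \<open>auto intro!: integers_closed\<close>)

text \<open>Applying the four embeddings to the relation puts the coefficient vector into the kernel
  of an invertible matrix.\<close>

lemma combination_eq_0:
  assumes det: "det (emat bs) \<noteq> 0" and in_K: "\<And>j. j < 4 \<Longrightarrow> bs ! j \<in> K"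
    and zero: "(\<Sum>j<4. of_rat (c j) * bs ! j) = 0" and j: "j < 4"
  shows "c j = 0"
proof (rule ccontr)
  assume "c j \<noteq> 0"
  define v where "v = vec 4 (\<lambda>j. of_rat (c j) :: complex)"
  have "v $ j \<noteq> 0" using j \<open>c j \<noteq> 0\<close> by (simp add: v_def)
  hence "v \<noteq> 0\<^sub>v 4" using j by auto
  moreover have "emat bs *\<^sub>v v = 0\<^sub>v 4"
  proof (rule eq_vecI)
    fix i assume "i < dim_vec (0\<^sub>v 4 :: complex vec)"
    hence i: "i < 4" by simp
    have "0 = \<sigma> i (\<Sum>j<4. of_rat (c j) * bs ! j)" using i by (simp add: zero \<sigma>_0)
    also have "\<dots> = (\<Sum>j<4. \<sigma> i (of_rat (c j) * bs ! j))"
      using i in_K by (intro \<sigma>_sum closed) auto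
    also have "\<dots> = (\<Sum>j<4. of_rat (c j) * \<sigma> i (bs ! j))"
      using i in_K by (intro sum.cong) (auto simp: \<sigma>_mult \<sigma>_of_rat closed)
    finally show "(emat bs *\<^sub>v v) $ i = 0\<^sub>v 4 $ i"
      using i by (simp add: emat_def v_def scalar_prod_def lessThan_atLeast0 mult.commute)
  qed (simp add: emat_def)
  ultimately have "det (emat bs) = 0"
    by (subst det_0_iff_vec_prod_zero_field[OF emat_carrier]) (auto simp: v_def intro!: exI[of _ v])
  thus False using det by blast
qed

lemma basis_of_det_nonzero:
  assumes len: "length bs = 4" and in_K: "\<And>j. j < 4 \<Longrightarrow> bs ! j \<in> K" and det: "det (emat bs) \<noteq> 0"
  shows "distinct bs" "rat_vs.independent (set bs)" "rat_vs.span (set bs) = K"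
proof -
  show dist: "distinct bs"
  proof (rule ccontr)
    assume "\<not> distinct bs"
    then obtain i j where ij: "i < 4" "j < 4" "i \<noteq> j" "bs ! i = bs ! j"
      using len by (auto simp: distinct_conv_nth)
    hence "col (emat bs) i = col (emat bs) j" by (auto simp: emat_def)
    thus False using det_identical_columns[OF emat_carrier ij(3,1,2)] det by blast
  qed
  show ind: "rat_vs.independent (set bs)"
  proof
    assume "rat_vs.dependent (set bs)"
    then obtain u where u: "\<exists>v\<in>set bs. u v \<noteq> 0" "(\<Sum>v\<in>set bs. of_rat (u v) * v) = 0"
      by (subst (asm) rat_vs.dependent_finite) auto
    have bij: "bij_betw (\<lambda>j. bs ! j) {..<4} (set bs)"
      using dist len by (auto simp: bij_betw_def inj_on_def nth_eq_iff_index_eq set_conv_nth)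
    have sum0: "(\<Sum>j<4. of_rat (u (bs ! j)) * bs ! j) = 0"
      using u(2) sum.reindex_bij_betw[OF bij, of "\<lambda>v. of_rat (u v) * v"] by simp
    have "u (bs ! j) = 0" if "j < 4" for j by (rule combination_eq_0[OF det in_K sum0 that])
    thus False using u(1) len by (auto simp: set_conv_nth)
  qed
  have "card (set bs) = 4" using dist len by (simp add: distinct_card)
  moreover have "set bs \<subseteq> K" using in_K len by (auto simp: set_conv_nth)
  ultimately show "rat_vs.span (set bs) = K" by (intro independent_card_span ind)
qed

lemma det_trace_form_int:
  assumes "\<And>i j. i < 4 \<Longrightarrow> j < 4 \<Longrightarrow> nf_trace K (f i j) \<in> \<int>"
  obtains n where "det (mat 4 4 (\<lambda>(i, j). nf_trace K (f i j))) = of_int n"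
proof -
  have "mat 4 4 (\<lambda>(i, j). nf_trace K (f i j)) =
      map_mat of_int (mat 4 4 (\<lambda>(i, j). \<lfloor>nf_trace K (f i j)\<rfloor>))"
  proof (rule eq_matI)
    fix i j assume "i < dim_row (map_mat of_int (mat 4 4 (\<lambda>(i, j). \<lfloor>nf_trace K (f i j)\<rfloor>)))"
      "j < dim_col (map_mat of_int (mat 4 4 (\<lambda>(i, j). \<lfloor>nf_trace K (f i j)\<rfloor>)))"
    hence ij: "i < 4" "j < 4" by auto
    obtain n where "nf_trace K (f i j) = of_int n" using assms[OF ij] by (elim Ints_cases)
    thus "mat 4 4 (\<lambda>(i, j). nf_trace K (f i j)) $$ (i, j) =
        map_mat of_int (mat 4 4 (\<lambda>(i, j). \<lfloor>nf_trace K (f i j)\<rfloor>)) $$ (i, j)"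
      using ij by simp
  qed auto
  thus ?thesis using that by simp
qed

lemma det_emat_sq_int:
  assumes "length bs = 4" "\<And>j. j < 4 \<Longrightarrow> bs ! j \<in> \<O>"
  obtains d :: int where "det (emat bs) ^ 2 = of_int d"
proof -
  obtain n where n: "det (mat 4 4 (\<lambda>(i, j). nf_trace K (1 * (bs ! i * bs ! j)))) = of_int n"
    by (rule det_trace_form_int[of "\<lambda>i j. 1 * (bs ! i * bs ! j)"])
       (use assms integers_closed(6) in \<open>auto simp: ring_of_integers_def intro!: nf_trace_int\<close>)
  have "of_int n = det (emat bs) ^ 2"
    using det_trace_form[of 1 bs] assms integers_closed(3) unfolding n
    by (simp add: \<sigma>_1 closed)
  thus ?thesis using that by metis
qed

text \<open>An integral basis is also a rational basis of \<open>K\<close>: a rational dependence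
  becomes an integral one after clearing denominators, and the powers of \<open>\<theta>\<close> are
  integers that already span \<open>K\<close>.\<close>

lemma integral_coordinates:
  assumes bs: "integral_basis K bs"
  shows "length bs = 4" "\<And>j. j < 4 \<Longrightarrow> bs ! j \<in> \<O>" "det (emat bs) \<noteq> 0"
    "\<And>x. x \<in> \<O> \<Longrightarrow> \<exists>m::nat \<Rightarrow> int. x = (\<Sum>k<4. of_int (m k) * bs ! k)"
proof -
  have dist: "distinct bs" and ind: "int_mod.independent (set bs)"
    and span: "int_mod.span (set bs) = \<O>" using bs by (auto simp: integral_basis_def)
  have sub: "set bs \<subseteq> \<O>" using span int_mod.span_superset by blast
  have int_rat: "int_mod.span (set bs) \<subseteq> rat_vs.span (set bs)"
  proof
    fix x assume "x \<in> int_mod.span (set bs)"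
    thus "x \<in> rat_vs.span (set bs)"
    proof (induction rule: int_mod.span_induct_alt)
      case (step c x y)
      thus ?case
        using rat_vs.span_add[OF rat_vs.span_scale[OF rat_vs.span_base[OF step(1)], of "of_int c"] step(2)]
        by simp
    qed (simp add: rat_vs.span_zero)
  qed
  have rat_ind: "rat_vs.independent (set bs)"
  proof
    assume "rat_vs.dependent (set bs)"
    then obtain u where u: "\<exists>v\<in>set bs. u v \<noteq> 0" "(\<Sum>v\<in>set bs. of_rat (u v) * v) = 0"
      by (subst (asm) rat_vs.dependent_finite) auto
    obtain N k where Nk: "N \<noteq> 0" "\<And>v. v \<in> set bs \<Longrightarrow> of_int N * u v = of_int (k v)"
      using common_denominator[of "set bs" u] by auto
    have "(\<Sum>v\<in>set bs. of_int (k v) * v) = (\<Sum>v\<in>set bs. of_int N * (of_rat (u v) * v))"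
    proof (rule sum.cong)
      fix v assume "v \<in> set bs"
      hence "(of_rat (of_int N * u v) :: complex) = of_rat (of_int (k v))" using Nk by simp
      thus "of_int (k v) * v = of_int N * (of_rat (u v) * v)" by (simp add: of_rat_mult)
    qed simp
    also have "\<dots> = 0" using u(2) by (simp flip: sum_distrib_left)
    finally have "(\<Sum>v\<in>set bs. of_int (k v) * v) = 0" .
    moreover have "\<exists>v\<in>set bs. k v \<noteq> 0" using u(1) Nk by force
    ultimately have "int_mod.dependent (set bs)"
      unfolding int_mod.dependent_explicit by (intro exI[of _ "set bs"] exI[of _ k]) auto
    thus False using ind by blast
  qed
  have "K \<subseteq> rat_vs.span (set bs)"
  proof
    fix x assume "x \<in> K"
    then obtain p where p: "degree p < 4" "x = qeval p \<theta>" by (rule obtain_qeval)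
    have "\<theta> ^ i \<in> rat_vs.span (set bs)" for i
      using int_rat span integers_closed(2) by blast
    thus "x \<in> rat_vs.span (set bs)"
      unfolding p(2) qeval_altdef[OF p(1)] by (intro rat_vs.span_sum rat_vs.span_scale)
  qed
  moreover have "set bs \<subseteq> K" using sub integers_closed(3) by blast
  ultimately have rat_span: "rat_vs.span (set bs) = K"
    using rat_vs.span_mono closed(10) by blast
  have "card (set bs) = rat_vs.dim K"
    using rat_vs.dim_eq_card[of "set bs" K] rat_ind rat_span by (metis rat_vs.span_span)
  thus len: "length bs = 4" using dist deg4 by (simp add: distinct_card nf_degree_def)
  show "bs ! j \<in> \<O>" if "j < 4" for j using sub len that by auto
  show "det (emat bs) \<noteq> 0" by (rule det_emat_basis[OF len dist rat_span])
  show "\<exists>m::nat \<Rightarrow> int. x = (\<Sum>k<4. of_int (m k) * bs ! k)" if "x \<in> \<O>" for x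
  proof -
    have "x \<in> int_mod.span (set bs)" using that span by simp
    then obtain u where u: "x = (\<Sum>v\<in>set bs. of_int (u v) * v)" by (auto simp: int_mod.span_finite)
    have bij: "bij_betw (\<lambda>j. bs ! j) {..<4} (set bs)"
      using dist len by (auto simp: bij_betw_def inj_on_def nth_eq_iff_index_eq set_conv_nth)
    have "x = (\<Sum>k<4. of_int (u (bs ! k)) * bs ! k)"
      unfolding u by (rule sum.reindex_bij_betw[OF bij, symmetric])
    thus ?thesis by (intro exI[of _ "\<lambda>k. u (bs ! k)"])
  qed
qed

lemma sum_integral_combination:
  assumes "\<And>j. j < 4 \<Longrightarrow> bs ! j \<in> \<O>"
  shows "(\<Sum>k<4. of_int (m k) * bs ! k) \<in> \<O>"
proof -
  have "(\<Sum>k\<in>J. of_int (m k) * bs ! k) \<in> \<O>" if "J \<subseteq> {..<4}" for J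
    using that by (induction J rule: infinite_finite_induct)
      (use integers_closed(1)[of 0] assms in \<open>auto intro!: integers_closed\<close>)
  thus ?thesis by blast
qed

text \<open>A rational basis of algebraic integers with minimal discriminant is integral: a non-integral
  coordinate \<open>c k\<close> of an integer would allow to shrink the discriminant by the factor
  \<open>(frac (c k))\<^sup>2\<close>.\<close>

lemma integral_basis_exists: "\<exists>bs. integral_basis K bs"
proof -
  define Q where "Q bs \<longleftrightarrow> length bs = 4 \<and> (\<forall>j<4. bs ! j \<in> \<O>) \<and> det (emat bs) \<noteq> 0" for bs
  \<comment> \<open>For lists of integers the squared determinant is a rational integer, so the
    floor changes nothing; it only provides a natural number to minimise.\<close>
  define N where "N bs = nat \<lfloor>cmod (det (emat bs) ^ 2)\<rfloor>" for bs
  have "Q (powers \<theta>)"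
    using det_emat_\<theta> by (auto simp: Q_def integers_closed(2) simp del: upt_rec_numeral)
  then obtain bs where bs: "Q bs" and min: "\<And>bs'. Q bs' \<Longrightarrow> N bs \<le> N bs'"
    using ex_has_least_nat[of Q "powers \<theta>" N] by blast
  have N: "real (N bs') = cmod (det (emat bs')) ^ 2" if Q: "Q bs'" for bs'
  proof -
    obtain d :: int where "det (emat bs') ^ 2 = of_int d"
      using det_emat_sq_int[of bs'] Q by (auto simp: Q_def)
    thus ?thesis by (simp add: N_def flip: norm_power)
  qed
  have len: "length bs = 4" and in_O: "\<And>j. j < 4 \<Longrightarrow> bs ! j \<in> \<O>" and det: "det (emat bs) \<noteq> 0"
    using bs by (auto simp: Q_def)
  have in_K: "bs ! j \<in> K" if "j < 4" for j using in_O[OF that] integers_closed(3) by blast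
  note basis = basis_of_det_nonzero[OF len in_K det]
  have "int_mod.span (set bs) = \<O>"
  proof (intro equalityI subsetI)
    fix x assume "x \<in> int_mod.span (set bs)"
    thus "x \<in> \<O>" using int_span_in[of "set bs"] in_O len by (auto simp: set_conv_nth)
  next
    fix x assume x: "x \<in> \<O>"
    obtain c where c: "x = (\<Sum>k<4. of_rat (c k) * bs ! k)"
      using coordinates[OF len basis(1,3) integers_closed(3)[OF x]] by blast
    have "c k \<in> \<int>" if k: "k < 4" for k
    proof (rule ccontr)
      assume nint: "c k \<notin> \<int>"
      define y where "y = x - of_int \<lfloor>c k\<rfloor> * bs ! k"
      have yO: "y \<in> \<O>" unfolding y_def using x in_O[OF k] by (intro integers_closed)
      define v where "v = vec 4 (\<lambda>j. of_rat (if j = k then frac (c k) else c j) :: complex)"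
      have y: "y = (\<Sum>j<4. v $ j * bs ! j)"
      proof -
        have "(\<Sum>j<4. v $ j * bs ! j) =
            (\<Sum>j<4. of_rat (c j) * bs ! j - (if j = k then of_int \<lfloor>c k\<rfloor> * bs ! k else 0))"
          by (intro sum.cong) (auto simp: v_def frac_def of_rat_diff algebra_simps)
        also have "\<dots> = y" using k by (simp add: sum_subtractf y_def c)
        finally show ?thesis by simp
      qed
      \<comment> \<open>As in Cramer's rule, replacing column \<open>k\<close> by the image of
        \<open>v\<close> multiplies the determinant by the entry \<open>k\<close> of
        \<open>v\<close>, which is the fractional part.\<close>
      have "emat (bs[k := y]) = replace_col (emat bs) (emat bs *\<^sub>v v) k"
      proof (rule eq_matI)
        fix i j assume "i < dim_row (replace_col (emat bs) (emat bs *\<^sub>v v) k)"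
          "j < dim_col (replace_col (emat bs) (emat bs *\<^sub>v v) k)"
        hence ij: "i < 4" "j < 4" by (auto simp: replace_col_def emat_def)
        have "\<sigma> i y = (\<Sum>j<4. \<sigma> i (v $ j * bs ! j))"
          unfolding y using ij in_K by (intro \<sigma>_sum) (auto simp: v_def intro!: closed)
        also have "\<dots> = (\<Sum>j<4. \<sigma> i (bs ! j) * v $ j)"
          using ij in_K by (intro sum.cong) (auto simp: v_def \<sigma>_mult \<sigma>_of_rat closed)
        also have "\<dots> = (emat bs *\<^sub>v v) $ i"
          using ij by (simp add: emat_def v_def scalar_prod_def lessThan_atLeast0)
        finally show "emat (bs[k := y]) $$ (i, j) =
            replace_col (emat bs) (emat bs *\<^sub>v v) k $$ (i, j)"
          using ij len k by (auto simp: replace_col_def emat_def nth_list_update)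
      qed (auto simp: replace_col_def emat_def)
      also have "det \<dots> = v $ k * det (emat bs)"
        by (rule cramer_lemma_mat[OF emat_carrier _ k]) (simp add: v_def)
      finally have det': "det (emat (bs[k := y])) = of_rat (frac (c k)) * det (emat bs)"
        using k by (simp add: v_def)
      have frac: "frac (c k) > 0" "frac (c k) < 1"
        using nint by (simp_all add: frac_gt_0_iff frac_lt_1)
      have Q': "Q (bs[k := y])"
        using bs yO k det' frac by (auto simp: Q_def nth_list_update)
      have "real (N (bs[k := y])) = cmod (of_rat (frac (c k))) ^ 2 * cmod (det (emat bs)) ^ 2"
        unfolding N[OF Q'] det' by (simp add: norm_mult power_mult_distrib)
      also have "cmod (of_rat (frac (c k))) = real_of_rat (frac (c k))"
        using frac by (simp add: of_rat_complex_real)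
      also have "real_of_rat (frac (c k)) ^ 2 * cmod (det (emat bs)) ^ 2 <
          1 * cmod (det (emat bs)) ^ 2"
        using frac det by (intro mult_strict_right_mono) (simp_all add: abs_square_less_1)
      also have "\<dots> = real (N bs)" using N[OF bs] by simp
      finally show False using min[OF Q'] by simp
    qed
    hence "\<exists>n. c k = of_int n" if "k < 4" for k using that by (auto elim: Ints_cases)
    then obtain m where m: "\<And>k. k < 4 \<Longrightarrow> c k = of_int (m k)" by metis
    have "x = (\<Sum>k<4. of_int (m k) * bs ! k)" unfolding c by (intro sum.cong) (auto simp: m)
    also have "\<dots> \<in> int_mod.span (set bs)"
      using len by (intro int_mod.span_sum int_mod.span_scale int_mod.span_base) auto
    finally show "x \<in> int_mod.span (set bs)" .
  qed
  moreover have "int_mod.independent (set bs)"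
  proof
    assume "int_mod.dependent (set bs)"
    then obtain T u where T: "finite T" "T \<subseteq> set bs" "(\<Sum>v\<in>T. of_int (u v) * v) = 0"
        "\<exists>v\<in>T. u v \<noteq> 0"
      unfolding int_mod.dependent_explicit by blast
    hence "rat_vs.dependent (set bs)"
      unfolding rat_vs.dependent_explicit
      by (intro exI[of _ T] exI[of _ "\<lambda>v. of_int (u v)"]) auto
    thus False using basis by blast
  qed
  ultimately show ?thesis using basis(1) by (auto simp: integral_basis_def)
qed

lemma obtain_integral_basis:
  obtains bs where "integral_basis K bs" "det (emat bs) ^ 2 = of_rat (nf_discriminant K)"
proof -
  define bs where "bs = (SOME bs. integral_basis K bs)"
  have bs: "integral_basis K bs" unfolding bs_def by (rule someI_ex[OF integral_basis_exists])
  have "of_rat (nf_discriminant K) = det (emat bs) ^ 2"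
    unfolding nf_discriminant_def bs_def[symmetric]
    using integral_coordinates[OF bs] integers_closed(3) by (intro trace_discriminant_eq) auto
  thus ?thesis using that bs by metis
qed

text \<open>If \<open>\<delta>\<^sup>2 = D\<close> is squarefree, then the trace of \<open>x / \<delta>\<close> is a rational number \<open>w\<close> such that
  \<open>w\<^sup>2 * D\<close> is an algebraic integer, so \<open>w\<close> is an integer; hence \<open>D\<^sup>2\<close> divides the discriminant.\<close>

lemma no_sqrt:
  assumes bs: "integral_basis K bs" and disc: "det (emat bs) ^ 2 = of_int d"
    and q: "prime (abs d)" and real0: "r 0 \<in> \<real>"
    and \<delta>: "\<delta> \<in> K" "\<delta> ^ 2 = of_rat t"
  shows "\<delta> \<in> \<rat>"
proof (rule ccontr)
  assume irr: "\<delta> \<notin> \<rat>"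
  obtain a b where ab: "t = Fract a b" "b > 0" using Rat_cases by metis
  have "\<delta> \<noteq> 0" using irr by auto
  hence "t \<noteq> 0" using \<delta>(2) by auto
  hence "a \<noteq> 0" using ab by (auto simp: rat_number_collapse)
  \<comment> \<open>Up to a rational square, \<open>a / b\<close> equals \<open>a * b\<close>.
    Writing \<open>a * b = D * m^2\<close>, the multiple \<open>b / m\<close> of
    \<open>\<delta>\<close> has square \<open>D\<close>.\<close>
  define D where "D = squarefree_part (a * b)"
  define m where "m = square_part (a * b)"
  have Dm: "a * b = D * m ^ 2" unfolding D_def m_def by (rule squarefree_decompose)
  have "m \<noteq> 0" using Dm \<open>a \<noteq> 0\<close> ab by auto
  have sqf: "squarefree D" by (simp add: D_def)
  define e where "e = of_rat (of_int b / of_int m) * \<delta>"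
  have eK: "e \<in> K" unfolding e_def by (intro closed \<delta>)
  have "e ^ 2 = of_rat ((of_int b / of_int m) ^ 2 * t)"
    by (simp add: e_def power_mult_distrib \<delta>(2) of_rat_mult of_rat_power)
  also have "(of_int b / of_int m) ^ 2 * t = (of_int D :: rat)"
  proof -
    have "(of_int b / of_int m) ^ 2 * t = of_int (a * b) / of_int m ^ 2"
      using ab by (simp add: Fract_of_int_quotient power2_eq_square)
    also have "\<dots> = of_int D" unfolding Dm using \<open>m \<noteq> 0\<close> by simp
    finally show ?thesis .
  qed
  finally have e2: "e ^ 2 = of_int D" by simp
  have e_irr: "e \<notin> \<rat>"
  proof
    assume "e \<in> \<rat>"
    hence "of_rat (of_int m / of_int b) * e \<in> \<rat>" by simp
    moreover have "of_rat (of_int m / of_int b) * e = \<delta>"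
      using ab \<open>m \<noteq> 0\<close> by (simp add: e_def of_rat_divide)
    ultimately show False using irr by simp
  qed
  have "e \<noteq> 0" using e_irr by auto
  have "D \<noteq> 0" using e2 \<open>e \<noteq> 0\<close> by auto
  have \<sigma>e: "\<sigma> i e ^ 2 = of_int D" if "i < 4" for i
    using \<sigma>_power[OF that eK, of 2] e2 that by (simp add: \<sigma>_of_int)
  \<comment> \<open>All conjugates of \<open>e\<close> agree up to sign, so the trace of
    \<open>x / e\<close> is an algebraic integer divided by the single number
    \<open>\<sigma> 0 e\<close>.\<close>
  define \<epsilon> where "\<epsilon> i = \<sigma> i e / \<sigma> 0 e" for i
  have \<epsilon>: "\<epsilon> i = 1 \<or> \<epsilon> i = - 1" if "i < 4" for i
  proof -
    have "\<epsilon> i ^ 2 = 1" using \<sigma>e[OF that] \<sigma>e[of 0] \<open>D \<noteq> 0\<close> by (simp add: \<epsilon>_def power_divide)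
    thus ?thesis by (simp add: power2_eq_1_iff)
  qed
  have int_tr: "nf_trace K (inverse e * x) \<in> \<int>" if x: "x \<in> \<O>" for x
  proof -
    define w where "w = nf_trace K (inverse e * x)"
    have xK: "x \<in> K" using x integers_closed(3) by blast
    have "of_rat w = (\<Sum>i<4. \<sigma> i (inverse e * x))"
      unfolding w_def by (intro nf_trace_eq closed eK xK)
    also have "\<dots> = (\<Sum>i<4. (\<epsilon> i * \<sigma> i x) / \<sigma> 0 e)"
    proof (rule sum.cong)
      fix i assume "i \<in> {..<4::nat}"
      hence i: "i < 4" by simp
      have nz: "\<sigma> i e \<noteq> 0" "\<sigma> 0 e \<noteq> 0" using \<sigma>_eq_0[OF _ eK] i \<open>e \<noteq> 0\<close> by auto
      have "inverse (\<sigma> i e) = \<epsilon> i / \<sigma> 0 e"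
        using \<epsilon>[OF i] nz by (auto simp: \<epsilon>_def field_simps)
      thus "\<sigma> i (inverse e * x) = (\<epsilon> i * \<sigma> i x) / \<sigma> 0 e"
        using i eK xK by (simp add: \<sigma>_mult \<sigma>_inverse closed)
    qed simp
    also have "\<dots> = (\<Sum>i<4. \<epsilon> i * \<sigma> i x) / \<sigma> 0 e" by (simp add: sum_divide_distrib)
    finally have w: "of_rat w = (\<Sum>i<4. \<epsilon> i * \<sigma> i x) / \<sigma> 0 e" .
    have "of_rat (w ^ 2 * of_int D) = (\<Sum>i<4. \<epsilon> i * \<sigma> i x) ^ 2"
      using \<sigma>e[of 0] \<open>D \<noteq> 0\<close> by (simp add: of_rat_mult of_rat_power w power_divide)
    moreover have "algebraic_int ((\<Sum>i<4. \<epsilon> i * \<sigma> i x) ^ 2)"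
    proof (intro algebraic_int_power algebraic_int_sum algebraic_int_mult)
      fix i assume "i \<in> {..<4::nat}"
      hence i: "i < 4" by simp
      show "algebraic_int (\<epsilon> i)" using \<epsilon>[OF i] by auto
      show "algebraic_int (\<sigma> i x)" using i x by (simp add: ring_of_integers_def \<sigma>_algebraic_int)
    qed
    ultimately obtain n where n: "w ^ 2 * of_int D = of_int n" by (metis algebraic_int_of_rat)
    obtain u v where uv: "w = Fract u v" "v > 0" "coprime u v" using Rat_cases by metis
    have "(of_int (u ^ 2 * D) :: rat) = of_int (n * v ^ 2)"
      using n uv by (simp add: Fract_of_int_quotient power_divide field_simps)
    hence "u ^ 2 * D = n * v ^ 2" by (metis of_int_eq_iff)
    hence "v ^ 2 dvd u ^ 2 * D" by simp
    moreover have "coprime (v ^ 2) (u ^ 2)" using uv(3) by (simp add: coprime_commute)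
    ultimately have "v ^ 2 dvd D" by (simp add: coprime_dvd_mult_right_iff)
    hence "v dvd 1" using sqf by (auto simp: squarefree_def)
    hence "v = 1" using uv(2) by simp
    thus "nf_trace K (inverse e * x) \<in> \<int>" using uv by (simp flip: w_def add: Fract_of_int_quotient)
  qed
  note bs' = integral_coordinates[OF bs]
  obtain n where n: "det (mat 4 4 (\<lambda>(i, j). nf_trace K (inverse e * (bs ! i * bs ! j)))) = of_int n"
    by (rule det_trace_form_int[of "\<lambda>i j. inverse e * (bs ! i * bs ! j)"])
       (use bs'(2) in \<open>auto intro!: int_tr integers_closed\<close>)
  have "of_int n = \<sigma> 0 (inverse e) * \<sigma> 1 (inverse e) * \<sigma> 2 (inverse e) * \<sigma> 3 (inverse e) * of_int d"
    using det_trace_form[of "inverse e" bs] bs'(2) integers_closed(3) eK unfolding n disc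
    by (simp add: closed)
  also have "\<dots> = of_int d / (\<sigma> 0 e * \<sigma> 1 e * \<sigma> 2 e * \<sigma> 3 e)"
    using eK by (simp add: \<sigma>_inverse divide_inverse ac_simps)
  \<comment> \<open>The product of the conjugates of \<open>e\<close> is \<open>D^2\<close> up to
    sign; squaring removes the need to know how the signs are distributed.\<close>
  finally have "of_int n ^ 2 = (of_int d / (\<sigma> 0 e * \<sigma> 1 e * \<sigma> 2 e * \<sigma> 3 e)) ^ 2" by simp
  also have "\<dots> = of_int d ^ 2 / (\<sigma> 0 e ^ 2 * \<sigma> 1 e ^ 2 * \<sigma> 2 e ^ 2 * \<sigma> 3 e ^ 2)"
    by (simp add: power_divide power_mult_distrib)
  also have "\<dots> = of_int d ^ 2 / of_int D ^ 4"
    by (simp add: \<sigma>e power4_eq_xxxx)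
  finally have "(of_int (n ^ 2 * D ^ 4) :: complex) = of_int (d ^ 2)"
    using \<open>D \<noteq> 0\<close> by (simp add: field_simps)
  hence "n ^ 2 * D ^ 4 = d ^ 2" by (metis of_int_eq_iff)
  hence "(n * D ^ 2) ^ 2 = d ^ 2" by (simp add: power_mult_distrib flip: power_mult)
  hence "d = n * D ^ 2 \<or> d = - (n * D ^ 2)" unfolding power2_eq_iff by linarith
  hence "D ^ 2 dvd \<bar>d\<bar>" by auto
  moreover have "squarefree \<bar>d\<bar>" using q by (intro squarefree_prime) auto
  ultimately have "D dvd 1" unfolding squarefree_def by blast
  hence "\<bar>D\<bar> = 1" by simp
  hence "D = 1 \<or> D = - 1" by linarith
  thus False
  proof
    assume "D = 1"
    hence "e = 1 \<or> e = - 1" using e2 by (simp add: power2_eq_1_iff)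
    thus False using e_irr by auto
  next
    \<comment> \<open>A real embedding cannot send \<open>e\<close> to a square root of
      \<open>-1\<close>.\<close>
    assume D1: "D = - 1"
    have "cnj (\<sigma> 0 e) = \<sigma> 0 e"
    proof -
      obtain p where p: "e = qeval p \<theta>" using obtain_qeval[OF eK] by metis
      show ?thesis using real0 by (simp add: p \<sigma>_poly qeval_cnj Reals_cnj_iff)
    qed
    then obtain s where "\<sigma> 0 e = of_real s" by (metis Reals_cases Reals_cnj_iff)
    hence "complex_of_real (s ^ 2) = complex_of_real (- 1)" using \<sigma>e[of 0] D1 by simp
    hence "s ^ 2 = - 1" by (metis of_real_eq_iff)
    thus False using zero_le_power2[of s] by linarith
  qed
qed

end

section \<open>Minkowski's theorem on linear forms\<close>

text \<open>The unit cubes with integer corners cut \<open>E\<close> into pieces. Translated into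
  one unit cube, the pieces have total measure above 1, so two of them overlap, and the overlap
  comes from two points differing by an integer vector.\<close>

lemma blichfeldt:
  fixes E :: "(real ^ 'n) set"
  assumes E: "E \<in> lmeasurable" and bdd: "bounded E" and big: "measure lebesgue E > 1"
  obtains x y where "x \<in> E" "y \<in> E" "x \<noteq> y" "\<And>i. vec_nth x i - vec_nth y i \<in> \<int>"
proof (rule ccontr)
  note witness = that
  assume "\<not> thesis"
  hence no: "x = y" if "x \<in> E" "y \<in> E" "\<And>i. vec_nth x i - vec_nth y i \<in> \<int>" for x y
    using that witness by blast
  define fl :: "real ^ 'n \<Rightarrow> real ^ 'n" where "fl x = (\<chi> i. of_int \<lfloor>vec_nth x i\<rfloor>)" for x
  define C :: "real ^ 'n \<Rightarrow> (real ^ 'n) set"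
    where "C k = {x. \<forall>i. vec_nth k i \<le> vec_nth x i \<and> vec_nth x i < vec_nth k i + 1}" for k
  define T where "T = fl ` E"
  have flC: "x \<in> C (fl x)" for x by (auto simp: C_def fl_def)
  have finT: "finite T"
  proof -
    obtain M where M: "\<And>x. x \<in> E \<Longrightarrow> norm x \<le> M" using bdd by (auto simp: bounded_iff)
    define F where "F = (of_int :: int \<Rightarrow> real) ` {- \<lceil>M\<rceil> - 1 .. \<lceil>M\<rceil> + 1}"
    have "T \<subseteq> (\<lambda>g. \<chi> i. g i) ` (PiE UNIV (\<lambda>_. F))"
    proof
      fix k assume "k \<in> T"
      then obtain x where x: "x \<in> E" "k = fl x" by (auto simp: T_def)
      have "vec_nth k i \<in> F" for i
      proof -
        have "\<bar>vec_nth x i\<bar> \<le> M" using M[OF x(1)] component_le_norm_cart[of x i] by linarith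
        hence "\<lfloor>vec_nth x i\<rfloor> \<in> {- \<lceil>M\<rceil> - 1 .. \<lceil>M\<rceil> + 1}" by (auto simp: abs_le_iff) linarith+
        thus ?thesis by (auto simp: x fl_def F_def)
      qed
      hence "(\<lambda>i. vec_nth k i) \<in> PiE UNIV (\<lambda>_. F)" by (auto simp: PiE_def)
      thus "k \<in> (\<lambda>g. \<chi> i. g i) ` (PiE UNIV (\<lambda>_. F))" by (rule rev_image_eqI) (simp add: Finite_Cartesian_Product.vec_eq_iff)
    qed
    moreover have "finite (PiE UNIV (\<lambda>_ :: 'n. F))" by (intro finite_PiE) (auto simp: F_def)
    ultimately show ?thesis using finite_surj by blast
  qed
  have C_meas: "C k \<in> lmeasurable" for k
  proof (rule bounded_set_imp_lmeasurable)
    show "bounded (C k)"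
      by (rule bounded_subset[OF bounded_cbox[of k "k + 1"]])
         (auto simp: C_def mem_box_cart, meson less_imp_le)
    have "C k = (\<Inter>i. {x. vec_nth k i \<le> vec_nth x i} \<inter> {x. vec_nth x i < vec_nth k i + 1})"
      by (auto simp: C_def)
    also have "\<dots> \<in> sets borel"
      by (intro sets.finite_INT sets.Int borel_closed borel_open closed_halfspace_component_ge_cart
            open_halfspace_component_lt_cart) auto
    finally show "C k \<in> sets lebesgue" by simp
  qed
  have C_disj: "k = k'" if "x \<in> C k" "x \<in> C k'" "k \<in> T" "k' \<in> T" for x k k'
  proof -
    have "fl x = k" if "x \<in> C k" "k \<in> T" for k
    proof -
      obtain z where z: "k = fl z" using \<open>k \<in> T\<close> by (auto simp: T_def)
      show ?thesis
        using \<open>x \<in> C k\<close> unfolding z by (auto simp: C_def fl_def Finite_Cartesian_Product.vec_eq_iff floor_eq_iff)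
    qed
    thus ?thesis using that by metis
  qed
  have piece: "E \<inter> C k \<in> lmeasurable" for k using E C_meas by (rule fmeasurable.Int)
  \<comment> \<open>The piece of \<open>E\<close> in the cube with corner \<open>k\<close>, moved
    into the cube at the origin.\<close>
  define G where "G k = (\<lambda>x. - k + x) ` (E \<inter> C k)" for k
  have G_meas: "G k \<in> lmeasurable" for k
    unfolding G_def by (rule measurable_translation[OF piece])
  have G_measure: "measure lebesgue (G k) = measure lebesgue (E \<inter> C k)" for k
    unfolding G_def by (rule measure_translation)
  have "E = (\<Union>k\<in>T. E \<inter> C k)" using flC by (auto simp: T_def)
  hence "measure lebesgue E = measure lebesgue (\<Union>k\<in>T. E \<inter> C k)" by simp
  also have "\<dots> = (\<Sum>k\<in>T. measure lebesgue (E \<inter> C k))"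
    using C_disj by (intro measure_UNION' finT piece) (auto simp: pairwise_def disjnt_def)
  also have "\<dots> = (\<Sum>k\<in>T. measure lebesgue (G k))" by (simp add: G_measure)
  also have "\<dots> = measure lebesgue (\<Union>k\<in>T. G k)"
  proof (intro measure_UNION'[symmetric] finT G_meas)
    show "pairwise (\<lambda>k k'. disjnt (G k) (G k')) T"
      unfolding pairwise_def disjnt_def
    proof (intro ballI impI equals0I)
      \<comment> \<open>A common point \<open>z = x - k = y - k'\<close> makes \<open>x - y\<close>
        an integer vector, so \<open>x = y\<close>; but this point would lie in two different cubes
        of the partition.\<close>
      fix k k' z assume k: "k \<in> T" "k' \<in> T" "k \<noteq> k'" and "z \<in> G k \<inter> G k'"
      then obtain x y where x: "x \<in> E" "x \<in> C k" "z = x - k" and y: "y \<in> E" "y \<in> C k'" "z = y - k'"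
        by (auto simp: G_def)
      have "vec_nth x i - vec_nth y i \<in> \<int>" for i
      proof -
        have "x - y = k - k'" using x y by (simp add: algebra_simps)
        hence "vec_nth x i - vec_nth y i = vec_nth k i - vec_nth k' i"
          by (metis vector_minus_component)
        moreover have "vec_nth k i \<in> \<int>" "vec_nth k' i \<in> \<int>" using k by (auto simp: T_def fl_def)
        ultimately show ?thesis by simp
      qed
      hence "x = y" using no x y by blast
      thus False using C_disj x y k by blast
    qed
  qed
  also have "\<dots> \<le> measure lebesgue (cbox (0 :: real ^ 'n) 1)"
  proof (rule measure_mono_fmeasurable)
    show "(\<Union>k\<in>T. G k) \<subseteq> cbox 0 1"
      by (auto simp: G_def C_def mem_box_cart) (simp_all add: algebra_simps less_imp_le)
    show "(\<Union>k\<in>T. G k) \<in> sets lebesgue" using G_meas finT by (intro sets.finite_UN) auto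
  qed auto
  also have "\<dots> = 1"
    by (simp add: content_cbox_cart interval_eq_empty_cart)
  finally show False using big by simp
qed

text \<open>The preimage under \<open>A\<close> of the box with side lengths \<open>c i\<close> has
  measure the product of the \<open>c i\<close> divided by the absolute determinant, which exceeds
  1. Two of its points differ by an integer vector, whose image is a difference of two points of the
  box.\<close>

lemma minkowski_linear_forms:
  fixes A :: "real ^ 'n :: {finite, wellorder} ^ 'n :: {finite, wellorder}" and c :: "'n \<Rightarrow> real"
  assumes c: "\<And>i. c i > 0" and det: "Determinants.det A \<noteq> 0"
    and lt: "\<bar>Determinants.det A\<bar> < (\<Prod>i\<in>UNIV. c i)"
  obtains m :: "'n \<Rightarrow> int" where "\<exists>j. m j \<noteq> 0"
    "\<And>i. \<bar>\<Sum>j\<in>UNIV. vec_nth (vec_nth A i) j * of_int (m j)\<bar> < c i"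
proof -
  \<comment> \<open>The box has half-widths \<open>c i / 2\<close>, since differences of its points
    are to be bounded by \<open>c i\<close>; being open, it yields strict bounds.\<close>
  define Bx where "Bx = box (\<chi> i. - (c i / 2)) (\<chi> i. c i / 2)"
  have inv: "invertible A" using det by (simp add: invertible_det_nz)
  then obtain A' where A': "A ** A' = Finite_Cartesian_Product.mat 1"
    by (auto simp: invertible_def)
  define g where "g = (\<lambda>y. A' *v y)"
  have Ag: "A *v g y = y" for y by (simp add: g_def matrix_vector_mul_assoc A')
  define E where "E = g ` Bx"
  have lin: "linear g" "linear (\<lambda>x. A *v x)" by (simp_all add: g_def)
  have E: "E \<in> lmeasurable"
    unfolding E_def Bx_def by (intro measurable_linear_image lin) auto
  have bdd: "bounded E"
    unfolding E_def Bx_def by (intro bounded_linear_image bounded_box) (use lin in \<open>simp add: linear_conv_bounded_linear\<close>)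
  have AE: "(\<lambda>x. A *v x) ` E = Bx" by (auto simp: E_def Ag image_image)
  have "measure lebesgue Bx = \<bar>Determinants.det A\<bar> * measure lebesgue E"
    using measure_linear_image[OF lin(2) E] unfolding AE by simp
  moreover have "measure lebesgue Bx = (\<Prod>i\<in>UNIV. c i)"
  proof -
    have "measure lebesgue Bx = measure lborel Bx" by (simp add: Bx_def)
    also have "\<dots> = (\<Prod>i\<in>UNIV. c i)"
    proof -
      have "measure lborel Bx = measure lborel (cbox (\<chi> i. - (c i / 2)) (\<chi> i. c i / 2))"
        unfolding Bx_def by (simp add: measure_lborel_box_eq measure_lborel_cbox_eq)
      also have "\<dots> = (\<Prod>i\<in>UNIV. c i)"
      proof (subst content_cbox_cart)
        have "- (c i / 2) \<le> c i / 2" for i using c[of i] by simp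
        thus "cbox (\<chi> i. - (c i / 2)) (\<chi> i. c i / 2) \<noteq> {}"
          by (auto simp: interval_eq_empty_cart not_less)
      qed simp
      finally show ?thesis .
    qed
    finally show ?thesis .
  qed
  ultimately have "measure lebesgue E > 1"
    using lt det by (metis abs_ge_zero abs_not_less_zero linorder_not_le mult.right_neutral mult_left_mono)
  then obtain x y where xy: "x \<in> E" "y \<in> E" "x \<noteq> y" "\<And>i. vec_nth x i - vec_nth y i \<in> \<int>"
    using blichfeldt[OF E bdd] by blast
  have "\<exists>n. vec_nth x i - vec_nth y i = of_int n" for i using xy(4)[of i] by (auto elim: Ints_cases)
  then obtain m where m: "\<And>i. vec_nth x i - vec_nth y i = of_int (m i)" by metis
  show ?thesis
  proof (rule that[of m])
    show "\<exists>j. m j \<noteq> 0"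
    proof (rule ccontr)
      assume "\<not> ?thesis"
      hence "vec_nth x i = vec_nth y i" for i using m[of i] by simp
      hence "x = y" by (simp add: Finite_Cartesian_Product.vec_eq_iff)
      thus False using xy(3) by blast
    qed
    fix i
    have "(\<Sum>j\<in>UNIV. vec_nth (vec_nth A i) j * of_int (m j)) = vec_nth (A *v x) i - vec_nth (A *v y) i"
      by (simp add: matrix_vector_mult_def sum_subtractf algebra_simps flip: m)
    moreover have "A *v x \<in> Bx" "A *v y \<in> Bx" using xy AE by blast+
    hence "- (c i / 2) < vec_nth (A *v x) i \<and> vec_nth (A *v x) i < c i / 2"
      "- (c i / 2) < vec_nth (A *v y) i \<and> vec_nth (A *v y) i < c i / 2"
      unfolding Bx_def mem_box_cart vec_lambda_beta by blast+
    ultimately show "\<bar>\<Sum>j\<in>UNIV. vec_nth (vec_nth A i) j * of_int (m j)\<bar> < c i" by linarith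
  qed
qed

text \<open>Translates the index type with elements 1, 2, 3, 4 (where 4 equals 0) into the matrix
  indices from 0 to 3, matching the enumeration \<open>UNIV_4\<close>.\<close>

definition idx4 :: "4 \<Rightarrow> nat" where
  "idx4 i = (if i = 1 then 0 else if i = 2 then 1 else if i = 3 then 2 else 3)"

lemma idx4_simps [simp]: "idx4 1 = 0" "idx4 2 = 1" "idx4 3 = 2" "idx4 4 = 3"
  by (simp_all add: idx4_def)

text \<open>Links the determinant used in measure theory with the one of the discriminant, by
  expanding both completely.\<close>

lemma det_cart_4:
  fixes f :: "nat \<times> nat \<Rightarrow> 'a :: comm_ring_1"
  shows "Determinants.det (\<chi> i j. f (idx4 i, idx4 j) :: 'a ^ 4 ^ 4) = det (mat 4 4 f)"
proof -
  have f1234: "finite {2::4, 3, 4}" "1 \<notin> {2::4, 3, 4}" by auto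
  have f234: "finite {3::4, 4}" "2 \<notin> {3::4, 4}" by auto
  have f34: "finite {4::4}" "3 \<notin> {4::4}" by auto
  show ?thesis
    unfolding Determinants.det_def UNIV_4
    unfolding sum_over_permutations_insert[OF f1234]
    unfolding sum_over_permutations_insert[OF f234]
    unfolding sum_over_permutations_insert[OF f34]
    unfolding permutes_sing det_mat_4 det_mat_3
    by (simp add: sign_swap_id permutation_swap_id permutation_compose sign_compose sign_id transpose_def)
       (simp add: algebra_simps numeral_2_eq_2 numeral_3_eq_3)
qed

lemma minkowski_4:
  fixes a :: "nat \<Rightarrow> nat \<Rightarrow> real" and c :: "nat \<Rightarrow> real"
  assumes c: "\<And>i. i < 4 \<Longrightarrow> c i > 0" and det: "det (mat 4 4 (\<lambda>(i, j). a i j)) \<noteq> 0"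
    and lt: "\<bar>det (mat 4 4 (\<lambda>(i, j). a i j))\<bar> < c 0 * c 1 * c 2 * c 3"
  obtains m :: "nat \<Rightarrow> int" where "\<exists>j<4. m j \<noteq> 0"
    "\<And>i. i < 4 \<Longrightarrow> \<bar>\<Sum>j<4. a i j * of_int (m j)\<bar> < c i"
proof -
  define A :: "real ^ 4 ^ 4" where "A = (\<chi> i j. (\<lambda>(i, j). a i j) (idx4 i, idx4 j))"
  have dA: "Determinants.det A = det (mat 4 4 (\<lambda>(i, j). a i j))"
    unfolding A_def by (rule det_cart_4)
  have "c (idx4 i) > 0" for i by (intro c) (simp add: idx4_def)
  moreover have "Determinants.det A \<noteq> 0" using det by (simp add: dA)
  moreover have "\<bar>Determinants.det A\<bar> < (\<Prod>i\<in>UNIV. c (idx4 i))"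
    unfolding dA UNIV_4 using lt by (simp add: mult_ac)
  ultimately obtain m where m: "\<exists>j. m j \<noteq> 0"
      "\<And>i. \<bar>\<Sum>j\<in>UNIV. vec_nth (vec_nth A i) j * of_int (m j)\<bar> < c (idx4 i)"
    using minkowski_linear_forms[of "\<lambda>i. c (idx4 i)" A] by blast
  define m' where "m' j = m (if j = 0 then 1 else if j = 1 then 2 else if j = 2 then 3 else 4)" for j :: nat
  have m'idx: "m' (idx4 j) = m j" for j using exhaust_4[of j] by (auto simp: m'_def)
  have lt4: "idx4 j < 4" for j by (simp add: idx4_def)
  show ?thesis
  proof (rule that[of m'])
    show "\<exists>j<4. m' j \<noteq> 0" using m(1) m'idx lt4 by metis
    fix i :: nat assume "i < 4"
    then obtain i' where i': "i = idx4 i'"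
      unfolding less_4_cases by (metis idx4_simps)
    have "(\<Sum>j<4. a i j * of_int (m' j)) = (\<Sum>j\<in>UNIV. vec_nth (vec_nth A i') j * of_int (m j))"
      by (simp add: sum_4_nat sum_4 A_def i' m'_def)
    thus "\<bar>\<Sum>j<4. a i j * of_int (m' j)\<bar> < c i" using m(2)[of i'] i' by simp
  qed
qed

section \<open>Signature and discriminants of depressed quartics\<close>

text \<open>The twelve ordered differences form six pairs of opposite sign, and six signs cancel.
  The left side depends only on the set of roots, so the roots can be renumbered freely.\<close>

lemma disc_set_eq:
  fixes a b c d :: "'a :: comm_ring_1"
  assumes "distinct [a, b, c, d]"
  shows "(\<Prod>z\<in>{a, b, c, d}. \<Prod>w\<in>{a, b, c, d} - {z}. z - w) =
    ((a - b) * (a - c) * (a - d) * (b - c) * (b - d) * (c - d)) ^ 2"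
proof -
  have eqs: "b - a = - (a - b)" "c - a = - (a - c)" "d - a = - (a - d)"
    "c - b = - (b - c)" "d - b = - (b - d)" "d - c = - (c - d)" by simp_all
  have "{a, b, c, d} - {a} = {b, c, d}" "{a, b, c, d} - {b} = {a, c, d}"
    "{a, b, c, d} - {c} = {a, b, d}" "{a, b, c, d} - {d} = {a, b, c}"
    using assms by auto
  hence "(\<Prod>z\<in>{a, b, c, d}. \<Prod>w\<in>{a, b, c, d} - {z}. z - w) =
      ((a - b) * ((a - c) * (a - d))) * (((b - a) * ((b - c) * (b - d))) *
      (((c - a) * ((c - b) * (c - d))) * ((d - a) * ((d - b) * (d - c)))))"
    using assms by (simp del: insert_Diff_single)
  also have "\<dots> = ((a - b) * (a - c) * (a - d) * (b - c) * (b - d) * (c - d)) ^ 2"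
    unfolding eqs by (simp only: power2_eq_square mult_minus_left mult_minus_right minus_minus mult_ac)
  finally show ?thesis .
qed

text \<open>The number of conjugate pairs of nonreal roots is 0, 1 or 2. With none or two pairs the
  product of the root differences is real, so its square could not be negative; exactly one pair
  remains.\<close>

lemma two_real_roots:
  fixes r :: "nat \<Rightarrow> complex"
  assumes inj: "inj_on r {..<4}" and R: "r ` {..<4} = R" and cnj: "\<And>z. z \<in> R \<Longrightarrow> cnj z \<in> R"
    and neg: "((r 1 - r 0) * (r 2 - r 0) * (r 3 - r 0) * (r 2 - r 1) * (r 3 - r 1) * (r 3 - r 2)) ^ 2 =
      of_real x" "x < 0"
  obtains s :: "nat \<Rightarrow> complex" where "inj_on s {..<4}" "\<And>i. i < 4 \<Longrightarrow> s i \<in> R"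
    "s 0 \<in> \<real>" "s 1 \<in> \<real>" "s 3 = cnj (s 2)"
proof -
  have eq4: "{..<4::nat} = {0, 1, 2, 3}" by auto
  have Req: "R = {r 0, r 1, r 2, r 3}" using R by (auto simp: eq4)
  have dist: "distinct [r 0, r 1, r 2, r 3]" using inj by (auto simp: inj_on_def eq4)
  have fin: "finite R" and card: "card R = 4" using Req dist by auto
  define \<Delta> where "\<Delta> = (\<Prod>z\<in>R. \<Prod>w\<in>R - {z}. z - w)"
  have \<Delta>: "\<Delta> = of_real x"
  proof -
    have "\<Delta> = ((r 0 - r 1) * (r 0 - r 2) * (r 0 - r 3) * (r 1 - r 2) * (r 1 - r 3) * (r 2 - r 3)) ^ 2"
      unfolding \<Delta>_def Req by (rule disc_set_eq[OF dist])
    also have "\<dots> = ((r 1 - r 0) * (r 2 - r 0) * (r 3 - r 0) * (r 2 - r 1) * (r 3 - r 1) * (r 3 - r 2)) ^ 2"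
      by (simp add: power_mult_distrib power2_commute)
    finally show ?thesis using neg by simp
  qed
  have not_square: False if sq: "\<Delta> = of_real y ^ 2" for y
  proof -
    have "complex_of_real x = of_real (y ^ 2)" using sq \<Delta> by simp
    hence "x = y ^ 2" by (metis of_real_eq_iff)
    thus False using neg(2) zero_le_power2[of y] by linarith
  qed
  \<comment> \<open>One representative from each pair of nonreal conjugates.\<close>
  define P where "P = {z \<in> R. Im z > 0}"
  have finP: "finite P" using fin by (simp add: P_def)
  have "card (P \<union> cnj ` P) = card P + card (cnj ` P)"
    using finP by (intro card_Un_disjoint) (auto simp: P_def)
  also have "card (cnj ` P) = card P" by (rule card_image) (auto simp: inj_on_def)
  finally have cPP: "card (P \<union> cnj ` P) = 2 * card P" by simp
  have sub: "P \<union> cnj ` P \<subseteq> R" using cnj by (auto simp: P_def)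
  have "2 * card P \<le> 4" using card_mono[OF fin sub] cPP card by simp
  moreover have "card P \<noteq> 0"
  proof
    assume "card P = 0"
    hence "P = {}" using finP by simp
    have real: "Im z = 0" if "z \<in> R" for z
    proof -
      have "\<not> Im z > 0" "\<not> Im (cnj z) > 0" using that cnj[OF that] \<open>P = {}\<close> by (auto simp: P_def)
      thus ?thesis by simp
    qed
    have "r i = of_real (Re (r i))" if "i < 4" for i
      using real[of "r i"] R that by (auto simp: complex_eq_iff)
    note rr = this[of 0] this[of 1] this[of 2] this[of 3]
    define y where "y = (Re (r 1) - Re (r 0)) * (Re (r 2) - Re (r 0)) * (Re (r 3) - Re (r 0)) *
      (Re (r 2) - Re (r 1)) * (Re (r 3) - Re (r 1)) * (Re (r 3) - Re (r 2))"
    have "(r 1 - r 0) * (r 2 - r 0) * (r 3 - r 0) * (r 2 - r 1) * (r 3 - r 1) * (r 3 - r 2) = of_real y"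
      unfolding y_def using rr by simp
    thus False using not_square[of y] \<Delta> neg(1) by simp
  qed
  moreover have "card P \<noteq> 2"
  proof
    assume "card P = 2"
    then obtain z w where P: "P = {z, w}" "z \<noteq> w" by (auto simp: card_2_iff)
    have Im: "Im z > 0" "Im w > 0" using P by (auto simp: P_def)
    have "P \<union> cnj ` P = R" using sub fin cPP \<open>card P = 2\<close> card by (intro card_subset_eq) auto
    hence R4: "R = {z, cnj z, w, cnj w}" using P by auto
    have d: "distinct [z, cnj z, w, cnj w]"
      using Im P(2) by (auto simp: complex_eq_iff)
    \<comment> \<open>The differences within the two pairs are \<open>2 * \<i> * Im z\<close> and
      \<open>2 * \<i> * Im w\<close>; the other four group into two products of a number with its
      complex conjugate.\<close>
    define y where "y = - 4 * Im z * Im w * cmod (z - w) ^ 2 * cmod (z - cnj w) ^ 2"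
    have "(z - cnj z) * (z - w) * (z - cnj w) * (cnj z - w) * (cnj z - cnj w) * (w - cnj w) =
        ((z - cnj z) * (w - cnj w)) * ((z - w) * cnj (z - w)) * ((z - cnj w) * cnj (z - cnj w))"
      by (simp add: mult_ac)
    also have "(z - cnj z) * (w - cnj w) = of_real (- 4 * Im z * Im w)"
      by (simp add: complex_eq_iff)
    also have "(z - w) * cnj (z - w) = of_real (cmod (z - w) ^ 2)"
      by (rule complex_norm_square[symmetric])
    also have "(z - cnj w) * cnj (z - cnj w) = of_real (cmod (z - cnj w) ^ 2)"
      by (rule complex_norm_square[symmetric])
    finally have "(z - cnj z) * (z - w) * (z - cnj w) * (cnj z - w) * (cnj z - cnj w) * (w - cnj w) = of_real y"
      by (simp add: y_def)
    hence "\<Delta> = of_real y ^ 2" unfolding \<Delta>_def R4 disc_set_eq[OF d] by simp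
    thus False by (rule not_square)
  qed
  ultimately have "card P = 1" by linarith
  then obtain z where P: "P = {z}" by (auto simp: card_1_singleton_iff)
  have zR: "z \<in> R" and Imz: "Im z > 0" using P by (auto simp: P_def)
  have "card (R - {z, cnj z}) = 2"
    using fin card zR cnj[OF zR] Imz by (subst card_Diff_subset) (auto simp: complex_eq_iff card_insert_if)
  then obtain a b where ab: "R - {z, cnj z} = {a, b}" "a \<noteq> b" by (auto simp: card_2_iff)
  have real: "u \<in> \<real>" if "u \<in> R - {z, cnj z}" for u
  proof -
    have "u \<notin> P" "cnj u \<notin> P" using that P by auto
    hence "\<not> Im u > 0" "\<not> Im (cnj u) > 0" using that cnj by (auto simp: P_def)
    thus ?thesis by (simp add: complex_is_Real_iff)
  qed
  define s where "s i = (if i = 0 then a else if i = 1 then b else if i = 2 then z else cnj z)" for i :: nat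
  show ?thesis
  proof (rule that[of s])
    have "a \<in> R - {z, cnj z}" "b \<in> R - {z, cnj z}" using ab by auto
    thus "s 0 \<in> \<real>" "s 1 \<in> \<real>" using real by (auto simp: s_def)
    have "z \<noteq> cnj z" using Imz by (auto simp: complex_eq_iff)
    thus "inj_on s {..<4}"
      using \<open>a \<in> R - {z, cnj z}\<close> \<open>b \<in> R - {z, cnj z}\<close> ab(2) by (auto simp: inj_on_def s_def eq4)
    show "s i \<in> R" if "i < 4" for i
      using \<open>a \<in> R - {z, cnj z}\<close> \<open>b \<in> R - {z, cnj z}\<close> zR cnj[OF zR] by (auto simp: s_def)
    show "s 3 = cnj (s 2)" by (simp add: s_def)
  qed
qed

text \<open>For a primitive \<open>y\<close> the number \<open>n\<close> is, up to sign, the index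
  of the order generated by \<open>y\<close> in the ring of integers.\<close>

lemma (in quartic_embeddings) det_powers_integral:
  assumes bs: "integral_basis K bs" and y: "y \<in> \<O>"
  obtains n :: int where "det (emat (powers y)) = det (emat bs) * of_int n"
proof -
  note bs' = integral_coordinates[OF bs]
  have "\<exists>m::nat \<Rightarrow> int. y ^ j = (\<Sum>k<4. of_int (m k) * bs ! k)" for j
    using bs'(4)[OF integers_closed(7)[OF y]] .
  then obtain m :: "nat \<Rightarrow> nat \<Rightarrow> int" where m: "\<And>j. y ^ j = (\<Sum>k<4. of_int (m j k) * bs ! k)"
    by metis
  define C where "C = mat 4 4 (\<lambda>(k, j). m j k)"
  have "det (emat (powers y)) = det (emat bs) * of_rat (det (map_mat of_int C))"
    by (rule det_emat_change)
       (use bs'(2) integers_closed(3) m in \<open>auto simp: C_def simp del: upt_rec_numeral\<close>)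
  also have "det (map_mat of_int C) = (of_int (det C) :: rat)" by simp
  finally show ?thesis by (intro that[of "det C"]) simp
qed

text \<open>The polynomial discriminant of an integral generator is the field discriminant times a
  nonzero square, so its sign is that of the field discriminant.\<close>

lemma (in quartic_field) obtain_signature_2_1:
  assumes neg: "nf_discriminant K < 0"
  obtains \<theta> r where "quartic_embeddings K \<theta> r" "r 0 \<in> \<real>" "r 1 \<in> \<real>" "r 3 = cnj (r 2)"
proof -
  obtain \<theta> where \<theta>: "\<theta> \<in> K" "algebraic_int \<theta>" "\<And>p. degree p < 4 \<Longrightarrow> qeval p \<theta> = 0 \<Longrightarrow> p = 0"
    using obtain_integral_primitive by metis
  have card: "card (conjugates \<theta>) = 4" by (rule card_conjugates[OF \<theta>(1,3)])
  hence "finite (conjugates \<theta>)" by (metis card.infinite zero_neq_numeral)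
  then obtain r where r: "bij_betw r {..<4::nat} (conjugates \<theta>)"
    using ex_bij_betw_nat_finite[of "conjugates \<theta>"] card by (auto simp: lessThan_atLeast0)
  interpret E: quartic_embeddings K \<theta> r
    using \<theta> r by unfold_locales (auto simp: bij_betw_def)
  obtain bs where bs: "integral_basis K bs" "det (E.emat bs) ^ 2 = of_rat (nf_discriminant K)"
    using E.obtain_integral_basis by blast
  have "\<theta> \<in> ring_of_integers K" using \<theta> by (simp add: ring_of_integers_def)
  then obtain n :: int where n: "det (E.emat (E.powers \<theta>)) = det (E.emat bs) * of_int n"
    using E.det_powers_integral[OF bs(1)] by blast
  have "n \<noteq> 0" using n E.det_emat_\<theta> by auto
  define x :: real where "x = of_rat (nf_discriminant K) * of_int n ^ 2"
  have "x < 0" unfolding x_def using neg \<open>n \<noteq> 0\<close> by (simp add: mult_neg_pos)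
  have "((r 1 - r 0) * (r 2 - r 0) * (r 3 - r 0) * (r 2 - r 1) * (r 3 - r 1) * (r 3 - r 2)) ^ 2 =
      det (E.emat (E.powers \<theta>)) ^ 2"
    using \<theta> by (simp add: E.det_emat_powers E.\<sigma>_\<theta>)
  also have "\<dots> = of_real x"
    unfolding n power_mult_distrib bs(2) by (simp add: x_def of_rat_complex_real)
  finally have "((r 1 - r 0) * (r 2 - r 0) * (r 3 - r 0) * (r 2 - r 1) * (r 3 - r 1) * (r 3 - r 2)) ^ 2 =
      of_real x" .
  then obtain s where s: "inj_on s {..<4::nat}" "\<And>i. i < 4 \<Longrightarrow> s i \<in> conjugates \<theta>"
    "s 0 \<in> \<real>" "s 1 \<in> \<real>" "s 3 = cnj (s 2)"
    using two_real_roots[of r "conjugates \<theta>" x] r \<open>x < 0\<close> cnj_conjugates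
    by (auto simp: bij_betw_def)
  have "quartic_embeddings K \<theta> s" using \<theta> s by unfold_locales auto
  thus ?thesis using that s by blast
qed

text \<open>The discriminant of the polynomial \<open>X^4 + a X^2 + b X + c\<close>.\<close>

definition quartic_disc :: "'a :: comm_ring_1 \<Rightarrow> 'a \<Rightarrow> 'a \<Rightarrow> 'a" where
  "quartic_disc a b c = 256 * c ^ 3 - 128 * a ^ 2 * c ^ 2 + 144 * a * b ^ 2 * c - 27 * b ^ 4 +
     16 * a ^ 4 * c - 4 * a ^ 3 * b ^ 2"

text \<open>Writing \<open>s = s0 + s1 = - (s2 + s3)\<close>, \<open>p = s0 * s1\<close>, \<open>t = s2 * s3\<close>, the quartic factors as
  \<open>(X\<^sup>2 - s X + p) (X\<^sup>2 + s X + t)\<close>, and the cross terms multiply to the resultant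
  \<open>2 s\<^sup>2 (p + t) + (p - t)\<^sup>2\<close> of the two factors.\<close>

lemma quartic_disc_roots:
  fixes s0 s1 s2 s3 :: "'a :: comm_ring_1"
  assumes "s0 + s1 + s2 + s3 = 0"
  shows "((s1 - s0) * (s2 - s0) * (s3 - s0) * (s2 - s1) * (s3 - s1) * (s3 - s2)) ^ 2 =
    quartic_disc (s0 * s1 + s0 * s2 + s0 * s3 + s1 * s2 + s1 * s3 + s2 * s3)
      (- (s0 * s1 * s2 + s0 * s1 * s3 + s0 * s2 * s3 + s1 * s2 * s3)) (s0 * s1 * s2 * s3)"
proof -
  define s p t where "s = s0 + s1" and "p = s0 * s1" and "t = s2 * s3"
  have s3: "s3 = - s0 - s1 - s2" using assms by (simp add: algebra_simps eq_neg_iff_add_eq_0)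
  have 1: "(s1 - s0) ^ 2 = s ^ 2 - 4 * p"
    by (simp add: s_def p_def power2_eq_square algebra_simps)
  have 2: "(s3 - s2) ^ 2 = s ^ 2 - 4 * t"
    by (simp add: s_def t_def s3 power2_eq_square algebra_simps)
  have 3: "(s2 - s0) * (s3 - s0) * (s2 - s1) * (s3 - s1) = 2 * s ^ 2 * (p + t) + (p - t) ^ 2"
    by (simp add: s_def p_def t_def s3 power2_eq_square algebra_simps)
  have a: "s0 * s1 + s0 * s2 + s0 * s3 + s1 * s2 + s1 * s3 + s2 * s3 = p + t - s ^ 2"
    by (simp add: s_def p_def t_def s3 power2_eq_square algebra_simps)
  have b: "- (s0 * s1 * s2 + s0 * s1 * s3 + s0 * s2 * s3 + s1 * s2 * s3) = s * (p - t)"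
    by (simp add: s_def p_def t_def s3 power2_eq_square algebra_simps)
  have c: "s0 * s1 * s2 * s3 = p * t" by (simp add: p_def t_def algebra_simps)
  have "((s1 - s0) * (s2 - s0) * (s3 - s0) * (s2 - s1) * (s3 - s1) * (s3 - s2)) ^ 2 =
      (s1 - s0) ^ 2 * (s3 - s2) ^ 2 * ((s2 - s0) * (s3 - s0) * (s2 - s1) * (s3 - s1)) ^ 2"
    by (simp add: power_mult_distrib mult_ac)
  also have "\<dots> = (s ^ 2 - 4 * p) * (s ^ 2 - 4 * t) * (2 * s ^ 2 * (p + t) + (p - t) ^ 2) ^ 2"
    unfolding 1 2 3 ..
  also have "\<dots> = quartic_disc (p + t - s ^ 2) (s * (p - t)) (p * t)"
    unfolding quartic_disc_def
    by (simp add: power2_eq_square power3_eq_cube power4_eq_xxxx algebra_simps)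
  finally show ?thesis unfolding a b c .
qed

section \<open>Small generators\<close>

context quartic_embeddings
begin

lemma \<sigma>_cnj:
  assumes "i < 4" "j < 4" "r j = cnj (r i)" "x \<in> K"
  shows "\<sigma> j x = cnj (\<sigma> i x)"
proof -
  obtain p where p: "x = qeval p \<theta>" using obtain_qeval[OF assms(4)] by metis
  show ?thesis using assms by (simp add: p \<sigma>_poly qeval_cnj)
qed

lemma \<sigma>_real:
  assumes "i < 4" "r i \<in> \<real>" "x \<in> K"
  shows "\<sigma> i x = of_real (Re (\<sigma> i x))"
proof -
  have "cnj (\<sigma> i x) = \<sigma> i x"
    using \<sigma>_cnj[of i i x] assms by (simp add: Reals_cnj_iff)
  thus ?thesis by (simp add: complex_eq_iff)
qed

text \<open>Minkowski's theorem is applied to the trace and to three forms that vanish on the rationals;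
  making the trace smaller than 2 excludes nonzero rational integers, whose trace is divisible
  by 4.\<close>

lemma short_element:
  assumes bs: "integral_basis K bs" and disc: "det (emat bs) ^ 2 = - of_nat q" and q: "q > 0"
    and r: "r 0 \<in> \<real>" "r 1 \<in> \<real>" "r 3 = cnj (r 2)"
  obtains y where "y \<in> \<O>" "\<sigma> 0 y + \<sigma> 1 y + \<sigma> 2 y + \<sigma> 3 y = 0" "y \<notin> \<rat>"
    "\<And>i. i < 4 \<Longrightarrow> cmod (\<sigma> i y) \<le> 10 * real q powr (1/6)"
proof -
  note bs' = integral_coordinates[OF bs]
  have in_K: "bs ! j \<in> K" if "j < 4" for j using bs'(2)[OF that] integers_closed(3) by blast
  \<comment> \<open>The real coordinates: two real embeddings, then real and imaginary part of the
    complex one.\<close>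
  define u where "u i j = (if i = 0 then Re (\<sigma> 0 (bs ! j)) else if i = 1 then Re (\<sigma> 1 (bs ! j))
    else if i = 2 then Re (\<sigma> 2 (bs ! j)) else Im (\<sigma> 2 (bs ! j)))" for i j :: nat
  \<comment> \<open>The first form is the trace; the other three vanish on the rationals.\<close>
  define a where "a i j = (if i = 0 then u 0 j + u 1 j + 2 * u 2 j else if i = 1 then u 0 j - u 1 j
    else if i = 2 then u 0 j + u 1 j - 2 * u 2 j else u 3 j)" for i j :: nat
  \<comment> \<open>\<open>G\<close> recovers the four embeddings from the four forms. Its squared
    determinant is \<open>-1/16\<close>, which turns the discriminant \<open>-q\<close> into squared
    determinant \<open>16 * q\<close> for the forms.\<close>
  define G where "G = mat 4 4 (\<lambda>(i, j). [[1/4, 1/2, 1/4, 0], [1/4, -1/2, 1/4, 0],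
    [1/4, 0, -1/4, \<i>], [1/4, 0, -1/4, -\<i>]] ! i ! j)"
  define L where "L = mat 4 4 (\<lambda>(i, j). a i j)"
  have s: "\<sigma> 0 (bs ! j) = of_real (u 0 j)" "\<sigma> 1 (bs ! j) = of_real (u 1 j)"
      "\<sigma> 2 (bs ! j) = of_real (u 2 j) + \<i> * of_real (u 3 j)"
      "\<sigma> 3 (bs ! j) = of_real (u 2 j) - \<i> * of_real (u 3 j)" if "j < 4" for j
    using \<sigma>_real[of 0 "bs ! j"] \<sigma>_real[of 1 "bs ! j"] \<sigma>_cnj[of 2 3 "bs ! j"] in_K[OF that] r
    by (simp_all add: u_def complex_eq_iff)
  have "emat bs = G * map_mat of_real L"
  proof (rule eq_matI)
    fix i j assume "i < dim_row (G * map_mat of_real L)" "j < dim_col (G * map_mat of_real L)"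
    hence ij: "i < 4" "j < 4" by (auto simp: G_def L_def)
    have "(G * map_mat of_real L) $$ (i, j) =
        (\<Sum>k<4. [[1/4, 1/2, 1/4, 0], [1/4, -1/2, 1/4, 0],
          [1/4, 0, -1/4, \<i>], [1/4, 0, -1/4, -\<i>]] ! i ! k * of_real (a k j))"
      using ij by (simp add: G_def L_def scalar_prod_def lessThan_atLeast0)
    also have "\<dots> = \<sigma> i (bs ! j)"
      using ij(1) s[OF ij(2)] unfolding less_4_cases
      by (elim disjE) (simp_all add: sum_4_nat a_def complex_eq_iff field_simps)
    finally show "emat bs $$ (i, j) = (G * map_mat of_real L) $$ (i, j)"
      using ij by (simp add: emat_def)
  qed (auto simp: G_def L_def emat_def)
  hence "det (emat bs) = det G * det (map_mat of_real L)"
    by (simp add: det_mult[of _ 4] G_def L_def)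
  also have "det (map_mat of_real L) = complex_of_real (det L)"
    by (rule of_real_hom.hom_det)
  finally have dE: "det (emat bs) = det G * of_real (det L)" .
  have dG: "det G ^ 2 = - 1 / 16"
    unfolding G_def det_mat_4 det_mat_3 by (simp add: power2_eq_square field_simps)
  have "complex_of_real (det L ^ 2) = of_real (16 * real q)"
    using disc unfolding dE power_mult_distrib dG by simp
  hence dL: "det L ^ 2 = 16 * real q" by (metis of_real_eq_iff)
  define B where "B = real q powr (1/6)"
  have "B > 0" using q by (simp add: B_def)
  have B6: "B ^ 6 = real q" using q by (simp add: B_def powr_power)
  \<comment> \<open>The product of the bounds is \<open>16 * B^3\<close>, which beats the
    determinant \<open>4 * B^3\<close> of the forms.\<close>
  define c where "c i = (if i = 0 then 2 else 2 * B)" for i :: nat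
  have "\<bar>det L\<bar> = 4 * B ^ 3"
  proof -
    have "det L ^ 2 = (4 * B ^ 3) ^ 2" unfolding dL by (simp add: power_mult_distrib B6 flip: power_mult)
    hence "det L = 4 * B ^ 3 \<or> det L = - (4 * B ^ 3)" by (rule power2_eq_iff[THEN iffD1])
    moreover have "4 * B ^ 3 > 0" using \<open>B > 0\<close> by simp
    ultimately show ?thesis by linarith
  qed
  hence dL0: "det L \<noteq> 0" and dLlt: "\<bar>det L\<bar> < c 0 * c 1 * c 2 * c 3"
    using \<open>B > 0\<close> by (auto simp: c_def power3_eq_cube)
  have c_pos: "c i > 0" for i using \<open>B > 0\<close> by (simp add: c_def)
  obtain m :: "nat \<Rightarrow> int" where m: "\<exists>j<4. m j \<noteq> 0"
      "\<And>i. i < 4 \<Longrightarrow> \<bar>\<Sum>j<4. a i j * of_int (m j)\<bar> < c i"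
    using minkowski_4[OF c_pos dL0[unfolded L_def] dLlt[unfolded L_def]] by blast
  define x where "x = (\<Sum>j<4. of_int (m j) * bs ! j)"
  have xO: "x \<in> \<O>" unfolding x_def by (rule sum_integral_combination[OF bs'(2)])
  have xK: "x \<in> K" using xO integers_closed(3) by blast
  define U where "U i = (\<Sum>j<4. u i j * of_int (m j))" for i
  have \<sigma>x: "\<sigma> i x = (\<Sum>j<4. \<sigma> i (bs ! j) * of_int (m j))" if "i < 4" for i
  proof -
    have "\<sigma> i x = (\<Sum>j<4. \<sigma> i (of_int (m j) * bs ! j))"
      unfolding x_def using that in_K closed(8)[of "of_int _"] by (intro \<sigma>_sum) (auto intro!: closed(4))
    also have "\<dots> = (\<Sum>j<4. \<sigma> i (bs ! j) * of_int (m j))"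
      using that in_K closed(8)[of "of_int _"] by (intro sum.cong) (auto simp: \<sigma>_mult \<sigma>_of_int)
    finally show ?thesis .
  qed
  have \<sigma>U: "\<sigma> 0 x = of_real (U 0)" "\<sigma> 1 x = of_real (U 1)"
      "\<sigma> 2 x = of_real (U 2) + \<i> * of_real (U 3)" "\<sigma> 3 x = of_real (U 2) - \<i> * of_real (U 3)"
    by (simp_all add: \<sigma>x s[unfolded One_nat_def] U_def sum.distrib sum_subtractf sum_distrib_left algebra_simps)
  have L: "\<bar>U 0 + U 1 + 2 * U 2\<bar> < 2" "\<bar>U 0 - U 1\<bar> < 2 * B"
      "\<bar>U 0 + U 1 - 2 * U 2\<bar> < 2 * B" "\<bar>U 3\<bar> < 2 * B"
    using m(2)[of 0] m(2)[of 1] m(2)[of 2] m(2)[of 3]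
    by (simp_all add: a_def c_def U_def sum.distrib sum_subtractf sum_distrib_left algebra_simps)
  obtain n where n: "nf_trace K x = of_int n"
    using nf_trace_int[OF xK] xO by (auto simp: ring_of_integers_def elim: Ints_cases)
  have "complex_of_real (of_int n) = of_rat (nf_trace K x)" by (simp add: n)
  also have "\<dots> = of_real (U 0 + U 1 + 2 * U 2)"
    by (simp add: nf_trace_eq[OF xK] sum_4_nat \<sigma>U[unfolded One_nat_def])
  finally have nU: "of_int n = U 0 + U 1 + 2 * U 2" by (metis of_real_eq_iff)
  \<comment> \<open>The trace of \<open>x\<close> is \<open>n\<close> and that of 1 is 4, so this
    integer has trace zero; the trace is removed without introducing a denominator.\<close>
  define y where "y = 4 * x - of_int n"
  have yO: "y \<in> \<O>"
    unfolding y_def using integers_closed(1)[of 4] by (intro integers_closed xO) auto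
  have yK: "y \<in> K" using yO integers_closed(3) by blast
  have \<sigma>y: "\<sigma> i y = 4 * \<sigma> i x - of_int n" if "i < 4" for i
  proof -
    have K: "of_int 4 \<in> K" "of_int n \<in> K" using integers_closed(1,3) by blast+
    have "\<sigma> i (of_int 4 * x - of_int n) = of_int 4 * \<sigma> i x - of_int n"
      using that K xK by (simp only: \<sigma>_diff \<sigma>_mult \<sigma>_of_int closed(4))
    thus ?thesis by (simp add: y_def)
  qed
  have nc: "complex_of_int n = of_real (U 0) + of_real (U 1) + 2 * of_real (U 2)"
    using arg_cong[OF nU, of complex_of_real] by simp
  have y0: "\<sigma> 0 y = of_real ((U 0 + U 1 - 2 * U 2) + 2 * (U 0 - U 1))"
    and y1: "\<sigma> 1 y = of_real ((U 0 + U 1 - 2 * U 2) - 2 * (U 0 - U 1))"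
    and y2: "\<sigma> 2 y = of_real (- (U 0 + U 1 - 2 * U 2)) + \<i> * of_real (4 * U 3)"
    and y3: "\<sigma> 3 y = of_real (- (U 0 + U 1 - 2 * U 2)) - \<i> * of_real (4 * U 3)"
    by (simp_all add: \<sigma>y \<sigma>U[unfolded One_nat_def] nc algebra_simps)
  have b01: "cmod (\<sigma> 0 y) \<le> 10 * B \<and> cmod (\<sigma> 1 y) \<le> 10 * B"
  proof -
    have "\<bar>P + 2 * Q\<bar> \<le> 10 * B \<and> \<bar>P - 2 * Q\<bar> \<le> 10 * B" if "\<bar>P\<bar> < 2 * B" "\<bar>Q\<bar> < 2 * B" for P Q
      using that \<open>B > 0\<close> by linarith
    thus ?thesis unfolding y0 y1 norm_of_real using L(2,3) by blast
  qed
  \<comment> \<open>The real part is below \<open>2 * B\<close> and the imaginary part below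
    \<open>8 * B\<close>; this is the source of the constant 10.\<close>
  have b2: "cmod (of_real (- (U 0 + U 1 - 2 * U 2))) + cmod (\<i> * of_real (4 * U 3)) \<le> 10 * B"
    unfolding norm_mult norm_of_real norm_ii using L(3,4) \<open>B > 0\<close> by linarith
  have b23: "cmod (\<sigma> 2 y) \<le> 10 * B" "cmod (\<sigma> 3 y) \<le> 10 * B"
    unfolding y2 y3 using b2 norm_triangle_ineq norm_triangle_ineq4 order_trans by blast+
  show ?thesis
  proof (rule that[OF yO])
    show sum0: "\<sigma> 0 y + \<sigma> 1 y + \<sigma> 2 y + \<sigma> 3 y = 0"
      unfolding y0 y1 y2 y3 by (simp add: algebra_simps)
    show "cmod (\<sigma> i y) \<le> 10 * real q powr (1/6)" if "i < 4" for i
      using that b01 b23 unfolding less_4_cases B_def by auto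
    show "y \<notin> \<rat>"
    proof
      assume "y \<in> \<rat>"
      then obtain b where b: "y = of_rat b" by (elim Rats_cases)
      hence "4 * of_rat b = (0 :: complex)" using sum0 by (simp add: \<sigma>_of_rat)
      hence "y = 0" using b by simp
      hence "x = of_rat (of_int n / 4)" by (simp add: y_def of_rat_divide mult.commute)
      moreover from this have "algebraic_int (of_rat (of_int n / 4) :: complex)"
        using xO by (simp add: ring_of_integers_def)
      then obtain k where k: "of_int n / 4 = (of_int k :: rat)" by (rule algebraic_int_of_rat)
      hence "(of_int n :: rat) = of_int (4 * k)" by simp
      hence "n = 4 * k" by (metis of_int_eq_iff)
      moreover have "\<bar>real_of_int n\<bar> < 2" using L(1) nU by simp
      hence "\<bar>n\<bar> < 2" by linarith
      ultimately have "x = 0" by simp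
      hence "(\<Sum>j<4. of_rat (of_int (m j)) * bs ! j) = 0" by (simp add: x_def)
      from combination_eq_0[OF bs'(3) in_K this] show False using m(1) by auto
    qed
  qed
qed

text \<open>The coefficients are elementary symmetric functions of the conjugates: algebraic
  integers, and rational by Newton's identities because power sums are traces. Their numbers of
  terms, 6, 4 and 1, give the constants in the bounds.\<close>

lemma trace_zero_charpoly:
  assumes bs: "integral_basis K bs" and disc: "det (emat bs) ^ 2 = - of_nat q"
    and y: "y \<in> \<O>" and sum0: "\<sigma> 0 y + \<sigma> 1 y + \<sigma> 2 y + \<sigma> 3 y = 0"
    and R: "\<And>i. i < 4 \<Longrightarrow> cmod (\<sigma> i y) \<le> R"
  obtains a b c :: int where "y ^ 4 + of_int a * y ^ 2 + of_int b * y + of_int c = 0"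
    "\<bar>real_of_int a\<bar> \<le> 6 * R ^ 2" "\<bar>real_of_int b\<bar> \<le> 4 * R ^ 3" "\<bar>real_of_int c\<bar> \<le> R ^ 4"
    "int q dvd quartic_disc a b c"
proof -
  have yK: "y \<in> K" using y integers_closed(3) by blast
  define s0 s1 s2 s3 where s_def: "s0 = \<sigma> 0 y" "s1 = \<sigma> 1 y" "s2 = \<sigma> 2 y" "s3 = \<sigma> 3 y"
  have s3: "s3 = - s0 - s1 - s2"
    using sum0 by (simp add: s_def algebra_simps eq_neg_iff_add_eq_0)
  have alg: "algebraic_int s0" "algebraic_int s1" "algebraic_int s2" "algebraic_int s3"
    using y by (auto simp: s_def ring_of_integers_def intro!: \<sigma>_algebraic_int)
  have tr: "s0 ^ k + s1 ^ k + s2 ^ k + s3 ^ k \<in> \<rat>" for k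
  proof -
    have "of_rat (nf_trace K (y ^ k)) = s0 ^ k + s1 ^ k + s2 ^ k + s3 ^ k"
      using yK by (simp add: nf_trace_eq power_in sum_4_nat \<sigma>_power s_def)
    thus ?thesis by (metis Rats_of_rat)
  qed
  define e2 where "e2 = s0 * s1 + s0 * s2 + s0 * s3 + s1 * s2 + s1 * s3 + s2 * s3"
  define e3 where "e3 = s0 * s1 * s2 + s0 * s1 * s3 + s0 * s2 * s3 + s1 * s2 * s3"
  define e4 where "e4 = s0 * s1 * s2 * s3"
  \<comment> \<open>Newton's identities with vanishing first symmetric function: the power sums of
    order 2, 3, 4 are \<open>-2 e2\<close>, \<open>3 e3\<close> and
    \<open>2 e2^2 - 4 e4\<close>.\<close>
  have "e2 = - (s0 ^ 2 + s1 ^ 2 + s2 ^ 2 + s3 ^ 2) / 2"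
    by (simp add: e2_def s3 power2_eq_square field_simps)
  also have "\<dots> \<in> \<rat>" by (intro Rats_divide Rats_minus_iff[THEN iffD2] tr Rats_number_of)
  finally have r2: "e2 \<in> \<rat>" .
  have "e3 = (s0 ^ 3 + s1 ^ 3 + s2 ^ 3 + s3 ^ 3) / 3"
    by (simp add: e3_def s3 power3_eq_cube field_simps)
  also have "\<dots> \<in> \<rat>" by (intro Rats_divide tr Rats_number_of)
  finally have r3: "e3 \<in> \<rat>" .
  have "e4 = (2 * e2 ^ 2 - (s0 ^ 4 + s1 ^ 4 + s2 ^ 4 + s3 ^ 4)) / 4"
    by (simp add: e4_def e2_def s3 power2_eq_square power4_eq_xxxx field_simps)
  also have "\<dots> \<in> \<rat>"
    by (intro Rats_divide Rats_diff Rats_mult Rats_power r2 tr Rats_number_of)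
  finally have r4: "e4 \<in> \<rat>" .
  have "algebraic_int e2" "algebraic_int e3" "algebraic_int e4"
    unfolding e2_def e3_def e4_def by (intro algebraic_int_add algebraic_int_mult alg)+
  hence "e2 \<in> \<int>" "e3 \<in> \<int>" "e4 \<in> \<int>" using r2 r3 r4 by (auto intro: rational_algebraic_int_is_int)
  then obtain a b' c where abc: "e2 = of_int a" "e3 = of_int b'" "e4 = of_int c"
    by (elim Ints_cases) blast
  define b where "b = - b'"
  have e3b: "e3 = - of_int b" by (simp add: abc b_def)
  note R' = R[of 0] R[of 1] R[of 2] R[of 3]
  have R0: "R \<ge> 0" using R'(1) norm_ge_zero[of "\<sigma> 0 y"] by linarith
  have R1: "cmod s0 \<le> R" "cmod s1 \<le> R" "cmod s2 \<le> R" "cmod s3 \<le> R" using R' by (simp_all add: s_def)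
  have prod2: "cmod (u * v) \<le> R ^ 2" if "cmod u \<le> R" "cmod v \<le> R" for u v
    using that R0 by (simp add: norm_mult power2_eq_square mult_mono)
  have prod3: "cmod (u * v * w) \<le> R ^ 3" if "cmod u \<le> R" "cmod v \<le> R" "cmod w \<le> R" for u v w
    using mult_mono[OF prod2[OF that(1,2)] that(3)] R0 by (simp add: norm_mult power2_eq_square power3_eq_cube)
  show ?thesis
  proof (rule that[of a b c])
    have "s0 ^ 4 + e2 * s0 ^ 2 - e3 * s0 + e4 = 0"
      by (simp add: e2_def e3_def e4_def s3 power2_eq_square power4_eq_xxxx algebra_simps)
    hence "s0 ^ 4 + of_int a * s0 ^ 2 + of_int b * s0 + of_int c = 0"
      by (simp add: abc(1,3) e3b)
    \<comment> \<open>The equation holds for the conjugate \<open>s0\<close>; injectivity of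
      \<open>\<sigma> 0\<close> transfers it to \<open>y\<close>.\<close>
    moreover have "\<sigma> 0 (y ^ 4 + of_int a * y ^ 2 + of_int b * y + of_int c) =
        s0 ^ 4 + of_int a * s0 ^ 2 + of_int b * s0 + of_int c"
    proof -
      have K: "of_int k \<in> K" for k using integers_closed(1,3) by blast
      show ?thesis using yK K by (simp add: \<sigma>_add \<sigma>_mult \<sigma>_power \<sigma>_of_int power_in closed s_def)
    qed
    moreover have "y ^ 4 + of_int a * y ^ 2 + of_int b * y + of_int c \<in> K"
      using integers_closed(1,3) yK by (intro closed power_in) blast+
    ultimately show "y ^ 4 + of_int a * y ^ 2 + of_int b * y + of_int c = 0"
      using \<sigma>_eq_0[of 0] by simp
    have "\<bar>real_of_int a\<bar> = cmod e2" by (simp add: abc)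
    also have "\<dots> \<le> cmod (s0 * s1) + cmod (s0 * s2) + cmod (s0 * s3) + cmod (s1 * s2) +
        cmod (s1 * s3) + cmod (s2 * s3)"
      unfolding e2_def by (intro norm_triangle_le add_right_mono order_refl)
    also have "\<dots> \<le> 6 * R ^ 2"
      using prod2[OF R1(1) R1(2)] prod2[OF R1(1) R1(3)] prod2[OF R1(1) R1(4)]
        prod2[OF R1(2) R1(3)] prod2[OF R1(2) R1(4)] prod2[OF R1(3) R1(4)] by linarith
    finally show "\<bar>real_of_int a\<bar> \<le> 6 * R ^ 2" .
    have "\<bar>real_of_int b\<bar> = cmod e3" by (simp add: abc b_def)
    also have "\<dots> \<le> cmod (s0 * s1 * s2) + cmod (s0 * s1 * s3) + cmod (s0 * s2 * s3) + cmod (s1 * s2 * s3)"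
      unfolding e3_def by (intro norm_triangle_le add_right_mono order_refl)
    also have "\<dots> \<le> 4 * R ^ 3"
      using prod3[OF R1(1) R1(2) R1(3)] prod3[OF R1(1) R1(2) R1(4)] prod3[OF R1(1) R1(3) R1(4)]
        prod3[OF R1(2) R1(3) R1(4)] by linarith
    finally show "\<bar>real_of_int b\<bar> \<le> 4 * R ^ 3" .
    have "\<bar>real_of_int c\<bar> = cmod e4" by (simp add: abc)
    also have "\<dots> = cmod (s0 * s1) * cmod (s2 * s3)" by (simp add: e4_def norm_mult)
    also have "\<dots> \<le> R ^ 2 * R ^ 2"
      using R1 by (intro mult_mono prod2) auto
    finally show "\<bar>real_of_int c\<bar> \<le> R ^ 4" by (simp flip: power_add)
    obtain n :: int where n: "det (emat (powers y)) = det (emat bs) * of_int n"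
      using det_powers_integral[OF bs y] by blast
    have "complex_of_int (quartic_disc a b c) = quartic_disc e2 (- e3) e4"
      unfolding quartic_disc_def abc(1,3) e3b by simp
    also have "\<dots> = det (emat (powers y)) ^ 2"
      unfolding det_emat_powers[OF yK] s_def[symmetric] e2_def e3_def e4_def
      by (rule quartic_disc_roots[symmetric]) (use sum0 in \<open>simp add: s_def\<close>)
    also have "\<dots> = of_int (- (int q * n ^ 2))"
      unfolding n power_mult_distrib disc by simp
    finally have "quartic_disc a b c = - (int q * n ^ 2)" by (metis of_int_eq_iff)
    thus "int q dvd quartic_disc a b c" by simp
  qed
qed

end

text \<open>The constants are \<open>6 * 10^2\<close>, \<open>4 * 10^3\<close> and
  \<open>10^4\<close>, from conjugates of size at most \<open>10 * q^(1/6)\<close>.\<close>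

lemma (in quartic_field) small_generator:
  assumes q: "prime q" and disc: "nf_discriminant K = of_int (- int q)"
  obtains y and a b c :: int where "y \<in> K" "\<And>p. degree p < 4 \<Longrightarrow> qeval p y = 0 \<Longrightarrow> p = 0"
    "y ^ 4 + of_int a * y ^ 2 + of_int b * y + of_int c = 0"
    "\<bar>real_of_int a\<bar> \<le> 600 * real q powr (1/3)" "\<bar>real_of_int b\<bar> \<le> 4000 * real q powr (1/2)"
    "\<bar>real_of_int c\<bar> \<le> 10000 * real q powr (2/3)" "int q dvd quartic_disc a b c"
proof -
  have "q > 0" using q by (simp add: prime_gt_0_nat)
  have "nf_discriminant K < 0" using disc \<open>q > 0\<close> by simp
  then obtain \<theta> r where "quartic_embeddings K \<theta> r" and r: "r 0 \<in> \<real>" "r 1 \<in> \<real>" "r 3 = cnj (r 2)"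
    using obtain_signature_2_1 by blast
  then interpret E: quartic_embeddings K \<theta> r by simp
  obtain bs where bs: "integral_basis K bs" and d0: "det (E.emat bs) ^ 2 = of_rat (nf_discriminant K)"
    using E.obtain_integral_basis by blast
  have d: "det (E.emat bs) ^ 2 = - of_nat q" using d0 by (simp add: disc of_rat_minus)
  define R where "R = 10 * real q powr (1/6)"
  obtain y where y: "y \<in> ring_of_integers K" "E.\<sigma> 0 y + E.\<sigma> 1 y + E.\<sigma> 2 y + E.\<sigma> 3 y = 0"
      "y \<notin> \<rat>" "\<And>i. i < 4 \<Longrightarrow> cmod (E.\<sigma> i y) \<le> R"
    using E.short_element[OF bs d \<open>q > 0\<close> r] unfolding R_def by blast
  have yK: "y \<in> K" using y(1) by (simp add: ring_of_integers_def)
  obtain a b c where abc: "y ^ 4 + of_int a * y ^ 2 + of_int b * y + of_int c = 0"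
    "\<bar>real_of_int a\<bar> \<le> 6 * R ^ 2" "\<bar>real_of_int b\<bar> \<le> 4 * R ^ 3" "\<bar>real_of_int c\<bar> \<le> R ^ 4"
    "int q dvd quartic_disc a b c"
    using E.trace_zero_charpoly[OF bs d y(1,2,4)] by blast
  have R_pow: "R ^ k = 10 ^ k * real q powr (real k / 6)" for k
    using \<open>q > 0\<close> by (simp add: R_def power_mult_distrib powr_power)
  have prim: "p = 0" if p: "degree p < 4" "qeval p y = 0" for p
  proof (rule ccontr)
    assume "p \<noteq> 0"
    obtain s t where st: "y ^ 2 = of_rat s * y + of_rat t"
      using quadratic_relation[OF yK \<open>p \<noteq> 0\<close> p] by blast
    \<comment> \<open>Completing the square turns a quadratic \<open>y\<close> into an element with
      rational square, which \<open>no_sqrt\<close> forces to be rational.\<close>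
    define \<delta> where "\<delta> = of_rat 2 * y - of_rat s"
    have "\<delta> \<in> K" unfolding \<delta>_def by (intro closed yK)
    have "\<delta> ^ 2 = 4 * y ^ 2 - 4 * of_rat s * y + of_rat s ^ 2"
      by (simp add: \<delta>_def power2_eq_square algebra_simps)
    also have "\<dots> = of_rat (4 * t + s ^ 2)"
      unfolding st by (simp add: of_rat_add of_rat_mult of_rat_power algebra_simps)
    finally have "\<delta> ^ 2 = of_rat (4 * t + s ^ 2)" .
    moreover have "det (E.emat bs) ^ 2 = of_int (- int q)" using d by simp
    moreover have "prime \<bar>- int q\<bar>" using q by simp
    ultimately have "\<delta> \<in> \<rat>" using E.no_sqrt[OF bs] r(1) \<open>\<delta> \<in> K\<close> by blast
    hence "(\<delta> + of_rat s) / 2 \<in> \<rat>" by simp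
    moreover have "(\<delta> + of_rat s) / 2 = y" by (simp add: \<delta>_def)
    ultimately show False using y(3) by simp
  qed
  show ?thesis
  proof (rule that[OF yK prim abc(1)])
    show "\<bar>real_of_int a\<bar> \<le> 600 * real q powr (1/3)" using abc(2) by (simp add: R_pow)
    show "\<bar>real_of_int b\<bar> \<le> 4000 * real q powr (1/2)" using abc(3) by (simp add: R_pow)
    show "\<bar>real_of_int c\<bar> \<le> 10000 * real q powr (2/3)" using abc(4) by (simp add: R_pow)
  qed (use abc(5) in auto)
qed

section \<open>Counting\<close>

lemma (in quartic_field) generated_by:
  assumes y: "y \<in> K" and prim: "\<And>p. degree p < 4 \<Longrightarrow> qeval p y = 0 \<Longrightarrow> p = 0"
  shows "K = range (\<lambda>p. qeval p y)"
  using primitive_range[OF assms] closed(9)[OF y] by blast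

text \<open>A monic quartic vanishing at an element of degree at least four divides every rational
  polynomial vanishing there, so its other roots are conjugates.\<close>

lemma conjugate_of_same_quartic:
  assumes prim: "\<And>p. degree p < 4 \<Longrightarrow> qeval p y = 0 \<Longrightarrow> p = 0"
    and y: "y ^ 4 + of_int a * y ^ 2 + of_int b * y + of_int c = 0"
    and z: "z ^ 4 + of_int a * z ^ 2 + of_int b * z + of_int c = 0"
  shows "z \<in> conjugates y"
proof -
  define f :: "rat poly" where "f = [:of_int c, of_int b, of_int a, 0, 1:]"
  have f: "qeval f w = w ^ 4 + of_int a * w ^ 2 + of_int b * w + of_int c" for w
    by (simp add: f_def algebra_simps power2_eq_square power4_eq_xxxx)
  have df: "degree f = 4" by (simp add: f_def)
  have "qeval p z = 0" if "qeval p y = 0" for p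
  proof -
    have eq: "qeval p w = qeval f w * qeval (p div f) w + qeval (p mod f) w" for w
      by (metis mult_div_mod_eq qeval_add qeval_mult)
    have "qeval (p mod f) y = 0" using eq[of y] that y by (simp add: f)
    moreover have "degree (p mod f) < 4"
      using degree_mod_less'[of f p] df by (cases "p mod f = 0"; cases "f = 0") auto
    ultimately have "p mod f = 0" using prim by blast
    thus ?thesis using eq[of z] z by (simp add: f)
  qed
  thus ?thesis by (simp add: conjugates_def)
qed

lemma number_fields_iso:
  assumes K: "K = range (\<lambda>p. qeval p y)" and L: "L = range (\<lambda>p. qeval p z)"
    and yz: "z \<in> conjugates y" "y \<in> conjugates z"
  shows "complex_field\<lparr>carrier := K\<rparr> \<simeq> complex_field\<lparr>carrier := L\<rparr>"
proof -
  define h where "h = emb y z"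
  have h: "h (qeval p y) = qeval p z" for p unfolding h_def by (rule emb_qeval[OF yz(1)])
  have "h \<in> ring_iso (complex_field\<lparr>carrier := K\<rparr>) (complex_field\<lparr>carrier := L\<rparr>)"
  proof (rule ring_iso_memI)
    show "h \<one>\<^bsub>complex_field\<lparr>carrier := K\<rparr>\<^esub> = \<one>\<^bsub>complex_field\<lparr>carrier := L\<rparr>\<^esub>"
      using h[of 1] by (simp add: ring_of_type_algebra_def)
    have "inj_on h K"
    proof (rule inj_onI)
      fix u v assume "u \<in> K" "v \<in> K" "h u = h v"
      then obtain p p' where p: "u = qeval p y" "v = qeval p' y" by (auto simp: K)
      hence "qeval (p - p') z = 0" using \<open>h u = h v\<close> by (simp add: h)
      hence "qeval (p - p') y = 0" using yz(2) unfolding conjugates_def by blast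
      thus "u = v" by (simp add: p)
    qed
    moreover have "h ` K = L" by (simp add: K L image_image h)
    ultimately show "bij_betw h (carrier (complex_field\<lparr>carrier := K\<rparr>)) (carrier (complex_field\<lparr>carrier := L\<rparr>))"
      by (simp add: bij_betw_def)
  next
    fix u assume "u \<in> carrier (complex_field\<lparr>carrier := K\<rparr>)"
    thus "h u \<in> carrier (complex_field\<lparr>carrier := L\<rparr>)" by (auto simp: K L h)
  next
    fix u v assume "u \<in> carrier (complex_field\<lparr>carrier := K\<rparr>)" "v \<in> carrier (complex_field\<lparr>carrier := K\<rparr>)"
    then obtain p p' where p: "u = qeval p y" "v = qeval p' y" by (auto simp: K)
    have "h (u * v) = h u * h v" using h[of "p * p'"] by (simp add: p h)
    moreover have "h (u + v) = h u + h v" using h[of "p + p'"] by (simp add: p h)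
    ultimately show "h (u \<otimes>\<^bsub>complex_field\<lparr>carrier := K\<rparr>\<^esub> v) = h u \<otimes>\<^bsub>complex_field\<lparr>carrier := L\<rparr>\<^esub> h v"
      "h (u \<oplus>\<^bsub>complex_field\<lparr>carrier := K\<rparr>\<^esub> v) = h u \<oplus>\<^bsub>complex_field\<lparr>carrier := L\<rparr>\<^esub> h v"
      by (simp_all add: ring_of_type_algebra_def)
  qed
  thus ?thesis by (auto simp: is_ring_iso_def)
qed

lemma nf_iso_class_eq:
  assumes "number_field K" "number_field L"
    and iso: "complex_field\<lparr>carrier := K\<rparr> \<simeq> complex_field\<lparr>carrier := L\<rparr>"
  shows "nf_iso `` {K} = nf_iso `` {L}"
proof -
  interpret ring complex_field by (rule ring_from_type_algebra)
  have "ring (complex_field\<lparr>carrier := K\<rparr>)"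
    using assms(1) by (intro subring_is_ring subfieldE(1)) (simp add: number_field_def)
  hence iso': "complex_field\<lparr>carrier := L\<rparr> \<simeq> complex_field\<lparr>carrier := K\<rparr>"
    using iso by (rule ring_iso_sym)
  show ?thesis
    using assms(1,2) ring_iso_trans[OF iso] ring_iso_trans[OF iso']
    unfolding nf_iso_def by blast
qed

text \<open>As a polynomial in \<open>c\<close> the discriminant is cubic with leading coefficient
  256, a unit modulo an odd prime. The bound on differences makes distinct elements of
  \<open>S\<close> incongruent modulo \<open>q\<close>. Divided differences at four roots end with
  \<open>q\<close> dividing a power of 2.\<close>

lemma at_most_3_roots:
  fixes q a b :: int and S :: "int set"
  assumes q: "prime q" "q \<noteq> 2" and S: "\<And>c. c \<in> S \<Longrightarrow> q dvd quartic_disc a b c"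
    and close: "\<And>c c'. c \<in> S \<Longrightarrow> c' \<in> S \<Longrightarrow> \<bar>c - c'\<bar> < q"
  shows "card S \<le> 3"
proof (rule ccontr)
  assume "\<not> card S \<le> 3"
  hence "4 \<le> card S" by simp
  then obtain T where T: "T \<subseteq> S" "card T = 4" by (metis obtain_subset_with_card_n)
  then obtain c1 c2 c3 c4 where c: "T = {c1, c2, c3, c4}" "distinct [c1, c2, c3, c4]"
    by (auto simp: card_Suc_eq eval_nat_numeral)
  define \<beta> \<gamma> where "\<beta> = - 128 * a ^ 2" and "\<gamma> = 144 * a * b ^ 2 + 16 * a ^ 4"
  have nd: "\<not> q dvd x - y" if "x \<in> T" "y \<in> T" "x \<noteq> y" for x y
  proof
    assume "q dvd x - y"
    hence "q \<le> \<bar>x - y\<bar>" using that by (intro zdvd_imp_le) auto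
    moreover have "\<bar>x - y\<bar> < q" using that T(1) by (intro close) auto
    ultimately show False by simp
  qed
  \<comment> \<open>The first divided difference of the cubic; \<open>\<beta>\<close> and
    \<open>\<gamma>\<close> are its coefficients of \<open>c^2\<close> and \<open>c\<close>.\<close>
  define h where "h x y = 256 * (x ^ 2 + x * y + y ^ 2) + \<beta> * (x + y) + \<gamma>" for x y
  have h: "q dvd h x y" if xy: "x \<in> T" "y \<in> T" "x \<noteq> y" for x y
  proof -
    have "quartic_disc a b x - quartic_disc a b y = (x - y) * h x y"
      by (simp add: quartic_disc_def h_def \<beta>_def \<gamma>_def power2_eq_square power3_eq_cube algebra_simps)
    moreover have "q dvd quartic_disc a b x - quartic_disc a b y"
      using S xy T(1) by (intro dvd_diff) auto
    ultimately have "q dvd (x - y) * h x y" by simp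
    thus ?thesis using nd[OF xy] q(1) by (simp add: prime_dvd_mult_iff)
  qed
  \<comment> \<open>The second divided difference at \<open>c1\<close>, \<open>c2\<close>,
    \<open>z\<close>; the third is the constant 256.\<close>
  define g where "g z = 256 * (c1 + c2 + z) + \<beta>" for z
  have g: "q dvd g z" if z: "z \<in> T" "z \<noteq> c1" "z \<noteq> c2" for z
  proof -
    have "h c1 c2 - h c1 z = (c2 - z) * g z"
      by (simp add: h_def g_def power2_eq_square algebra_simps)
    moreover have "q dvd h c1 c2 - h c1 z"
      using z c by (intro dvd_diff h) auto
    ultimately have "q dvd (c2 - z) * g z" by simp
    thus ?thesis using nd[of c2 z] z c q(1) by (simp add: prime_dvd_mult_iff)
  qed
  have "q dvd g c3 - g c4" using c by (intro dvd_diff g) auto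
  also have "g c3 - g c4 = 2 ^ 8 * (c3 - c4)" by (simp add: g_def)
  finally have "q dvd 2 ^ 8 \<or> q dvd c3 - c4" using q(1) by (simp only: prime_dvd_mult_iff)
  moreover have "\<not> q dvd c3 - c4" using nd c by auto
  ultimately have "q dvd 2" using q(1) prime_dvd_power by blast
  hence "q \<le> 2" by (rule zdvd_imp_le) simp
  thus False using q prime_ge_2_int[of q] by linarith
qed

text \<open>Fibred over \<open>(a, b)\<close>, because the divisibility limits the number of
  \<open>c\<close> for each fixed pair.\<close>

definition small_quartics :: "nat \<Rightarrow> ((int \<times> int) \<times> int) set" where
  "small_quartics q =
    (SIGMA (a, b) : {-\<lfloor>600 * real q powr (1/3)\<rfloor>..\<lfloor>600 * real q powr (1/3)\<rfloor>} \<times>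
                    {-\<lfloor>4000 * real q powr (1/2)\<rfloor>..\<lfloor>4000 * real q powr (1/2)\<rfloor>}.
       {c \<in> {-\<lfloor>10000 * real q powr (2/3)\<rfloor>..\<lfloor>10000 * real q powr (2/3)\<rfloor>}.
          int q dvd quartic_disc a b c})"

text \<open>The additional 1 from counting both ends and zero is absorbed by \<open>x\<close>, which
  is at least 1.\<close>

lemma card_int_interval_le:
  assumes "x \<ge> (1::real)" "C \<ge> 0"
  shows "real (card {-\<lfloor>C * x\<rfloor>..\<lfloor>C * x\<rfloor>}) \<le> (2 * C + 1) * x"
proof -
  have "C * x \<ge> 0" using assms by simp
  hence "0 \<le> \<lfloor>C * x\<rfloor>" by simp
  hence "real (card {-\<lfloor>C * x\<rfloor>..\<lfloor>C * x\<rfloor>}) = 2 * real_of_int \<lfloor>C * x\<rfloor> + 1" by simp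
  also have "\<dots> \<le> 2 * (C * x) + 1" by linarith
  also have "\<dots> \<le> (2 * C + 1) * x" using assms by (simp add: algebra_simps)
  finally show ?thesis .
qed

lemma card_small_quartics:
  fixes k :: real
  assumes q: "q \<ge> 1"
    and k: "\<And>a b. real (card {c \<in> {-\<lfloor>10000 * real q powr (2/3)\<rfloor>..\<lfloor>10000 * real q powr (2/3)\<rfloor>}.
        int q dvd quartic_disc a b c}) \<le> k"
  shows "finite (small_quartics q)" "real (card (small_quartics q)) \<le> 1201 * 8001 * k * real q powr (5/6)"
proof -
  let ?A = "{-\<lfloor>600 * real q powr (1/3)\<rfloor>..\<lfloor>600 * real q powr (1/3)\<rfloor>}"
  let ?B = "{-\<lfloor>4000 * real q powr (1/2)\<rfloor>..\<lfloor>4000 * real q powr (1/2)\<rfloor>}"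
  let ?C = "\<lambda>a b. {c \<in> {-\<lfloor>10000 * real q powr (2/3)\<rfloor>..\<lfloor>10000 * real q powr (2/3)\<rfloor>}.
          int q dvd quartic_disc a b c}"
  have finC: "finite (?C a b)" for a b
    by (rule finite_subset[of _ "{-\<lfloor>10000 * real q powr (2/3)\<rfloor>..\<lfloor>10000 * real q powr (2/3)\<rfloor>}"]) auto
  show "finite (small_quartics q)"
    unfolding small_quartics_def case_prod_beta by (intro finite_SigmaI finC) simp_all
  have k0: "k \<ge> 0" using k[of 0 0] of_nat_0_le_iff order_trans by blast
  have ge1: "real q powr e \<ge> 1" if "e \<ge> 0" for e
    using q that by (intro ge_one_powr_ge_zero) auto
  have "card (small_quartics q) = (\<Sum>x\<in>?A \<times> ?B. card (?C (fst x) (snd x)))"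
    unfolding small_quartics_def case_prod_beta by (intro card_SigmaI ballI finC) simp_all
  hence "real (card (small_quartics q)) = (\<Sum>x\<in>?A \<times> ?B. real (card (?C (fst x) (snd x))))"
    by simp
  also have "\<dots> \<le> (\<Sum>x\<in>?A \<times> ?B. k)" by (intro sum_mono k)
  also have "\<dots> = real (card ?A) * real (card ?B) * k"
    by (simp add: card_cartesian_product)
  also have "\<dots> \<le> ((2 * 600 + 1) * real q powr (1/3)) * ((2 * 4000 + 1) * real q powr (1/2)) * k"
    by (intro mult_right_mono mult_mono card_int_interval_le ge1 k0) auto
  also have "\<dots> = 1201 * 8001 * k * (real q powr (1/3) * real q powr (1/2))" by simp
  also have "real q powr (1/3) * real q powr (1/2) = real q powr (5/6)"
    by (simp flip: powr_add)
  finally show "real (card (small_quartics q)) \<le> 1201 * 8001 * k * real q powr (5/6)" .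
qed

text \<open>The interval for \<open>c\<close> is shorter than \<open>q\<close> as soon as
  \<open>q\<close> exceeds \<open>20000^3 = 8 * 10^12\<close>; the round threshold
  \<open>10^13\<close> is used. Above it at most three \<open>c\<close> remain in each fibre, below
  it all integers of the interval are counted.\<close>

lemma card_small_quartics_le:
  assumes q: "prime q"
  shows "finite (small_quartics q)"
    "real (card (small_quartics q)) \<le> 1201 * 8001 * (20001 * 10 ^ 13) * real q powr (5/6)"
proof -
  have q2: "q \<ge> 2" using q by (simp add: prime_ge_2_nat)
  let ?I = "{-\<lfloor>10000 * real q powr (2/3)\<rfloor>..\<lfloor>10000 * real q powr (2/3)\<rfloor>}"
  have k: "real (card {c \<in> ?I. int q dvd quartic_disc a b c}) \<le> 20001 * 10 ^ 13" for a b
  proof (cases "real q \<le> 10 ^ 13")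
    case True
    have "real (card {c \<in> ?I. int q dvd quartic_disc a b c}) \<le> real (card ?I)"
      by (intro of_nat_mono card_mono) auto
    also have "\<dots> \<le> (2 * 10000 + 1) * real q powr (2/3)"
      using q2 by (intro card_int_interval_le ge_one_powr_ge_zero) auto
    also have "real q powr (2/3) \<le> real q powr 1" using q2 by (intro powr_mono) auto
    also have "\<dots> \<le> 10 ^ 13" using True q2 by simp
    finally show ?thesis by simp
  next
    case False
    have "(20000 :: real) < real q powr (1/3)"
    proof (rule ccontr)
      assume "\<not> ?thesis"
      hence "(real q powr (1/3)) ^ 3 \<le> 20000 ^ 3" by (intro power_mono) auto
      moreover have "(real q powr (1/3)) ^ 3 = real q" using q2 by (simp add: powr_power)
      ultimately show False using False by simp
    qed
    hence "20000 * real q powr (2/3) < real q powr (1/3) * real q powr (2/3)"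
      using q2 by (intro mult_strict_right_mono) auto
    also have "\<dots> = real q" using q2 by (simp flip: powr_add)
    finally have lt: "20000 * real q powr (2/3) < real q" .
    have "card {c \<in> ?I. int q dvd quartic_disc a b c} \<le> 3"
    proof (rule at_most_3_roots)
      show "prime (int q)" using q by simp
      show "int q \<noteq> 2" using False by auto
      fix c c' assume "c \<in> {c \<in> ?I. int q dvd quartic_disc a b c}" "c' \<in> {c \<in> ?I. int q dvd quartic_disc a b c}"
      hence "\<bar>c - c'\<bar> \<le> 2 * \<lfloor>10000 * real q powr (2/3)\<rfloor>" by auto
      also have "\<dots> < int q" using lt by linarith
      finally show "\<bar>c - c'\<bar> < int q" .
    qed auto
    thus ?thesis by simp
  qed
  show "finite (small_quartics q)" "real (card (small_quartics q)) \<le>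
      1201 * 8001 * (20001 * 10 ^ 13) * real q powr (5/6)"
    using card_small_quartics[OF _ k] q2 by auto
qed

text \<open>Each class is sent to the quartic of a small generator of some field in it. This is
  injective: generators with the same quartic are conjugate to each other and generate isomorphic
  fields.\<close>

lemma nf_classes_bound:
  assumes q: "prime q"
  shows "finite (nf_classes 4 (- int q))" "nf_count 4 (- int q) \<le> card (small_quartics q)"
proof -
  define gen where "gen K y a b c \<longleftrightarrow> y \<in> K \<and> (\<forall>p. degree p < 4 \<longrightarrow> qeval p y = 0 \<longrightarrow> p = 0) \<and>
    y ^ 4 + of_int a * y ^ 2 + of_int b * y + of_int c = 0" for K y and a b c :: int
  let ?A = "{K. number_field K \<and> nf_degree K = 4 \<and> nf_discriminant K = of_int (- int q)}"
  \<comment> \<open>Field and quartic are tied in one relation, so that they are chosen together for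
    each class.\<close>
  define rep where "rep V K t \<longleftrightarrow> V = nf_iso `` {K} \<and> K \<in> ?A \<and> t \<in> small_quartics q \<and>
      (\<exists>y. gen K y (fst (fst t)) (snd (fst t)) (snd t))" for V K t
  have "\<exists>K t. rep V K t" if V: "V \<in> nf_classes 4 (- int q)" for V
  proof -
    obtain K where K: "K \<in> ?A" "V = nf_iso `` {K}"
      using V unfolding nf_classes_def quotient_def by blast
    interpret quartic_field K using K by unfold_locales auto
    obtain y a b c where y: "y \<in> K" "\<And>p. degree p < 4 \<Longrightarrow> qeval p y = 0 \<Longrightarrow> p = 0"
      "y ^ 4 + of_int a * y ^ 2 + of_int b * y + of_int c = 0"
      "\<bar>real_of_int a\<bar> \<le> 600 * real q powr (1/3)" "\<bar>real_of_int b\<bar> \<le> 4000 * real q powr (1/2)"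
      "\<bar>real_of_int c\<bar> \<le> 10000 * real q powr (2/3)" "int q dvd quartic_disc a b c"
      using small_generator[OF q] K by blast
    have "x \<in> {-\<lfloor>B\<rfloor>..\<lfloor>B\<rfloor>}" if "\<bar>real_of_int x\<bar> \<le> B" for x B
      using that by (auto simp: abs_le_iff le_floor_iff) linarith
    hence "((a, b), c) \<in> small_quartics q" using y by (simp add: small_quartics_def)
    moreover have "gen K y a b c" using y by (simp add: gen_def)
    ultimately have "rep V K ((a, b), c)" using K by (auto simp: rep_def)
    thus ?thesis by blast
  qed
  then obtain F t where rep: "\<And>V. V \<in> nf_classes 4 (- int q) \<Longrightarrow> rep V (F V) (t V)" by metis
  hence Ft: "\<And>V. \<And>V. V \<in> nf_classes 4 (- int q) \<Longrightarrow> V = nf_iso `` {F V} \<and> F V \<in> ?A \<and>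
      t V \<in> small_quartics q \<and> (\<exists>y. gen (F V) y (fst (fst (t V))) (snd (fst (t V))) (snd (t V)))"
    unfolding rep_def by blast
  have inj: "inj_on t (nf_classes 4 (- int q))"
  proof (rule inj_onI)
    fix V W assume V: "V \<in> nf_classes 4 (- int q)" and W: "W \<in> nf_classes 4 (- int q)" and eq: "t V = t W"
    interpret KV: quartic_field "F V" using Ft[OF V] by unfold_locales auto
    interpret KW: quartic_field "F W" using Ft[OF W] by unfold_locales auto
    obtain a b c where t: "t V = ((a, b), c)" by (metis surj_pair)
    obtain y z where y: "gen (F V) y a b c" and z: "gen (F W) z a b c"
      using Ft[OF V, unfolded t fst_conv snd_conv] Ft[OF W, folded eq, unfolded t fst_conv snd_conv]
      by blast
    have FV: "F V = range (\<lambda>p. qeval p y)" using y by (intro KV.generated_by) (auto simp: gen_def)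
    have FW: "F W = range (\<lambda>p. qeval p z)" using z by (intro KW.generated_by) (auto simp: gen_def)
    have "z \<in> conjugates y" "y \<in> conjugates z"
      using y z by (auto simp: gen_def intro!: conjugate_of_same_quartic[of _ a b c])
    from number_fields_iso[OF FV FW this] have "nf_iso `` {F V} = nf_iso `` {F W}"
      using KV.nf KW.nf by (intro nf_iso_class_eq)
    thus "V = W" using Ft[OF V] Ft[OF W] by metis
  qed
  have sub: "t ` nf_classes 4 (- int q) \<subseteq> small_quartics q" using Ft by blast
  show "finite (nf_classes 4 (- int q))"
    using inj_on_finite[OF inj sub] card_small_quartics_le(1)[OF q] by blast
  show "nf_count 4 (- int q) \<le> card (small_quartics q)"
    unfolding nf_count_def using card_inj_on_le[OF inj sub] card_small_quartics_le(1)[OF q] by blast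
qed

theorem theorem2:
  shows "\<exists>C::real. C > 0 \<and> (\<forall>q::nat. prime q \<longrightarrow>
     finite (nf_classes 4 (- int q)) \<and>
     real (nf_count 4 (- int q)) \<le> C * real q powr (7/8) * ln (real q) ^ 4)"
proof (intro exI[of _ "16 * (1201 * 8001 * (20001 * 10 ^ 13)) :: real"] conjI allI impI)
  define M :: real where "M = 1201 * 8001 * (20001 * 10 ^ 13)"
  have "M > 0" by (simp add: M_def)
  fix q :: nat assume q: "prime q"
  show "finite (nf_classes 4 (- int q))" by (rule nf_classes_bound(1)[OF q])
  have q2: "q \<ge> 2" using q by (simp add: prime_ge_2_nat)
  \<comment> \<open>From \<open>ln 2 >= 1/2\<close> it follows that \<open>16 * ln q ^ 4\<close> is
    at least 1 for every prime; this is the factor 16 in the constant, and it lets the logarithm be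
    inserted for free.\<close>
  have "ln (1 / 2) \<le> 1 / 2 - (1::real)" by (rule ln_le_minus_one) simp
  hence "1 / 2 \<le> ln (2::real)" by (simp add: ln_div)
  also have "\<dots> \<le> ln (real q)" using q2 by simp
  finally have "(1 / 2) ^ 4 \<le> ln (real q) ^ 4" by (intro power_mono) auto
  hence ln4: "1 \<le> 16 * ln (real q) ^ 4" by (simp add: power_divide)
  have "real (nf_count 4 (- int q)) \<le> real (card (small_quartics q))"
    using nf_classes_bound(2)[OF q] by simp
  also have "\<dots> \<le> M * real q powr (5/6)"
    using card_small_quartics_le(2)[OF q] by (simp only: M_def)
  also have "\<dots> \<le> M * real q powr (7/8)"
    using q2 \<open>M > 0\<close> by (intro mult_left_mono powr_mono) auto
  also have "\<dots> \<le> M * real q powr (7/8) * (16 * ln (real q) ^ 4)"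
    using ln4 \<open>M > 0\<close> mult_left_mono[OF ln4, of "M * real q powr (7/8)"] by simp
  also have "\<dots> = 16 * M * real q powr (7/8) * ln (real q) ^ 4" by simp
  finally show "real (nf_count 4 (- int q)) \<le>
      16 * (1201 * 8001 * (20001 * 10 ^ 13)) * real q powr (7/8) * ln (real q) ^ 4"
    by (simp only: M_def)
qed simp

end
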